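(* Let $d,n\ge1$ and let $\mathcal J$ be a poset ideal of $\mathrm{Hom}([d],[n])$. Then $L(\mathcal J)$ has linear resolution. Let $p_2:[d]\times[n]\to[n]$ be the projection, and let $\hat p_2:\Bbbk[x_{[d]\times[n]}]\to\Bbbk[x_{[n]}]=\Bbbk[x_1,\dots,x_n]$ be the $\Bbbk$-algebra map $x_{a,b}\mapsto x_b$. The induced quotient map $$\Bbbk[x_{[d]\times[n]}]/L(\mathcal J)\xrightarrow{\ \hat p_2\ }\Bbbk[x_{[n]}]/L^{p_2}(\mathcal J)$$ is a quotient map by a regular sequence, and $L^{p_2}(\mathcal J)$ is the strongly stable ideal in $\Bbbk[x_1,\ldots,x_n]$ associated to $\mathcal J$.
   Context: $\Bbbk$ is a field and $[n]=\{1<2<\cdots<n\}$ is the chain on $n$ elements. For a set $A$, $\Bbbk[x_A]$ is the polynomial ring in variables $x_a$, $a\in A$. $\mathrm{Hom}([d],[n])$ is the set of isotone (order preserving) maps $[d]\to[n]$, partially ordered by $\phi\le\psi$ iff $\phi(i)\le\psi(i)$ for all $i$. A poset ideal of a poset is a subset $J$ such that $q\in J$ and $p\le q$ imply $p\in J$. $L(\mathcal J)=L([d],n;\mathcal J)\subseteq\Bbbk[x_{[d]\times[n]}]$ is the ideal generated by all monomials $\prod_{i=1}^d x_{i,\phi(i)}$ with $\phi\in\mathcal J$, and $L^{p_2}(\mathcal J)$ is the ideal of $\Bbbk[x_{[n]}]$ generated by its image under $\hat p_2$. Maps $\phi\in\mathrm{Hom}([d],[n])$ correspond bijectively to monomials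 $\prod_{i=1}^d x_{\phi(i)}$ of degree $d$ in $\Bbbk[x_1,\dots,x_n]$. By this, poset ideals $\mathcal J$ correspond bijectively to strongly stable ideals generated in degree $d$: the strongly stable ideal associated to $\mathcal J$ is the one generated by the monomials corresponding to the elements of $\mathcal J$. A monomial ideal $I$ is strongly stable if for every monomial $m$ with $x_jm\in I$ and every $i<j$ one has $x_im\in I$. A homogeneous ideal generated in a single degree $d$ has linear resolution if its graded Betti numbers $\beta_{i,j}$ vanish unless $j=i+d$. "A quotient map by a regular sequence" means that the map is surjective with kernel generated by a regular sequence. *)

theory Defs
  imports "HOL-Algebra.QuotRing" "HOL-Library.Poly_Mapping" "HOL-Library.FuncSet"
begin

section \<open>Polynomial rings\<close>

text \<open>
  A polynomial is a finitely supported map from exponent vectors to coefficients; multiplication is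
  the convolution product of \<^theory>\<open>HOL-Library.Poly_Mapping\<close>.
\<close>

type_synonym ('v, 'k) mpoly = "('v \<Rightarrow>\<^sub>0 nat) \<Rightarrow>\<^sub>0 'k"

definition monom :: "('v \<Rightarrow>\<^sub>0 nat) \<Rightarrow> ('v, 'k::field) mpoly" where
  "monom m = Poly_Mapping.single m 1"

definition X :: "'v \<Rightarrow> ('v, 'k::field) mpoly" where
  "X v = monom (Poly_Mapping.single v 1)"

definition vars :: "('v, 'k::field) mpoly \<Rightarrow> 'v set" where
  "vars p = (\<Union>m\<in>Poly_Mapping.keys p. Poly_Mapping.keys m)"

definition mpoly_ring :: "'v set \<Rightarrow> ('v, 'k::field) mpoly ring" where
  "mpoly_ring V = \<lparr>carrier = {p. vars p \<subseteq> V}, mult = (*), one = 1, zero = 0, add = (+)\<rparr>"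

definition mdeg :: "('v \<Rightarrow>\<^sub>0 nat) \<Rightarrow> nat" where
  "mdeg m = (\<Sum>v\<in>Poly_Mapping.keys m. Poly_Mapping.lookup m v)"

definition homogeneous :: "nat \<Rightarrow> ('v, 'k::field) mpoly \<Rightarrow> bool" where
  "homogeneous j p \<longleftrightarrow> (\<forall>m\<in>Poly_Mapping.keys p. mdeg m = j)"

text \<open>The algebra map over the coefficient field with \<open>X v \<mapsto> X (f v)\<close>.\<close>

definition var_hom :: "('v \<Rightarrow> 'w) \<Rightarrow> ('v, 'k::field) mpoly \<Rightarrow> ('w, 'k) mpoly" where
  "var_hom f p = (\<Sum>m\<in>Poly_Mapping.keys p.
     Poly_Mapping.single 0 (Poly_Mapping.lookup p m) *
     (\<Prod>v\<in>Poly_Mapping.keys m. X (f v) ^ Poly_Mapping.lookup m v))"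

lemma vars_add: "vars (p + q) \<subseteq> vars p \<union> vars q"
  unfolding vars_def using Poly_Mapping.keys_add[of p q] by fastforce

lemma vars_uminus: "vars (- p) = vars p"
  unfolding vars_def by (simp add: in_keys_iff)

lemma vars_mult: "vars (p * q) \<subseteq> vars p \<union> vars q"
proof
  fix v assume "v \<in> vars (p * q)"
  then obtain m where m: "m \<in> Poly_Mapping.keys (p * q)" "v \<in> Poly_Mapping.keys m"
    by (auto simp: vars_def)
  then obtain a b where ab: "m = a + b" "a \<in> Poly_Mapping.keys p" "b \<in> Poly_Mapping.keys q"
    using keys_mult[of p q] by blast
  with m have "v \<in> Poly_Mapping.keys a \<union> Poly_Mapping.keys b"
    using Poly_Mapping.keys_add[of a b] by blast
  with ab show "v \<in> vars p \<union> vars q" by (auto simp: vars_def)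
qed

lemma mpoly_ring_cring: "cring (mpoly_ring V :: ('v, 'k::field) mpoly ring)"
proof -
  let ?R = "mpoly_ring V :: ('v, 'k) mpoly ring"
  have [simp]: "vars (0 :: ('v, 'k) mpoly) = {}" "vars (1 :: ('v, 'k) mpoly) = {}"
    by (simp_all add: vars_def)
  have R: "p \<in> carrier ?R \<longleftrightarrow> vars p \<subseteq> V" "\<zero>\<^bsub>?R\<^esub> = 0" "\<one>\<^bsub>?R\<^esub> = 1"
      "p \<oplus>\<^bsub>?R\<^esub> q = p + q" "p \<otimes>\<^bsub>?R\<^esub> q = p * q" for p q
    by (simp_all add: mpoly_ring_def)
  have add: "vars (p + q) \<subseteq> V" and mult: "vars (p * q) \<subseteq> V"
    if "vars p \<subseteq> V" "vars q \<subseteq> V" for p q :: "('v, 'k) mpoly"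
    using vars_add[of p q] vars_mult[of p q] that by blast+
  have neg: "\<exists>q\<in>carrier ?R. q \<oplus>\<^bsub>?R\<^esub> p = \<zero>\<^bsub>?R\<^esub>" if "p \<in> carrier ?R" for p
    using that by (intro bexI[of _ "- p"]) (simp_all add: R vars_uminus)
  show ?thesis
  proof (rule cringI)
    show "abelian_group ?R"
      by (rule abelian_groupI) (use neg in \<open>simp_all add: R add ac_simps\<close>)
    show "comm_monoid ?R"
      by (rule comm_monoidI) (simp_all add: R mult ac_simps)
  qed (simp add: R algebra_simps)
qed

section \<open>Regular sequences and quotient maps\<close>

text \<open>
  Each \<open>fs ! i\<close> is a nonzerodivisor modulo the ideal generated by its predecessors, and the
  quotient by the whole sequence is nonzero.
\<close>

definition regular_sequence :: "('a, 'm) ring_scheme \<Rightarrow> 'a list \<Rightarrow> bool" where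
  "regular_sequence R fs \<longleftrightarrow>
     set fs \<subseteq> carrier R \<and> Idl\<^bsub>R\<^esub> (set fs) \<noteq> carrier R \<and>
     (\<forall>i < length fs. \<forall>a \<in> carrier R.
        fs ! i \<otimes>\<^bsub>R\<^esub> a \<in> Idl\<^bsub>R\<^esub> (set (take i fs)) \<longrightarrow> a \<in> Idl\<^bsub>R\<^esub> (set (take i fs)))"

definition quotient_by_regular_sequence ::
    "('a, 'm) ring_scheme \<Rightarrow> ('b, 'n) ring_scheme \<Rightarrow> ('a \<Rightarrow> 'b) \<Rightarrow> bool" where
  "quotient_by_regular_sequence R S h \<longleftrightarrow>
     h \<in> ring_hom R S \<and> h ` carrier R = carrier S \<and>
     (\<exists>fs. regular_sequence R fs \<and> a_kernel R S h = Idl\<^bsub>R\<^esub> (set fs))"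

text \<open>
  The map \<open>R Quot I \<rightarrow> S Quot K\<close> induced by \<open>h : R \<rightarrow> S\<close> with \<open>h ` I \<subseteq> K\<close>.  A coset \<open>C\<close> of \<open>I\<close> is
  sent to the common value of \<open>K +> h p\<close> over its representatives \<open>p\<close>.
\<close>

definition induced_quot_map :: "('b, 'n) ring_scheme \<Rightarrow> 'b set \<Rightarrow> ('a \<Rightarrow> 'b) \<Rightarrow> 'a set \<Rightarrow> 'b set" where
  "induced_quot_map S K h C = the_elem ((\<lambda>p. K +>\<^bsub>S\<^esub> h p) ` C)"

lemma induced_quot_map_coset:
  assumes "ideal I R" "ideal K S" "h \<in> ring_hom R S" "h ` I \<subseteq> K" "p \<in> carrier R"
  shows "induced_quot_map S K h (I +>\<^bsub>R\<^esub> p) = K +>\<^bsub>S\<^esub> h p"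
proof -
  interpret I: ideal I R by fact
  interpret K: ideal K S by fact
  have "K +>\<^bsub>S\<^esub> h q = K +>\<^bsub>S\<^esub> h p" if "q \<in> I +>\<^bsub>R\<^esub> p" for q
  proof -
    from that obtain a where a: "a \<in> I" "q = a \<oplus>\<^bsub>R\<^esub> p"
      by (auto simp: a_r_coset_def')
    have "a \<in> carrier R" using a(1) by (rule I.a_Hcarr)
    then have hq: "h q = h a \<oplus>\<^bsub>S\<^esub> h p"
      using a(2) assms(3,5) by (simp add: ring_hom_add)
    have "h a \<in> K" "h p \<in> carrier S"
      using a(1) assms(3,4,5) by (auto simp: ring_hom_closed)
    then have "h q \<in> K +>\<^bsub>S\<^esub> h p"
      unfolding hq by (auto simp: a_r_coset_def')
    then show ?thesis
      using K.a_repr_independence[OF _ \<open>h p \<in> carrier S\<close> K.a_subgroup] by simp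
  qed
  moreover have "p \<in> I +>\<^bsub>R\<^esub> p"
    using assms(5) by (rule I.a_rcos_self)
  ultimately show ?thesis
    unfolding induced_quot_map_def by (metis (mono_tags, lifting) empty_iff the_elem_image_unique)
qed

section \<open>Graded Betti numbers and linear resolutions\<close>

text \<open>
  Data for a complex of graded free modules \<open>\<dots> \<rightarrow> F 1 \<rightarrow> F 0 \<rightarrow> S\<close> of finite rank over the polynomial
  ring \<open>S\<close>.  The module \<open>F i\<close> has a basis \<open>e 0, \<dots>, e (rk i - 1)\<close> with \<open>e k\<close> in degree \<open>shift i k\<close>.
  The map \<open>F 0 \<rightarrow> S\<close> sends \<open>e k\<close> to \<open>aug k\<close>, and \<open>diff i l k\<close> is the coefficient of \<open>e l\<close> in the image
  of \<open>e k\<close> under \<open>F (Suc i) \<rightarrow> F i\<close>.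
\<close>

record (overloaded) ('v, 'k) free_complex =
  rk :: "nat \<Rightarrow> nat"
  shift :: "nat \<Rightarrow> nat \<Rightarrow> nat"
  aug :: "nat \<Rightarrow> ('v, 'k) mpoly"
  diff :: "nat \<Rightarrow> nat \<Rightarrow> nat \<Rightarrow> ('v, 'k) mpoly"

definition free_mod :: "'v set \<Rightarrow> nat \<Rightarrow> (nat \<Rightarrow> ('v, 'k::field) mpoly) set" where
  "free_mod V r = {u. (\<forall>k<r. u k \<in> carrier (mpoly_ring V)) \<and> (\<forall>k\<ge>r. u k = 0)}"

definition aug_map :: "('v, 'k::field) free_complex \<Rightarrow> (nat \<Rightarrow> ('v, 'k) mpoly) \<Rightarrow> ('v, 'k) mpoly" where
  "aug_map F u = (\<Sum>k<rk F 0. aug F k * u k)"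

definition diff_map ::
    "('v, 'k::field) free_complex \<Rightarrow> nat \<Rightarrow> (nat \<Rightarrow> ('v, 'k) mpoly) \<Rightarrow> nat \<Rightarrow> ('v, 'k) mpoly" where
  "diff_map F i u = (\<lambda>l. if l < rk F i then (\<Sum>k<rk F (Suc i). diff F i l k * u k) else 0)"

text \<open>
  Minimality says that every \<open>F (Suc i) \<rightarrow> F i\<close> has its image in \<open>\<mm> F i\<close>, where \<open>\<mm>\<close> is generated by the
  variables: no matrix entry has a constant term.  Degrees are compared additively to avoid
  truncated subtraction.
\<close>

definition minimal_graded_free_resolution ::
    "'v set \<Rightarrow> ('v, 'k::field) mpoly set \<Rightarrow> ('v, 'k) free_complex \<Rightarrow> bool" where
  "minimal_graded_free_resolution V I F \<longleftrightarrow>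
     (\<forall>k < rk F 0. aug F k \<in> carrier (mpoly_ring V) \<and> homogeneous (shift F 0 k) (aug F k)) \<and>
     (\<forall>i. \<forall>l < rk F i. \<forall>k < rk F (Suc i).
        diff F i l k \<in> carrier (mpoly_ring V) \<and>
        (\<forall>m \<in> Poly_Mapping.keys (diff F i l k). mdeg m + shift F i l = shift F (Suc i) k)) \<and>
     aug_map F ` free_mod V (rk F 0) = I \<and>
     {u \<in> free_mod V (rk F 0). aug_map F u = 0} = diff_map F 0 ` free_mod V (rk F 1) \<and>
     (\<forall>i. {u \<in> free_mod V (rk F (Suc i)). diff_map F i u = (\<lambda>_. 0)} =
        diff_map F (Suc i) ` free_mod V (rk F (Suc (Suc i)))) \<and>
     (\<forall>i. \<forall>l < rk F i. \<forall>k < rk F (Suc i). Poly_Mapping.lookup (diff F i l k) 0 = 0)"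

text \<open>
  The number of basis elements of degree \<open>j\<close> in step \<open>i\<close> of the minimal graded free resolution of the
  ideal \<open>I\<close> (of the ideal, not of the quotient by it).  For \<open>V\<close> finite and \<open>I\<close> homogeneous such a
  resolution exists and is unique up to isomorphism, so the choice does not matter.
\<close>

definition graded_betti :: "'v set \<Rightarrow> ('v, 'k::field) mpoly set \<Rightarrow> nat \<Rightarrow> nat \<Rightarrow> nat" where
  "graded_betti V I i j =
     (let F = (SOME F. minimal_graded_free_resolution V I F)
      in card {k. k < rk F i \<and> shift F i k = j})"

definition has_linear_resolution :: "'v set \<Rightarrow> nat \<Rightarrow> ('v, 'k::field) mpoly set \<Rightarrow> bool" where
  "has_linear_resolution V d I \<longleftrightarrow>
     (\<exists>G \<subseteq> carrier (mpoly_ring V). (\<forall>g\<in>G. homogeneous d g) \<and> I = Idl\<^bsub>mpoly_ring V\<^esub> G) \<and>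
     (\<forall>i j. graded_betti V I i j \<noteq> 0 \<longrightarrow> j = i + d)"

section \<open>Strongly stable ideals\<close>

definition monomial_ideal :: "'v set \<Rightarrow> ('v, 'k::field) mpoly set \<Rightarrow> bool" where
  "monomial_ideal V I \<longleftrightarrow>
     (\<exists>M. (\<forall>m\<in>M. Poly_Mapping.keys m \<subseteq> V) \<and> I = Idl\<^bsub>mpoly_ring V\<^esub> (monom ` M))"

definition strongly_stable :: "nat \<Rightarrow> (nat, 'k::field) mpoly set \<Rightarrow> bool" where
  "strongly_stable n I \<longleftrightarrow>
     monomial_ideal {1..n} I \<and>
     (\<forall>m i j. Poly_Mapping.keys m \<subseteq> {1..n} \<and> i \<in> {1..n} \<and> j \<in> {1..n} \<and> i < j \<and>
        X j * monom m \<in> I \<longrightarrow> X i * monom m \<in> I)"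

section \<open>Ideals of poset ideals of isotone maps\<close>

definition isotone_maps :: "nat \<Rightarrow> nat \<Rightarrow> (nat \<Rightarrow> nat) set" where
  "isotone_maps d n = {\<phi> \<in> {1..d} \<rightarrow>\<^sub>E {1..n}. mono_on {1..d} \<phi>}"

definition poset_ideal_Hom :: "nat \<Rightarrow> nat \<Rightarrow> (nat \<Rightarrow> nat) set \<Rightarrow> bool" where
  "poset_ideal_Hom d n J \<longleftrightarrow>
     J \<subseteq> isotone_maps d n \<and>
     (\<forall>\<psi>\<in>J. \<forall>\<phi>\<in>isotone_maps d n. (\<forall>i\<in>{1..d}. \<phi> i \<le> \<psi> i) \<longrightarrow> \<phi> \<in> J)"

definition L_ideal :: "nat \<Rightarrow> nat \<Rightarrow> (nat \<Rightarrow> nat) set \<Rightarrow> (nat \<times> nat, 'k::field) mpoly set" where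
  "L_ideal d n J =
     Idl\<^bsub>mpoly_ring ({1..d} \<times> {1..n})\<^esub> ((\<lambda>\<phi>. \<Prod>i\<in>{1..d}. X (i, \<phi> i)) ` J)"

abbreviation p2_hat :: "(nat \<times> nat, 'k::field) mpoly \<Rightarrow> (nat, 'k) mpoly" where
  "p2_hat \<equiv> var_hom snd"

definition L_p2_ideal :: "nat \<Rightarrow> nat \<Rightarrow> (nat \<Rightarrow> nat) set \<Rightarrow> (nat, 'k::field) mpoly set" where
  "L_p2_ideal d n J = Idl\<^bsub>mpoly_ring {1..n}\<^esub> (p2_hat ` L_ideal d n J)"

definition associated_stable_ideal ::
    "nat \<Rightarrow> nat \<Rightarrow> (nat \<Rightarrow> nat) set \<Rightarrow> (nat, 'k::field) mpoly set" where
  "associated_stable_ideal d n J =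
     Idl\<^bsub>mpoly_ring {1..n}\<^esub> ((\<lambda>\<phi>. \<Prod>i\<in>{1..d}. X (\<phi> i)) ` J)"

end

theory Submission
  imports Defs
begin

text \<open>
  The generators of \<open>L_ideal d n J\<close> are the graph monomials of the maps in \<open>J\<close>, and everything rests on
  one property of a poset ideal: a map in \<open>J\<close> may be lowered as long as it stays isotone, so a splice of
  two isotone maps that lies below one of them is again in \<open>J\<close>.

  \<^emph>\<open>Linear resolution.\<close> List the maps by increasing sum of their values.  The colon ideal of the
  earlier generators by the generator of \<open>\<phi>\<close> is generated by the variables \<open>(i, c)\<close> with
  \<open>\<phi> (i - 1) \<le> c < \<phi> i\<close> (just \<open>1 \<le> c < \<phi> 1\<close> for \<open>i = 1\<close>): lowering the value
  of \<open>\<phi>\<close> at \<open>i\<close> to such a \<open>c\<close> gives an earlier map, and at the first place where an earlier map is smaller than \<open>\<phi>\<close> its value is such a \<open>c\<close>.  So the ideal has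
  linear quotients by ideals of variables (\<open>linear_module_L_ideal\<close>).  To pass from there to Betti numbers,
  the coinductive predicate \<open>linear_module\<close> describes the submodules of free modules that are generated
  in a single degree and whose syzygies are again generated by vectors of linear forms, indefinitely.
  It is closed under extensions (\<open>linear_module_extension\<close>), which handles linear quotients
  (\<open>linear_quotients\<close>).  It yields a minimal resolution at once (\<open>linear_module_resolution\<close>).  Conversely,
  two minimal homogeneous systems of generators of such a module differ by an invertible matrix of scalars, hence have
  isomorphic syzygy modules, so that every minimal resolution has the same shifts
  (\<open>linear_module_minimal_generators\<close>, \<open>linear_module_shifts\<close>).

  \<^emph>\<open>Regular sequence.\<close> The sequence consists of the differences \<open>X (1, c) - X (i, c)\<close> with \<open>i \<ge> 2\<close>, the
  columns \<open>c\<close> taken in decreasing and the rows \<open>i\<close> in increasing order.  Dividing out an initial part of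
  it amounts to replacing the variables met so far by those of the first row, which turns \<open>L_ideal d n J\<close>
  into another monomial ideal (\<open>Idl_union_linear_forms\<close>).  A difference of two variables is a
  nonzerodivisor modulo a monomial ideal as soon as the exponents satisfy an exchange condition
  (\<open>difference_of_variables_nonzerodivisor\<close>).  In the chosen order the smaller columns are still
  untouched, and the exchange condition follows by splicing the minimum of two maps with one of them
  (\<open>merged_column_exchange\<close>).  Dividing out the whole sequence is the projection \<open>p2_hat\<close>
  (\<open>p2_hat_in_L_p2_ideal_iff\<close>).

  \<^emph>\<open>Strong stability.\<close> Replacing one variable \<open>j + 1\<close> by \<open>j\<close> in a projected generator lowers the map at
  the first place where it takes the value \<open>j + 1\<close> (\<open>strongly_stable_adjacent\<close>).
\<close>

abbreviation lookup where "lookup \<equiv> Poly_Mapping.lookup"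
abbreviation keys where "keys \<equiv> Poly_Mapping.keys"

section \<open>Exponents and monomial ideals\<close>

definition mon_dvd :: "('v \<Rightarrow>\<^sub>0 nat) \<Rightarrow> ('v \<Rightarrow>\<^sub>0 nat) \<Rightarrow> bool" where
  "mon_dvd a m \<longleftrightarrow> (\<forall>v. lookup a v \<le> lookup m v)"

lemma mon_dvd_add [simp]: "mon_dvd a (a + m)"
  by (simp add: mon_dvd_def lookup_add)

lemma mon_dvd_diff: "mon_dvd a m \<Longrightarrow> a + (m - a) = m"
  by (rule poly_mapping_eqI) (simp add: mon_dvd_def lookup_add lookup_minus)

lemma mon_dvd_refl [simp]: "mon_dvd a a"
  by (simp add: mon_dvd_def)

lemma mon_dvd_trans: "mon_dvd a b \<Longrightarrow> mon_dvd b c \<Longrightarrow> mon_dvd a c"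
  by (meson mon_dvd_def order_trans)

lemma keys_add_nat: "keys (a + b) = keys a \<union> keys (b :: 'v \<Rightarrow>\<^sub>0 nat)"
  by (auto simp: in_keys_iff lookup_add)

lemma keys_minus_nat: "keys (a - b) \<subseteq> keys (a :: 'v \<Rightarrow>\<^sub>0 nat)"
  by (auto simp: in_keys_iff lookup_minus)

lemma mdeg_eq_sum: "finite A \<Longrightarrow> keys m \<subseteq> A \<Longrightarrow> mdeg m = (\<Sum>v\<in>A. lookup m v)"
  unfolding mdeg_def by (rule sum.mono_neutral_left) (auto simp: in_keys_iff)

lemma mdeg_add [simp]: "mdeg (a + b) = mdeg a + mdeg b"
proof -
  have "mdeg (a + b) = (\<Sum>v\<in>keys a \<union> keys b. lookup (a + b) v)"
    by (rule mdeg_eq_sum) (auto simp: keys_add_nat)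
  moreover have "mdeg a = (\<Sum>v\<in>keys a \<union> keys b. lookup a v)"
    "mdeg b = (\<Sum>v\<in>keys a \<union> keys b. lookup b v)"
    by (rule mdeg_eq_sum; auto)+
  ultimately show ?thesis by (simp add: lookup_add sum.distrib)
qed

lemma mdeg_single [simp]: "mdeg (Poly_Mapping.single v k) = k"
  by (cases "k = 0") (simp_all add: mdeg_def)

lemma mdeg_zero [simp]: "mdeg 0 = 0"
  by (simp add: mdeg_def)

lemma mdeg_sum [simp]: "mdeg (\<Sum>i\<in>A. f i) = (\<Sum>i\<in>A. mdeg (f i))"
  by (induction A rule: infinite_finite_induct) auto

lemma mdeg_eq_0: "mdeg m = 0 \<longleftrightarrow> m = 0"
  by (auto simp: mdeg_def in_keys_iff poly_mapping_eq_iff fun_eq_iff)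

lemma poly_expand: "p = (\<Sum>m\<in>keys p. Poly_Mapping.single m (lookup p m))"
proof (rule poly_mapping_eqI)
  fix k
  have "(\<Sum>m\<in>keys p. lookup p m when m = k) = (\<Sum>m\<in>keys p. if m = k then lookup p m else 0)"
    by (rule sum.cong) (auto simp: when_def)
  then show "lookup p k = lookup (\<Sum>m\<in>keys p. Poly_Mapping.single m (lookup p m)) k"
    by (simp add: lookup_sum lookup_single in_keys_iff)
qed

text \<open>
  Multiplication by a term shifts coefficients.  All statements about products below are reduced to
  this case.
\<close>

lemma lookup_single_mult:
  fixes p :: "('v, 'k::field) mpoly"
  shows "lookup (Poly_Mapping.single a c * p) m = (if mon_dvd a m then c * lookup p (m - a) else 0)"
proof -
  have "Poly_Mapping.single a c * p
      = Poly_Mapping.single a c * (\<Sum>b\<in>keys p. Poly_Mapping.single b (lookup p b))"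
    by (subst poly_expand[of p]) simp
  also have "\<dots> = (\<Sum>b\<in>keys p. Poly_Mapping.single (a + b) (c * lookup p b))"
    by (simp add: sum_distrib_left mult_single)
  finally have "lookup (Poly_Mapping.single a c * p) m
      = (\<Sum>b\<in>keys p. if a + b = m then c * lookup p b else 0)"
    by (simp add: lookup_sum lookup_single when_def)
  also have "\<dots> = (\<Sum>b\<in>keys p. if b = m - a then (if mon_dvd a m then c * lookup p (m - a) else 0) else 0)"
    by (rule sum.cong) (auto simp: mon_dvd_diff)
  also have "\<dots> = (if mon_dvd a m then c * lookup p (m - a) else 0)"
    by (simp add: in_keys_iff)
  finally show ?thesis .
qed

lemma lookup_monom_mult:
  "lookup (monom a * p) m = (if mon_dvd a m then lookup p (m - a) else 0)"
  by (simp add: monom_def lookup_single_mult)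

lemma keys_monom_mult: "keys (monom a * p) = (+) a ` keys p"
proof (intro equalityI subsetI)
  fix m assume "m \<in> keys (monom a * p)"
  then have "mon_dvd a m" "m - a \<in> keys p"
    by (auto simp: in_keys_iff lookup_monom_mult split: if_splits)
  then show "m \<in> (+) a ` keys p" using mon_dvd_diff by (metis imageI)
qed (auto simp: in_keys_iff lookup_monom_mult)

lemma monom_mult: "monom a * monom b = monom (a + b)"
  by (simp add: monom_def mult_single)

lemma monom_0 [simp]: "monom 0 = 1"
  by (simp add: monom_def)

lemma monom_sum: "monom (\<Sum>i\<in>A. f i) = (\<Prod>i\<in>A. monom (f i))"
  by (induction A rule: infinite_finite_induct) (simp_all add: monom_mult[symmetric])

lemma keys_monom [simp]: "keys (monom m :: ('v, 'k::field) mpoly) = {m}"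
  by (simp add: monom_def)

lemma monom_inject: "(monom a :: ('v, 'k::field) mpoly) = monom b \<longleftrightarrow> a = b"
  by (metis keys_monom singleton_inject)

lemma homogeneous_monom: "homogeneous (mdeg m) (monom m)"
  by (simp add: homogeneous_def)

lemma homogeneous_zero [simp]: "homogeneous j 0"
  by (simp add: homogeneous_def)

lemma vars_zero [simp]: "vars 0 = {}"
  and vars_one [simp]: "vars 1 = {}"
  and vars_single: "vars (Poly_Mapping.single m c) \<subseteq> keys m"
  and vars_monom [simp]: "vars (monom m :: ('v, 'k::field) mpoly) = keys m"
  and vars_X [simp]: "vars (X v :: ('v, 'k::field) mpoly) = {v}"
  by (auto simp: vars_def X_def)

lemma vars_minus: "vars (p - q) \<subseteq> vars p \<union> vars q"
  using vars_add[of p "- q"] by (simp add: vars_uminus)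

lemma vars_sum: "(\<And>i. i \<in> A \<Longrightarrow> vars (f i) \<subseteq> V) \<Longrightarrow> vars (\<Sum>i\<in>A. f i) \<subseteq> V"
  by (induction A rule: infinite_finite_induct) (auto dest!: subsetD[OF vars_add])

lemma vars_add_in: "vars p \<subseteq> V \<Longrightarrow> vars q \<subseteq> V \<Longrightarrow> vars (p + q) \<subseteq> V"
  and vars_mult_in: "vars p \<subseteq> V \<Longrightarrow> vars q \<subseteq> V \<Longrightarrow> vars (p * q) \<subseteq> V"
  and vars_minus_in: "vars p \<subseteq> V \<Longrightarrow> vars q \<subseteq> V \<Longrightarrow> vars (p - q) \<subseteq> V"
  using vars_add[of p q] vars_mult[of p q] vars_minus[of p q] by blast+

lemma carrier_mpoly_ring [simp]: "p \<in> carrier (mpoly_ring V) \<longleftrightarrow> vars p \<subseteq> V"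
  and mpoly_ring_simps [simp]: "\<zero>\<^bsub>mpoly_ring V\<^esub> = 0" "\<one>\<^bsub>mpoly_ring V\<^esub> = 1"
  "p \<oplus>\<^bsub>mpoly_ring V\<^esub> q = p + q" "p \<otimes>\<^bsub>mpoly_ring V\<^esub> q = p * q"
  by (simp_all add: mpoly_ring_def)

lemma mpoly_ring_ring: "ring (mpoly_ring V :: ('v, 'k::field) mpoly ring)"
  using mpoly_ring_cring cring_def by blast

lemma mpoly_ring_minus:
  fixes p :: "('v, 'k::field) mpoly"
  assumes "vars p \<subseteq> V"
  shows "\<ominus>\<^bsub>mpoly_ring V\<^esub> p = - p"
proof -
  interpret ring "mpoly_ring V :: ('v, 'k) mpoly ring" by (rule mpoly_ring_ring)
  show ?thesis
    using minus_equality[of "- p" p] assms by (simp add: vars_uminus)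
qed

lemma mpoly_idealI:
  fixes I :: "('v, 'k::field) mpoly set"
  assumes "\<And>p. p \<in> I \<Longrightarrow> vars p \<subseteq> V" "0 \<in> I" "\<And>p q. p \<in> I \<Longrightarrow> q \<in> I \<Longrightarrow> p + q \<in> I"
    and mult: "\<And>p q. p \<in> I \<Longrightarrow> vars q \<subseteq> V \<Longrightarrow> q * p \<in> I"
  shows "ideal I (mpoly_ring V)"
proof -
  interpret ring "mpoly_ring V :: ('v, 'k) mpoly ring" by (rule mpoly_ring_ring)
  have neg: "- p \<in> I" if "p \<in> I" for p
    using mult[OF that, of "- 1"] by (simp add: vars_uminus)
  have "subgroup I (add_monoid (mpoly_ring V))"
  proof (rule add.subgroupI)
    show "\<ominus>\<^bsub>mpoly_ring V\<^esub> p \<in> I" if "p \<in> I" for p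
      using that assms(1) by (simp add: mpoly_ring_minus neg)
  qed (use assms in auto)
  then show ?thesis
    by (rule idealI[OF mpoly_ring_ring]) (use mult in \<open>auto simp: mult.commute\<close>)
qed

lemma
  fixes I :: "('v, 'k::field) mpoly set"
  assumes "ideal I (mpoly_ring V)"
  shows mpoly_ideal_zero: "0 \<in> I"
    and mpoly_ideal_add: "p \<in> I \<Longrightarrow> q \<in> I \<Longrightarrow> p + q \<in> I"
    and mpoly_ideal_mult: "p \<in> I \<Longrightarrow> vars q \<subseteq> V \<Longrightarrow> q * p \<in> I"
    and mpoly_ideal_uminus: "p \<in> I \<Longrightarrow> - p \<in> I"
    and mpoly_ideal_sum: "(\<And>i. i \<in> A \<Longrightarrow> f i \<in> I) \<Longrightarrow> (\<Sum>i\<in>A. f i) \<in> I"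
proof -
  interpret ideal I "mpoly_ring V" by fact
  show 0: "0 \<in> I" using additive_subgroup.zero_closed[OF is_additive_subgroup] by simp
  show add: "p + q \<in> I" if "p \<in> I" "q \<in> I" for p q using additive_subgroup.a_closed[OF is_additive_subgroup that] by simp
  show mult: "q * p \<in> I" if "p \<in> I" "vars q \<subseteq> V" for p q
    using I_l_closed[of p q] that by simp
  show "- p \<in> I" if "p \<in> I" for p
    using mult[OF that, of "- 1"] by (simp add: vars_uminus)
  show "(\<Sum>i\<in>A. f i) \<in> I" if "\<And>i. i \<in> A \<Longrightarrow> f i \<in> I"
    using that by (induction A rule: infinite_finite_induct) (auto simp: 0 add)
qed

lemma
  fixes G :: "('v, 'k::field) mpoly set"
  assumes "\<And>g. g \<in> G \<Longrightarrow> vars g \<subseteq> V"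
  shows Idl_ideal: "ideal (Idl\<^bsub>mpoly_ring V\<^esub> G) (mpoly_ring V)"
    and Idl_self: "g \<in> G \<Longrightarrow> g \<in> Idl\<^bsub>mpoly_ring V\<^esub> G"
    and Idl_least: "ideal K (mpoly_ring V) \<Longrightarrow> G \<subseteq> K \<Longrightarrow> Idl\<^bsub>mpoly_ring V\<^esub> G \<subseteq> K"
proof -
  interpret ring "mpoly_ring V :: ('v, 'k) mpoly ring" by (rule mpoly_ring_ring)
  have G: "G \<subseteq> carrier (mpoly_ring V)" using assms by auto
  show "ideal (Idl\<^bsub>mpoly_ring V\<^esub> G) (mpoly_ring V)" using G by (rule genideal_ideal)
  show "g \<in> G \<Longrightarrow> g \<in> Idl\<^bsub>mpoly_ring V\<^esub> G" using genideal_self[OF G] by blast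
  show "ideal K (mpoly_ring V) \<Longrightarrow> G \<subseteq> K \<Longrightarrow> Idl\<^bsub>mpoly_ring V\<^esub> G \<subseteq> K"
    using genideal_minimal by blast
qed

text \<open>
  The monomial ideal generated by \<open>M\<close>, presented by the criterion that decides membership one monomial at
  a time (see \<open>Idl_monom\<close>).
\<close>

definition monomial_span :: "'v set \<Rightarrow> ('v \<Rightarrow>\<^sub>0 nat) set \<Rightarrow> ('v, 'k::field) mpoly set" where
  "monomial_span V M = {p. vars p \<subseteq> V \<and> (\<forall>m\<in>keys p. \<exists>a\<in>M. mon_dvd a m)}"

lemma ideal_monomial_span:
  "ideal (monomial_span V M) (mpoly_ring V :: ('v, 'k::field) mpoly ring)"
proof (rule mpoly_idealI)
  fix p q :: "('v, 'k) mpoly"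
  assume p: "p \<in> monomial_span V M"
  show "vars p \<subseteq> V" using p by (simp add: monomial_span_def)
  show "p + q \<in> monomial_span V M" if "q \<in> monomial_span V M"
    using p that Poly_Mapping.keys_add[of p q]
    by (fastforce simp: monomial_span_def vars_add_in)
  show "q * p \<in> monomial_span V M" if q: "vars q \<subseteq> V"
  proof -
    have "\<exists>a\<in>M. mon_dvd a m" if "m \<in> keys (q * p)" for m
    proof -
      from that obtain x y where m: "m = x + y" "y \<in> keys p"
        using keys_mult[of q p] by blast
      then obtain a where a: "a \<in> M" "mon_dvd a y" using p by (auto simp: monomial_span_def)
      then have "mon_dvd a m" using m mon_dvd_trans[of a y m] by (metis mon_dvd_add add.commute)
      with a show ?thesis by blast
    qed
    then show ?thesis using p q by (simp add: monomial_span_def vars_mult_in)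
  qed
qed (simp add: monomial_span_def)

lemma Idl_monom:
  assumes M: "\<And>m. m \<in> M \<Longrightarrow> keys m \<subseteq> V"
  shows "Idl\<^bsub>mpoly_ring V\<^esub> (monom ` M) = (monomial_span V M :: ('v, 'k::field) mpoly set)"
proof
  let ?I = "Idl\<^bsub>mpoly_ring V\<^esub> (monom ` M) :: ('v, 'k) mpoly set"
  have gens: "vars g \<subseteq> V" if "g \<in> monom ` M" for g :: "('v, 'k) mpoly"
    using that M by fastforce
  note I = Idl_ideal[of "monom ` M" V, OF gens]
  show "?I \<subseteq> monomial_span V M"
  proof (rule Idl_least[OF gens ideal_monomial_span])
    show "monom ` M \<subseteq> (monomial_span V M :: ('v, 'k) mpoly set)"
      using M by (fastforce simp: monomial_span_def intro: mon_dvd_refl)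
  qed
  show "monomial_span V M \<subseteq> ?I"
  proof
    fix p :: "('v, 'k) mpoly" assume p: "p \<in> monomial_span V M"
    have "Poly_Mapping.single m (lookup p m) \<in> ?I" if m: "m \<in> keys p" for m
    proof -
      obtain a where a: "a \<in> M" "mon_dvd a m" using p m by (auto simp: monomial_span_def)
      have "keys m \<subseteq> V" using p m by (auto simp: monomial_span_def vars_def)
      then have v: "vars (Poly_Mapping.single (m - a) (lookup p m)) \<subseteq> V"
        using vars_single[of "m - a" "lookup p m"] keys_minus_nat[of m a] by blast
      have "Poly_Mapping.single (m - a) (lookup p m) * monom a \<in> ?I"
        by (rule mpoly_ideal_mult[OF I _ v]) (auto intro!: Idl_self gens a)
      moreover have "Poly_Mapping.single (m - a) (lookup p m) * monom a = Poly_Mapping.single m (lookup p m)"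
        using mon_dvd_diff[OF a(2)] by (simp add: monom_def mult_single add.commute)
      ultimately show ?thesis by simp
    qed
    then show "p \<in> ?I"
      by (subst poly_expand) (rule mpoly_ideal_sum[OF I])
  qed
qed

section \<open>Homogeneous components\<close>

definition hcomp :: "nat \<Rightarrow> ('v, 'k::field) mpoly \<Rightarrow> ('v, 'k) mpoly" where
  "hcomp j p = (\<Sum>m\<in>{m\<in>keys p. mdeg m = j}. Poly_Mapping.single m (lookup p m))"

lemma lookup_hcomp: "lookup (hcomp j p) m = (if mdeg m = j then lookup p m else 0)"
proof -
  have "lookup (hcomp j p) m
      = (\<Sum>x\<in>{x\<in>keys p. mdeg x = j}. if x = m then (lookup p m) else 0)"
    unfolding hcomp_def lookup_sum lookup_single when_def by (rule sum.cong) auto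
  then show ?thesis by (simp add: in_keys_iff)
qed

lemma hcomp_add: "hcomp j (p + q) = hcomp j p + hcomp j q"
  by (rule poly_mapping_eqI) (simp add: lookup_hcomp lookup_add)

lemma hcomp_zero [simp]: "hcomp j 0 = 0"
  by (rule poly_mapping_eqI) (simp add: lookup_hcomp)

lemma hcomp_sum: "hcomp j (\<Sum>i\<in>A. f i) = (\<Sum>i\<in>A. hcomp j (f i))"
  by (induction A rule: infinite_finite_induct) (simp_all add: hcomp_add)

lemma hcomp_homogeneous: "homogeneous j (hcomp j p)"
  by (auto simp: homogeneous_def in_keys_iff lookup_hcomp split: if_splits)

lemma hcomp_of_homogeneous: "homogeneous j p \<Longrightarrow> hcomp i p = (if i = j then p else 0)"
  by (rule poly_mapping_eqI) (auto simp: lookup_hcomp homogeneous_def in_keys_iff)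

lemma vars_hcomp: "vars (hcomp j p) \<subseteq> vars p"
  by (fastforce simp: vars_def in_keys_iff lookup_hcomp split: if_splits)

text \<open>
  Taking components is how a relation between homogeneous vectors is made homogeneous.
\<close>

lemma hcomp_mult:
  assumes "homogeneous e c"
  shows "hcomp t (c * p) = (if e \<le> t then c * hcomp (t - e) p else 0)"
proof -
  have mon: "hcomp t (Poly_Mapping.single a k * p)
      = (if e \<le> t then Poly_Mapping.single a k * hcomp (t - e) p else 0)" if "mdeg a = e" for a and k :: 'b
  proof (rule poly_mapping_eqI)
    fix m
    have "mdeg m = e + mdeg (m - a)" if "mon_dvd a m"
      using mdeg_add[of a "m - a"] mon_dvd_diff[OF that] \<open>mdeg a = e\<close> by simp
    then show "lookup (hcomp t (Poly_Mapping.single a k * p)) m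
        = lookup (if e \<le> t then Poly_Mapping.single a k * hcomp (t - e) p else 0) m"
      by (auto simp: lookup_hcomp lookup_single_mult)
  qed
  have "c * p = (\<Sum>a\<in>keys c. Poly_Mapping.single a (lookup c a) * p)" for p :: "('a, 'b) mpoly"
    by (subst poly_expand[of c]) (simp add: sum_distrib_right)
  note exp = this
  have "hcomp t (c * p) = (\<Sum>a\<in>keys c. hcomp t (Poly_Mapping.single a (lookup c a) * p))"
    by (subst exp) (simp add: hcomp_sum)
  also have "\<dots> = (\<Sum>a\<in>keys c. if e \<le> t then Poly_Mapping.single a (lookup c a) * hcomp (t - e) p else 0)"
    by (rule sum.cong) (use assms in \<open>auto simp: mon homogeneous_def\<close>)
  also have "\<dots> = (if e \<le> t then c * hcomp (t - e) p else 0)"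
    by (simp add: exp[symmetric])
  finally show ?thesis .
qed

lemma homogeneous_0_const:
  assumes "homogeneous 0 p"
  shows "p = Poly_Mapping.single 0 (lookup p 0)"
proof (rule poly_mapping_eqI)
  fix m
  have "lookup p m = 0" if "m \<noteq> 0"
    using assms that by (auto simp: homogeneous_def in_keys_iff mdeg_eq_0)
  then show "lookup p m = lookup (Poly_Mapping.single 0 (lookup p 0)) m"
    by (simp add: lookup_single when_def)
qed

lemma lookup_mult_0:
  fixes p q :: "('v, 'k::field) mpoly"
  shows "lookup (p * q) 0 = lookup p 0 * lookup q 0"
proof -
  have "p * q = (\<Sum>a\<in>keys p. Poly_Mapping.single a (lookup p a) * q)"
    by (subst poly_expand[of p]) (simp add: sum_distrib_right)
  moreover have zero: "mon_dvd a 0 \<longleftrightarrow> a = 0" for a :: "'v \<Rightarrow>\<^sub>0 nat"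
    by (auto simp: mon_dvd_def poly_mapping_eq_iff fun_eq_iff)
  ultimately have "lookup (p * q) 0 = (\<Sum>a\<in>keys p. if mon_dvd a 0 then lookup p a * lookup q (0 - a) else 0)"
    by (simp add: lookup_sum lookup_single_mult)
  also have "\<dots> = (\<Sum>a\<in>keys p. if a = 0 then lookup p 0 * lookup q 0 else 0)"
    by (rule sum.cong) (auto simp: zero)
  also have "\<dots> = lookup p 0 * lookup q 0"
    by (simp add: in_keys_iff)
  finally show ?thesis .
qed

lemma homogeneous_mult: "homogeneous a p \<Longrightarrow> homogeneous b q \<Longrightarrow> homogeneous (a + b) (p * q)"
  using keys_mult[of p q] by (fastforce simp: homogeneous_def)

lemma homogeneous_add: "homogeneous a p \<Longrightarrow> homogeneous a q \<Longrightarrow> homogeneous a (p + q)"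
  using Poly_Mapping.keys_add[of p q] by (auto simp: homogeneous_def)

lemma homogeneous_sum: "(\<And>i. i \<in> A \<Longrightarrow> homogeneous a (f i)) \<Longrightarrow> homogeneous a (\<Sum>i\<in>A. f i)"
  by (induction A rule: infinite_finite_induct) (simp_all add: homogeneous_add)

lemma homogeneous_minus: "homogeneous a p \<Longrightarrow> homogeneous a q \<Longrightarrow> homogeneous a (p - q)"
  using homogeneous_add[of a p "- q"] by (simp add: homogeneous_def in_keys_iff)

lemma homogeneous_one [simp]: "homogeneous 0 1"
  by (simp add: homogeneous_def)

lemma homogeneous_unique: "homogeneous a p \<Longrightarrow> homogeneous b p \<Longrightarrow> p \<noteq> 0 \<Longrightarrow> a = b"
  by (metis homogeneous_def keys_eq_empty all_not_in_conv)

lemma homogeneous_lookup_0: "homogeneous t p \<Longrightarrow> t > 0 \<Longrightarrow> lookup p 0 = 0"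
  by (metis homogeneous_def in_keys_iff mdeg_zero less_irrefl)

section \<open>Substitution of variables\<close>

text \<open>
  The polynomial ring is generated as a ring by the constants and the variables.
\<close>

lemma mpoly_induct [consumes 1, case_names const X add mult]:
  fixes p :: "('v, 'k::field) mpoly"
  assumes p: "vars p \<subseteq> V"
    and const: "\<And>c. P (Poly_Mapping.single 0 c)"
    and X: "\<And>v. v \<in> V \<Longrightarrow> P (X v)"
    and add: "\<And>p q. vars p \<subseteq> V \<Longrightarrow> vars q \<subseteq> V \<Longrightarrow> P p \<Longrightarrow> P q \<Longrightarrow> P (p + q)"
    and mult: "\<And>p q. vars p \<subseteq> V \<Longrightarrow> vars q \<subseteq> V \<Longrightarrow> P p \<Longrightarrow> P q \<Longrightarrow> P (p * q)"
  shows "P p"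
proof -
  have 1: "P 1" using const[of 1] by simp
  have 0: "P 0" using const[of 0] by simp
  have mon: "P (monom m)" if "keys m \<subseteq> V" for m
    using that
  proof (induction "mdeg m" arbitrary: m)
    case 0
    then show ?case using 1 by (simp add: mdeg_eq_0)
  next
    case (Suc k)
    have "keys m \<noteq> {}"
    proof
      assume "keys m = {}"
      then have "mdeg m = 0" by (simp only: mdeg_def sum.empty)
      with Suc.hyps(2) show False by simp
    qed
    then obtain v where v: "v \<in> keys m" by blast
    let ?s = "Poly_Mapping.single v (1::nat)"
    have "mon_dvd ?s m" using v by (auto simp: mon_dvd_def lookup_single when_def in_keys_iff)
    from mon_dvd_diff[OF this] have m: "m = ?s + (m - ?s)" by simp
    have k: "keys (m - ?s) \<subseteq> V" using keys_minus_nat[of m ?s] Suc.prems by blast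
    have "mdeg m = 1 + mdeg (m - ?s)" by (subst m) simp
    then have "P (monom (m - ?s))" using Suc.hyps(1)[of "m - ?s"] Suc.hyps(2) k by simp
    moreover have "vars (X v :: ('v,'k) mpoly) \<subseteq> V" "P (X v)" using v Suc.prems X by auto
    ultimately have "P (X v * monom (m - ?s))" using k by (intro mult) auto
    moreover have "(X v :: ('v,'k) mpoly) * monom (m - ?s) = monom m"
      unfolding X_def monom_mult using m by simp
    ultimately show ?case by simp
  qed
  have "P (Poly_Mapping.single m c)" if "keys m \<subseteq> V" for m and c :: 'k
  proof -
    have "vars (Poly_Mapping.single 0 c) \<subseteq> V" using vars_single[of 0 c] by auto
    then have "P (Poly_Mapping.single 0 c * monom m)" using that by (intro mult const mon) auto
    then show ?thesis by (simp add: monom_def mult_single)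
  qed
  note P_single = this
  have vars_single': "vars (Poly_Mapping.single m c) \<subseteq> V" if "keys m \<subseteq> V" for m and c :: 'k
    using that vars_single[of m c] by blast
  have "P (\<Sum>m\<in>A. Poly_Mapping.single m (f m))" if "finite A" "\<And>m. m \<in> A \<Longrightarrow> keys m \<subseteq> V" for A f
    using that
  proof (induction A rule: finite_induct)
    case (insert m A)
    then show ?case
      by (simp add: add P_single vars_single' vars_sum)
  qed (simp add: 0)
  then have "P (\<Sum>m\<in>keys p. Poly_Mapping.single m (lookup p m))"
    using p finite_keys[of p] by (metis UN_subset_iff vars_def)
  then show ?thesis by (simp flip: poly_expand)
qed

text \<open>
  The exponent of the image of \<open>monom m\<close> under \<open>var_hom f\<close>.
\<close>

definition var_image :: "('v \<Rightarrow> 'w) \<Rightarrow> ('v \<Rightarrow>\<^sub>0 nat) \<Rightarrow> ('w \<Rightarrow>\<^sub>0 nat)" where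
  "var_image f m = (\<Sum>v\<in>keys m. Poly_Mapping.single (f v) (lookup m v))"

lemma var_image_superset:
  "finite A \<Longrightarrow> keys m \<subseteq> A \<Longrightarrow> var_image f m = (\<Sum>v\<in>A. Poly_Mapping.single (f v) (lookup m v))"
  unfolding var_image_def by (rule sum.mono_neutral_left) (auto simp: in_keys_iff)

lemma var_image_add [simp]: "var_image f (a + b) = var_image f a + var_image f b"
  using var_image_superset[of "keys a \<union> keys b" "a + b" f]
    var_image_superset[of "keys a \<union> keys b" a f] var_image_superset[of "keys a \<union> keys b" b f]
  by (simp add: keys_add_nat lookup_add single_add sum.distrib)

lemma var_image_zero [simp]: "var_image f 0 = 0"
  by (simp add: var_image_def)

lemma var_image_single [simp]: "var_image f (Poly_Mapping.single v k) = Poly_Mapping.single (f v) k"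
  by (cases "k = 0") (simp_all add: var_image_def)

lemma var_image_sum [simp]: "var_image f (\<Sum>i\<in>A. g i) = (\<Sum>i\<in>A. var_image f (g i))"
  by (induction A rule: infinite_finite_induct) simp_all

lemma keys_var_image:
  assumes "keys m \<subseteq> V" "\<And>v. v \<in> V \<Longrightarrow> f v \<in> W"
  shows "keys (var_image f m) \<subseteq> W"
proof
  fix w assume "w \<in> keys (var_image f m)"
  then have "(\<Sum>v\<in>keys m. lookup (Poly_Mapping.single (f v) (lookup m v)) w) \<noteq> 0"
    by (simp add: var_image_def lookup_sum in_keys_iff)
  then obtain v where v: "v \<in> keys m" "lookup (Poly_Mapping.single (f v) (lookup m v)) w \<noteq> 0"
    by (rule sum.not_neutral_contains_not_neutral)
  then have "w = f v" by (auto simp: lookup_single when_def split: if_splits)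
  then show "w \<in> W" using v(1) assms by auto
qed

lemma mon_dvd_var_image: "mon_dvd a b \<Longrightarrow> mon_dvd (var_image f a) (var_image f b)"
  using mon_dvd_add[of "var_image f a" "var_image f (b - a)"] mon_dvd_diff[of a b]
  by (metis var_image_add)

lemma mdeg_var_image [simp]: "mdeg (var_image f m) = mdeg m"
  unfolding var_image_def mdeg_sum mdeg_single by (simp add: mdeg_def)

lemma var_hom_superset:
  fixes p :: "('v, 'k::field) mpoly"
  assumes "finite A" "keys p \<subseteq> A"
  shows "var_hom f p = (\<Sum>m\<in>A. Poly_Mapping.single (var_image f m) (lookup p m))"
proof -
  have Xpow: "(X w :: ('w, 'k) mpoly) ^ k = monom (Poly_Mapping.single w k)" for w :: 'w and k
    by (induction k) (simp_all add: X_def monom_mult flip: single_add)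
  have "var_hom f p = (\<Sum>m\<in>keys p. Poly_Mapping.single (var_image f m) (lookup p m))"
    unfolding var_hom_def Xpow
    by (simp add: monom_sum[symmetric] var_image_def[symmetric]) (simp add: monom_def mult_single)
  also have "\<dots> = (\<Sum>m\<in>A. Poly_Mapping.single (var_image f m) (lookup p m))"
    by (rule sum.mono_neutral_left) (use assms in \<open>auto simp: in_keys_iff\<close>)
  finally show ?thesis .
qed

lemma var_hom_add: "var_hom f (p + q) = var_hom f p + var_hom f q"
  using var_hom_superset[of "keys p \<union> keys q" "p + q" f] var_hom_superset[of "keys p \<union> keys q" p f]
    var_hom_superset[of "keys p \<union> keys q" q f] Poly_Mapping.keys_add[of p q]
  by (simp add: lookup_add single_add sum.distrib)

lemma var_hom_single [simp]:
  "var_hom f (Poly_Mapping.single m c) = Poly_Mapping.single (var_image f m) c"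
  using var_hom_superset[of "{m}" "Poly_Mapping.single m c" f] by (simp split: if_splits)

lemma var_hom_zero [simp]: "var_hom f 0 = 0"
  by (simp add: var_hom_def)

lemma var_hom_one [simp]: "var_hom f 1 = 1"
  using var_hom_single[of f 0 1] by simp

lemma var_hom_monom [simp]: "var_hom f (monom m) = monom (var_image f m)"
  by (simp add: monom_def)

lemma var_hom_X [simp]: "var_hom f (X v) = X (f v)"
  by (simp add: X_def)

lemma var_hom_sum: "var_hom f (\<Sum>i\<in>A. g i) = (\<Sum>i\<in>A. var_hom f (g i))"
  by (induction A rule: infinite_finite_induct) (simp_all add: var_hom_add)

lemma var_hom_mult:
  fixes p q :: "('v, 'k::field) mpoly"
  shows "var_hom f (p * q) = var_hom f p * var_hom f q"
proof -
  let ?s = "\<lambda>p m. Poly_Mapping.single m (lookup p m) :: ('v, 'k) mpoly"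
  have "var_hom f (p * q) = var_hom f ((\<Sum>a\<in>keys p. ?s p a) * (\<Sum>b\<in>keys q. ?s q b))"
    by (simp flip: poly_expand)
  also have "\<dots> = (\<Sum>a\<in>keys p. \<Sum>b\<in>keys q. var_hom f (?s p a) * var_hom f (?s q b))"
    by (simp add: sum_product var_hom_sum mult_single)
  also have "\<dots> = var_hom f (\<Sum>a\<in>keys p. ?s p a) * var_hom f (\<Sum>b\<in>keys q. ?s q b)"
    by (simp add: sum_product var_hom_sum)
  finally show ?thesis by (simp flip: poly_expand)
qed

lemma var_hom_uminus: "var_hom f (- p) = - var_hom f p"
  by (rule minus_unique[symmetric]) (simp flip: var_hom_add)

lemma var_hom_minus: "var_hom f (p - q) = var_hom f p - var_hom f q"
  using var_hom_add[of f p "- q"] by (simp add: var_hom_uminus)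

lemma vars_var_hom:
  assumes "vars p \<subseteq> V" "\<And>v. v \<in> V \<Longrightarrow> f v \<in> W"
  shows "vars (var_hom f p) \<subseteq> W"
  using assms(1)
proof (induction rule: mpoly_induct)
  case (const c)
  then show ?case using vars_single[of 0 c] by auto
qed (simp_all add: assms(2) var_hom_add var_hom_mult vars_add_in vars_mult_in)

lemma var_hom_ring_hom:
  assumes "\<And>v. v \<in> V \<Longrightarrow> f v \<in> W"
  shows "var_hom f \<in> ring_hom (mpoly_ring V) (mpoly_ring W)"
  by (rule ring_hom_memI) (use assms in \<open>simp_all add: var_hom_add var_hom_mult vars_var_hom\<close>)

lemma var_hom_comp:
  assumes "vars p \<subseteq> V" "\<And>v. v \<in> V \<Longrightarrow> g (f v) = h v"
  shows "var_hom g (var_hom f p) = var_hom h p"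
  using assms(1) by (induction rule: mpoly_induct) (simp_all add: assms(2) var_hom_add var_hom_mult)

lemma var_hom_id:
  assumes "vars p \<subseteq> V" "\<And>v. v \<in> V \<Longrightarrow> f v = v"
  shows "var_hom f p = p"
  using assms(1) by (induction rule: mpoly_induct) (simp_all add: assms(2) var_hom_add var_hom_mult)

lemma var_hom_monomial_span:
  fixes p :: "('v, 'k::field) mpoly"
  assumes p: "p \<in> monomial_span V M" and f: "\<And>v. v \<in> V \<Longrightarrow> f v \<in> W"
  shows "var_hom f p \<in> monomial_span W (var_image f ` M)"
proof -
  have "\<exists>a\<in>var_image f ` M. mon_dvd a m" if m: "m \<in> keys (var_hom f p)" for m
  proof -
    have "var_hom f p = (\<Sum>k\<in>keys p. Poly_Mapping.single (var_image f k) (lookup p k))"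
      by (rule var_hom_superset) auto
    then have "lookup (\<Sum>k\<in>keys p. Poly_Mapping.single (var_image f k) (lookup p k)) m \<noteq> 0"
      using m by (simp add: in_keys_iff)
    then obtain k where k: "k \<in> keys p" "lookup (Poly_Mapping.single (var_image f k) (lookup p k)) m \<noteq> 0"
      unfolding lookup_sum by (rule sum.not_neutral_contains_not_neutral)
    then have "m = var_image f k" by (auto simp: lookup_single when_def split: if_splits)
    moreover obtain a where "a \<in> M" "mon_dvd a k"
      using p k(1) by (auto simp: monomial_span_def)
    ultimately show ?thesis using mon_dvd_var_image[of a k f] by blast
  qed
  then show ?thesis using p f vars_var_hom[of p V f W] by (auto simp: monomial_span_def)
qed

text \<open>
  The monomials of a monomial ideal are multiples of generators, and images of multiples are multiples of
  images.
\<close>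

lemma Idl_var_hom_monomial_span:
  assumes M: "\<And>m. m \<in> M \<Longrightarrow> keys m \<subseteq> V" and f: "\<And>v. v \<in> V \<Longrightarrow> f v \<in> W"
  shows "Idl\<^bsub>mpoly_ring W\<^esub> (var_hom f ` monomial_span V M)
    = (monomial_span W (var_image f ` M) :: ('w, 'k::field) mpoly set)" (is "?I = ?S")
proof
  have sub: "var_hom f ` monomial_span V M \<subseteq> ?S"
    using var_hom_monomial_span[where f = f and V = V and W = W, OF _ f] by blast
  then have gens: "vars g \<subseteq> W" if "g \<in> var_hom f ` monomial_span V M" for g :: "('w, 'k) mpoly"
    using that by (auto simp: monomial_span_def)
  show "?I \<subseteq> ?S" by (rule Idl_least[OF gens ideal_monomial_span sub])
  have fM: "keys m \<subseteq> W" if "m \<in> var_image f ` M" for m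
    using that keys_var_image[where f = f, OF M f] by blast
  have "?S = Idl\<^bsub>mpoly_ring W\<^esub> (monom ` var_image f ` M)" by (rule Idl_monom[OF fM, symmetric])
  also have "\<dots> \<subseteq> ?I"
  proof (rule Idl_least)
    show "vars g \<subseteq> W" if "g \<in> monom ` var_image f ` M" for g :: "('w, 'k) mpoly"
      using that fM by fastforce
    show "ideal ?I (mpoly_ring W)" by (rule Idl_ideal) (rule gens)
    show "monom ` var_image f ` M \<subseteq> ?I"
    proof clarify
      fix m assume m: "m \<in> M"
      have "(monom m :: (_, 'k) mpoly) \<in> monomial_span V M"
        using m M[OF m] by (auto simp: monomial_span_def intro!: bexI[of _ m])
      then have "var_hom f (monom m) \<in> (var_hom f ` monomial_span V M :: ('w, 'k) mpoly set)"
        by (rule imageI)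
      from Idl_self[OF gens this] show "monom (var_image f m) \<in> ?I" by simp
    qed
  qed
  finally show "?S \<subseteq> ?I" .
qed

section \<open>Enumerations sorted by a key\<close>

lemma ex_sorted_enumeration:
  fixes key :: "'a \<Rightarrow> nat"
  assumes "finite A"
  shows "\<exists>xs. distinct xs \<and> set xs = A \<and> (\<forall>i j. i \<le> j \<longrightarrow> j < length xs \<longrightarrow> key (xs ! i) \<le> key (xs ! j))"
proof -
  obtain ys where ys: "set ys = A" "distinct ys" using finite_distinct_list[OF assms] by blast
  have "key (sort_key key ys ! i) \<le> key (sort_key key ys ! j)" if "i \<le> j" "j < length (sort_key key ys)" for i j
    using sorted_nth_mono[of "map key (sort_key key ys)" i j] that by simp
  then show ?thesis using ys by (intro exI[of _ "sort_key key ys"]) simp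
qed

lemma set_take_sorted:
  fixes key :: "'a \<Rightarrow> nat"
  assumes sorted: "\<And>i j. i \<le> j \<Longrightarrow> j < length xs \<Longrightarrow> key (xs ! i) \<le> key (xs ! j)"
    and "distinct xs" "inj_on key (set xs)" and j: "j < length xs"
  shows "set (take j xs) = {x \<in> set xs. key x < key (xs ! j)}"
proof -
  have ne: "key (xs ! i) \<noteq> key (xs ! j)" if "i < j" for i
  proof
    assume "key (xs ! i) = key (xs ! j)"
    then have "xs ! i = xs ! j" using inj_onD[OF assms(3)] that j by (meson nth_mem less_trans)
    then show False using nth_eq_iff_index_eq[OF assms(2), of i j] that j by simp
  qed
  have "set (take j xs) = (!) xs ` {..<j}"
    using nth_image[of j xs] j by (simp add: atLeast0LessThan)
  also have "\<dots> = {x \<in> set xs. key x < key (xs ! j)}"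
  proof (intro equalityI subsetI)
    fix x assume "x \<in> (!) xs ` {..<j}"
    then obtain i where "i < j" "x = xs ! i" by auto
    then show "x \<in> {x \<in> set xs. key x < key (xs ! j)}"
      using sorted[of i j] ne[of i] j by (simp add: less_le)
  next
    fix x assume "x \<in> {x \<in> set xs. key x < key (xs ! j)}"
    then obtain i where i: "i < length xs" "x = xs ! i" "key (xs ! i) < key (xs ! j)"
      by (auto simp: in_set_conv_nth)
    then have "i < j" using sorted[of j i] by (meson not_le)
    then show "x \<in> (!) xs ` {..<j}" using i by auto
  qed
  finally show ?thesis .
qed

section \<open>Matrices of polynomials\<close>

text \<open>
  A matrix is a function of the row and the column.  Only the number \<open>N\<close> of columns is recorded: the
  rows that matter are those in which some column is nonzero.  Submodules of free modules appear as the
  kernel \<open>syz\<close> or the image \<open>img\<close> of such a matrix.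
\<close>

definition mat_vec ::
    "nat \<Rightarrow> (nat \<Rightarrow> nat \<Rightarrow> ('v, 'k::field) mpoly) \<Rightarrow> (nat \<Rightarrow> ('v, 'k) mpoly) \<Rightarrow> nat \<Rightarrow> ('v, 'k) mpoly" where
  "mat_vec N D u = (\<lambda>l. \<Sum>k<N. D l k * u k)"

definition syz :: "'v set \<Rightarrow> nat \<Rightarrow> (nat \<Rightarrow> nat \<Rightarrow> ('v, 'k::field) mpoly) \<Rightarrow> (nat \<Rightarrow> ('v, 'k) mpoly) set" where
  "syz V N D = {u \<in> free_mod V N. mat_vec N D u = (\<lambda>_. 0)}"

definition img :: "'v set \<Rightarrow> nat \<Rightarrow> (nat \<Rightarrow> nat \<Rightarrow> ('v, 'k::field) mpoly) \<Rightarrow> (nat \<Rightarrow> ('v, 'k) mpoly) set" where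
  "img V N D = mat_vec N D ` free_mod V N"

definition uniform :: "'v set \<Rightarrow> nat \<Rightarrow> nat \<Rightarrow> (nat \<Rightarrow> nat \<Rightarrow> ('v, 'k::field) mpoly) \<Rightarrow> bool" where
  "uniform V c N D \<longleftrightarrow> (\<forall>l. \<forall>k<N. vars (D l k) \<subseteq> V \<and> homogeneous c (D l k))"

definition unit_vec :: "nat \<Rightarrow> nat \<Rightarrow> ('v, 'k::field) mpoly" where
  "unit_vec k = (\<lambda>j. if j = k then 1 else 0)"

definition vcat :: "nat \<Rightarrow> (nat \<Rightarrow> 'a) \<Rightarrow> (nat \<Rightarrow> 'a) \<Rightarrow> nat \<Rightarrow> 'a" where
  "vcat p a b = (\<lambda>k. if k < p then a k else b (k - p))"

lemma free_mod_iff: "u \<in> free_mod V r \<longleftrightarrow> (\<forall>k. vars (u k) \<subseteq> V) \<and> (\<forall>k\<ge>r. u k = 0)"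
proof -
  have "vars (u k) \<subseteq> V" if "\<forall>k<r. vars (u k) \<subseteq> V" "\<forall>k\<ge>r. u k = 0" for k
    using that by (cases "k < r") auto
  then show ?thesis by (auto simp: free_mod_def)
qed

lemma free_mod_zero: "(\<lambda>_. 0) \<in> free_mod V r"
  and free_mod_add: "u \<in> free_mod V r \<Longrightarrow> w \<in> free_mod V r \<Longrightarrow> (\<lambda>l. u l + w l) \<in> free_mod V r"
  and free_mod_diff: "u \<in> free_mod V r \<Longrightarrow> w \<in> free_mod V r \<Longrightarrow> (\<lambda>l. u l - w l) \<in> free_mod V r"
  and free_mod_uminus: "u \<in> free_mod V r \<Longrightarrow> (\<lambda>l. - u l) \<in> free_mod V r"
  and free_mod_mult: "u \<in> free_mod V r \<Longrightarrow> vars x \<subseteq> V \<Longrightarrow> (\<lambda>l. x * u l) \<in> free_mod V r"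
  and free_mod_hcomp: "u \<in> free_mod V r \<Longrightarrow> (\<lambda>l. hcomp t (u l)) \<in> free_mod V r"
  and free_mod_unit_vec: "k < r \<Longrightarrow> unit_vec k \<in> free_mod V r"
  and free_mod_mono: "r \<le> s \<Longrightarrow> u \<in> free_mod V r \<Longrightarrow> u \<in> free_mod V s"
  and free_mod_vcat: "a \<in> free_mod V p \<Longrightarrow> b \<in> free_mod V q \<Longrightarrow> vcat p a b \<in> free_mod V (p + q)"
  by (simp_all add: free_mod_iff vars_add_in vars_minus_in vars_mult_in vars_uminus unit_vec_def vcat_def
      order_trans[OF vars_hcomp])

lemma free_mod_sum:
  "(\<And>i. i \<in> A \<Longrightarrow> f i \<in> free_mod V r) \<Longrightarrow> (\<lambda>l. \<Sum>i\<in>A. f i l) \<in> free_mod V r"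
  by (induction A rule: infinite_finite_induct) (simp_all add: free_mod_zero free_mod_add)

lemma mat_vec_diff: "mat_vec N D (\<lambda>k. u k - w k) = (\<lambda>l. mat_vec N D u l - mat_vec N D w l)"
  and mat_vec_uminus: "mat_vec N D (\<lambda>k. - u k) = (\<lambda>l. - mat_vec N D u l)"
  and mat_vec_zero: "mat_vec N D (\<lambda>_. 0) = (\<lambda>_. 0)"
  by (simp_all add: mat_vec_def right_diff_distrib sum_subtractf sum_negf)

lemma mat_vec_unit: "k < N \<Longrightarrow> mat_vec N D (unit_vec k) = (\<lambda>l. D l k)"
  by (simp add: mat_vec_def unit_vec_def if_distrib[of "(*) _"] cong: if_cong)

lemma mat_vec_cong:
  "(\<And>l k. k < N \<Longrightarrow> D l k = D' l k) \<Longrightarrow> (\<And>k. k < N \<Longrightarrow> u k = u' k) \<Longrightarrow> mat_vec N D u = mat_vec N D' u'"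
  by (simp add: mat_vec_def)

lemma mat_vec_mat_vec:
  "mat_vec N D (mat_vec M E u) = mat_vec M (\<lambda>l k. mat_vec N D (\<lambda>j. E j k) l) u"
proof
  fix l
  have "mat_vec N D (mat_vec M E u) l = (\<Sum>j<N. \<Sum>k<M. D l j * E j k * u k)"
    by (simp add: mat_vec_def sum_distrib_left mult.assoc)
  also have "\<dots> = (\<Sum>k<M. \<Sum>j<N. D l j * E j k * u k)" by (rule sum.swap)
  finally show "mat_vec N D (mat_vec M E u) l = mat_vec M (\<lambda>l k. mat_vec N D (\<lambda>j. E j k) l) u l"
    by (simp add: mat_vec_def sum_distrib_right)
qed

lemma mat_vec_vcat:
  "mat_vec (p + q) D (vcat p a b) = (\<lambda>l. mat_vec p D a l + mat_vec q (\<lambda>l k. D l (p + k)) b l)"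
proof
  fix l
  have "(\<Sum>k<p + q. D l k * vcat p a b k)
      = (\<Sum>k<p. D l k * vcat p a b k) + (\<Sum>k<q. D l (p + k) * vcat p a b (p + k))"
    by (induction q) (simp_all add: add.assoc)
  then show "mat_vec (p + q) D (vcat p a b) l = mat_vec p D a l + mat_vec q (\<lambda>l k. D l (p + k)) b l"
    by (simp add: mat_vec_def vcat_def)
qed

lemma mat_vec_truncate:
  assumes "u \<in> free_mod V p"
  shows "mat_vec (p + q) D u = mat_vec p D u"
proof -
  have "u = vcat p u (\<lambda>_. 0)" using assms by (auto simp: vcat_def free_mod_iff)
  then have "mat_vec (p + q) D u = mat_vec (p + q) D (vcat p u (\<lambda>_. 0))" by simp
  then show ?thesis unfolding mat_vec_vcat mat_vec_zero by simp
qed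

lemma mat_vec_hcomp:
  assumes "uniform V c N D"
  shows "hcomp t (mat_vec N D u l) = (if c \<le> t then mat_vec N D (\<lambda>k. hcomp (t - c) (u k)) l else 0)"
proof -
  have "hcomp t (mat_vec N D u l) = (\<Sum>k<N. if c \<le> t then D l k * hcomp (t - c) (u k) else 0)"
    unfolding mat_vec_def hcomp_sum
    by (rule sum.cong) (use assms in \<open>auto simp: uniform_def hcomp_mult\<close>)
  then show ?thesis by (simp add: mat_vec_def)
qed

lemma mat_vec_free_mod:
  assumes "\<And>k. k < M \<Longrightarrow> (\<lambda>l. E l k) \<in> free_mod V r" "u \<in> free_mod V M"
  shows "mat_vec M E u \<in> free_mod V r"
proof -
  have "(\<lambda>l. \<Sum>k\<in>{..<M}. u k * E l k) \<in> free_mod V r"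
    using assms by (intro free_mod_sum free_mod_mult) (auto simp: free_mod_iff[of u])
  then show ?thesis by (simp add: mat_vec_def mult.commute)
qed

lemma lookup_mat_vec_0: "lookup (mat_vec N D u l) 0 = (\<Sum>k<N. lookup (D l k) 0 * lookup (u k) 0)"
  by (simp add: mat_vec_def lookup_sum lookup_mult_0)

lemma mat_vec_identity:
  assumes "\<And>k. k < N \<Longrightarrow> (\<lambda>l. D l k) = unit_vec k" "u \<in> free_mod V N"
  shows "mat_vec N D u = u"
proof
  fix l
  have "mat_vec N D u l = (\<Sum>k<N. if l = k then u k else 0)"
    unfolding mat_vec_def
    by (rule sum.cong) (use assms(1) in \<open>auto simp: unit_vec_def fun_eq_iff\<close>)
  then show "mat_vec N D u l = u l"
    using assms(2) by (auto simp: free_mod_iff)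
qed

lemma
  assumes "u \<in> syz V N D"
  shows syz_free_mod: "u \<in> free_mod V N" and syz_eq: "mat_vec N D u = (\<lambda>_. 0)"
    and syz_diff: "w \<in> syz V N D \<Longrightarrow> (\<lambda>l. u l - w l) \<in> syz V N D"
  using assms by (simp_all add: syz_def free_mod_diff mat_vec_diff)

lemma syz_mat_vec:
  assumes "\<And>k. k < M \<Longrightarrow> (\<lambda>l. E l k) \<in> syz V N D" "u \<in> free_mod V M"
  shows "mat_vec M E u \<in> syz V N D"
proof -
  have "mat_vec M (\<lambda>l k. mat_vec N D (\<lambda>j. E j k) l) u = mat_vec M (\<lambda>_ _. 0) u"
    by (rule mat_vec_cong) (use syz_eq[OF assms(1)] in \<open>auto simp: fun_eq_iff\<close>)
  then show ?thesis
    using assms mat_vec_free_mod[of M E V N u]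
    by (simp add: syz_def mat_vec_mat_vec) (simp add: mat_vec_def)
qed

lemma img_column: "k < N \<Longrightarrow> (\<lambda>l. D l k) \<in> img V N D"
  unfolding img_def using free_mod_unit_vec[of k N V] mat_vec_unit[of k N D] by (metis image_eqI)

section \<open>Modules with a linear resolution\<close>

text \<open>
  A coinductive reading is essential: the syzygies of the generators are required to be linearly
  generated at every later step, with no base case.  After the first step the degree is always 1,
  because a syzygy module sits in a free module whose basis elements all have the same degree, and its
  generators lie one degree higher.
\<close>

coinductive linear_module :: "'v set \<Rightarrow> nat \<Rightarrow> (nat \<Rightarrow> ('v, 'k::field) mpoly) set \<Rightarrow> bool" for V where
  linear_moduleI:
    "uniform V c N D \<Longrightarrow> linear_module V 1 (syz V N D) \<Longrightarrow> linear_module V c (img V N D)"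

text \<open>
  The splitting of the columns of \<open>D\<close> into the first \<open>p\<close> and the last \<open>q\<close> makes its syzygy module an
  extension of a submodule of the free module of rank \<open>q\<close> by the syzygies of the first \<open>p\<close> columns.
  Generators of the two outer modules give generators of the middle one, as in the horseshoe lemma, and the
  syzygies of these generators form an extension of the same kind.  This is one step of the coinduction.
  The grading is used to lift the generators \<open>D2\<close> of the quotient to elements of the same degree.
\<close>

lemma linear_extension_step:
  fixes D :: "nat \<Rightarrow> nat \<Rightarrow> ('v, 'k::field) mpoly"
  assumes D: "uniform V e (p + q) D"
    and D1: "uniform V c N1 D1" "syz V p D = img V N1 D1"
    and D2: "uniform V c N2 D2"
      "{w \<in> free_mod V q. \<exists>u\<in>free_mod V p. vcat p u w \<in> syz V (p + q) D} = img V N2 D2"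
  obtains D' where "uniform V c (N1 + N2) D'" "syz V (p + q) D = img V (N1 + N2) D'"
    "syz V N1 D' = syz V N1 D1"
    "{w \<in> free_mod V N2. \<exists>u\<in>free_mod V N1. vcat N1 u w \<in> syz V (N1 + N2) D'} = syz V N2 D2"
proof -
  let ?K = "syz V (p + q) D"
  have "\<exists>u. u \<in> free_mod V p \<and> vcat p u (\<lambda>l. D2 l j) \<in> ?K" if "j < N2" for j
    using img_column[OF that, of D2 V] D2(2) by blast
  then obtain U where U: "\<And>j. j < N2 \<Longrightarrow> U j \<in> free_mod V p"
      "\<And>j. j < N2 \<Longrightarrow> vcat p (U j) (\<lambda>l. D2 l j) \<in> ?K"
    by metis
  \<comment> \<open>the lifts \<open>U\<close> need not be homogeneous, but their components of degree \<open>c\<close> are lifts as well\<close>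
  define E where "E l j = hcomp c (U j l)" for l j
  have E: "vcat p (\<lambda>l. E l j) (\<lambda>l. D2 l j) \<in> ?K" if j: "j < N2" for j
  proof -
    have "(\<lambda>k. hcomp c (vcat p (U j) (\<lambda>l. D2 l j) k)) = vcat p (\<lambda>l. E l j) (\<lambda>l. D2 l j)"
      using D2(1) j hcomp_of_homogeneous[of c "D2 _ j" c] by (simp add: vcat_def E_def uniform_def fun_eq_iff)
    moreover have "mat_vec (p + q) D (\<lambda>k. hcomp c (vcat p (U j) (\<lambda>l. D2 l j) k)) = (\<lambda>_. 0)"
      using mat_vec_hcomp[OF D, of "e + c" "vcat p (U j) (\<lambda>l. D2 l j)"] syz_eq[OF U(2)[OF j]]
      by (simp add: fun_eq_iff)
    ultimately show ?thesis
      using free_mod_hcomp[OF syz_free_mod[OF U(2)[OF j]], of c] by (simp add: syz_def)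
  qed
  define D' where "D' l k = (if k < N1 then D1 l k
    else vcat p (\<lambda>l. E l (k - N1)) (\<lambda>l. D2 l (k - N1)) l)" for l k
  have lower: "u \<in> ?K" if "u \<in> syz V p D" for u
    using that mat_vec_truncate[of u V p q D] free_mod_mono[of p "p + q" u V]
    by (simp add: syz_def)
  have lower': "u \<in> syz V p D" if "u \<in> ?K" "\<And>l. l \<ge> p \<Longrightarrow> u l = 0" for u
  proof -
    have u: "u \<in> free_mod V p" using that by (simp add: syz_def free_mod_iff)
    then show ?thesis
      using that mat_vec_truncate[OF u, of q D] by (simp add: syz_def)
  qed
  have col1: "(\<lambda>l. D1 l k) \<in> syz V p D" if "k < N1" for k
    using img_column[OF that, of D1 V] D1(2) by simp
  have D1_zero: "D1 l k = 0" if "k < N1" "l \<ge> p" for l k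
    using syz_free_mod[OF col1[OF that(1)]] that(2) by (simp add: free_mod_iff)
  have col: "(\<lambda>l. D' l k) \<in> ?K" if "k < N1 + N2" for k
    using that lower[OF col1, of k] E[of "k - N1"] by (cases "k < N1") (simp_all add: D'_def)
  have D'1: "mat_vec N1 D' a = mat_vec N1 D1 a" for a
    by (rule mat_vec_cong) (simp_all add: D'_def)
  define Z where "Z b = mat_vec N2 (\<lambda>l k. D' l (N1 + k)) b" for b
  have Z_in: "Z b \<in> ?K" if "b \<in> free_mod V N2" for b
    unfolding Z_def by (rule syz_mat_vec[OF _ that]) (use col in auto)
  have Z_up: "Z b l = mat_vec N2 D2 b (l - p)" if "l \<ge> p" for b l
    using that by (simp add: Z_def mat_vec_def D'_def vcat_def)
  have D'_vcat: "mat_vec (N1 + N2) D' (vcat N1 a b) = (\<lambda>l. mat_vec N1 D1 a l + Z b l)" for a b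
    unfolding mat_vec_vcat D'1 Z_def ..
  have "uniform V c (N1 + N2) D'"
    unfolding uniform_def
  proof (intro allI impI conjI)
    fix l k assume k: "k < N1 + N2"
    show "vars (D' l k) \<subseteq> V" using syz_free_mod[OF col[OF k]] by (simp add: free_mod_iff)
    have "homogeneous c (D2 (l - p) (k - N1))" if "\<not> k < N1"
      using D2(1) k that by (simp add: uniform_def)
    moreover have "homogeneous c (D1 l k)" if "k < N1"
      using D1(1) that by (simp add: uniform_def)
    ultimately show "homogeneous c (D' l k)"
      by (simp add: D'_def vcat_def E_def hcomp_homogeneous)
  qed
  moreover have "?K = img V (N1 + N2) D'"
  proof
    show "img V (N1 + N2) D' \<subseteq> ?K"
      unfolding img_def using syz_mat_vec[where E = D' and M = "N1 + N2", OF col] by blast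
    show "?K \<subseteq> img V (N1 + N2) D'"
    proof
      fix u assume u: "u \<in> ?K"
      let ?u = "\<lambda>l. if l < p then u l else 0" and ?w = "\<lambda>l. u (l + p)"
      have "vcat p ?u ?w = u" by (auto simp: vcat_def)
      moreover have "?u \<in> free_mod V p" "?w \<in> free_mod V q"
        using syz_free_mod[OF u] by (auto simp: free_mod_iff)
      ultimately have "?w \<in> img V N2 D2" using u unfolding D2(2)[symmetric] by (intro CollectI conjI bexI[of _ ?u]) simp_all
      then obtain b where b: "b \<in> free_mod V N2" "?w = mat_vec N2 D2 b" by (auto simp: img_def)
      have "(\<lambda>l. u l - Z b l) \<in> syz V p D"
      proof (rule lower')
        show "(\<lambda>l. u l - Z b l) \<in> ?K" by (rule syz_diff[OF u Z_in[OF b(1)]])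
        show "u l - Z b l = 0" if "l \<ge> p" for l
          using Z_up[OF that, of b] fun_cong[OF b(2), of "l - p"] that by simp
      qed
      then obtain a where a: "a \<in> free_mod V N1" "(\<lambda>l. u l - Z b l) = mat_vec N1 D1 a"
        unfolding D1(2) by (auto simp: img_def)
      have "u = mat_vec (N1 + N2) D' (vcat N1 a b)"
        unfolding D'_vcat using fun_cong[OF a(2)] by (auto simp: fun_eq_iff algebra_simps)
      then show "u \<in> img V (N1 + N2) D'"
        unfolding img_def using free_mod_vcat[OF a(1) b(1)] by blast
    qed
  qed
  moreover have "syz V N1 D' = syz V N1 D1"
    by (simp add: syz_def D'1)
  moreover have "{w \<in> free_mod V N2. \<exists>u\<in>free_mod V N1. vcat N1 u w \<in> syz V (N1 + N2) D'} = syz V N2 D2"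
  proof (intro equalityI subsetI)
    fix w assume "w \<in> {w \<in> free_mod V N2. \<exists>u\<in>free_mod V N1. vcat N1 u w \<in> syz V (N1 + N2) D'}"
    then obtain a where w: "w \<in> free_mod V N2" and a: "a \<in> free_mod V N1"
      "mat_vec (N1 + N2) D' (vcat N1 a w) = (\<lambda>_. 0)" by (auto simp: syz_def)
    have "mat_vec N2 D2 w l = 0" for l
    proof -
      have "mat_vec N1 D1 a (l + p) + Z w (l + p) = 0"
        using fun_cong[OF a(2), of "l + p"] unfolding D'_vcat .
      moreover have "mat_vec N1 D1 a (l + p) = 0" by (simp add: mat_vec_def D1_zero)
      ultimately show ?thesis by (simp add: Z_up)
    qed
    then show "w \<in> syz V N2 D2" using w by (auto simp: syz_def)
  next
    fix w assume w: "w \<in> syz V N2 D2"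
    have "Z w \<in> syz V p D"
      by (rule lower'[OF Z_in[OF syz_free_mod[OF w]]]) (simp add: Z_up syz_eq[OF w])
    then obtain a where a: "a \<in> free_mod V N1" "Z w = mat_vec N1 D1 a"
      unfolding D1(2) by (auto simp: img_def)
    have "mat_vec (N1 + N2) D' (vcat N1 (\<lambda>l. - a l) w) = (\<lambda>_. 0)"
      unfolding D'_vcat mat_vec_uminus a(2) by simp
    then show "w \<in> {w \<in> free_mod V N2. \<exists>u\<in>free_mod V N1. vcat N1 u w \<in> syz V (N1 + N2) D'}"
      using free_mod_uminus[OF a(1)] free_mod_vcat[OF free_mod_uminus[OF a(1)] syz_free_mod[OF w]]
        syz_free_mod[OF w]
      by (auto simp: syz_def)
  qed
  ultimately show thesis by (rule that)
qed

lemma linear_module_extension: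
  fixes D :: "nat \<Rightarrow> nat \<Rightarrow> ('v, 'k::field) mpoly"
  assumes "uniform V e (p + q) D" "linear_module V c (syz V p D)"
    "linear_module V c {w \<in> free_mod V q. \<exists>u\<in>free_mod V p. vcat p u w \<in> syz V (p + q) D}"
  shows "linear_module V c (syz V (p + q) D)"
proof -
  define R where "R c K \<longleftrightarrow> (\<exists>p q e (D :: nat \<Rightarrow> nat \<Rightarrow> ('v, 'k) mpoly).
    K = syz V (p + q) D \<and> uniform V e (p + q) D \<and> linear_module V c (syz V p D) \<and>
    linear_module V c {w \<in> free_mod V q. \<exists>u\<in>free_mod V p. vcat p u w \<in> syz V (p + q) D})" for c K
  have "R c (syz V (p + q) D)" unfolding R_def using assms by blast
  then show ?thesis
  proof (rule linear_module.coinduct[of R])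
    fix c K assume "R c K"
    then obtain p q e and D :: "nat \<Rightarrow> nat \<Rightarrow> ('v, 'k) mpoly" where
      K: "K = syz V (p + q) D" and D: "uniform V e (p + q) D"
      and 1: "linear_module V c (syz V p D)"
      and 2: "linear_module V c {w \<in> free_mod V q. \<exists>u\<in>free_mod V p. vcat p u w \<in> syz V (p + q) D}"
      unfolding R_def by blast
    from 1 obtain N1 D1 where D1: "uniform V c N1 D1" "syz V p D = img V N1 D1"
      "linear_module V 1 (syz V N1 D1)" by cases auto
    from 2 obtain N2 D2 where D2: "uniform V c N2 D2"
      "{w \<in> free_mod V q. \<exists>u\<in>free_mod V p. vcat p u w \<in> syz V (p + q) D} = img V N2 D2"
      "linear_module V 1 (syz V N2 D2)" by cases auto
    obtain D' where D': "uniform V c (N1 + N2) D'" "syz V (p + q) D = img V (N1 + N2) D'"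
      "syz V N1 D' = syz V N1 D1"
      "{w \<in> free_mod V N2. \<exists>u\<in>free_mod V N1. vcat N1 u w \<in> syz V (N1 + N2) D'} = syz V N2 D2"
      by (rule linear_extension_step[OF D D1(1,2) D2(1,2)])
    have "R 1 (syz V (N1 + N2) D')"
      unfolding R_def using D' D1(3) D2(3) by (intro exI[of _ N1] exI[of _ N2] exI[of _ c] exI[of _ D']) simp
    then show "\<exists>c' N D'. c = c' \<and> K = img V N D' \<and> uniform V c' N D' \<and>
        (R 1 (syz V N D') \<or> linear_module V 1 (syz V N D'))"
      using K D'(1,2) by blast
  qed
qed

text \<open>
  The zero module has the empty system of generators.
\<close>

lemma linear_module_zero: "linear_module V c {\<lambda>_. 0 :: ('v, 'k::field) mpoly}"
proof -
  have *: "free_mod V 0 = {\<lambda>_. 0 :: ('v, 'k) mpoly}" by (auto simp: free_mod_iff)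
  have **: "syz V 0 D = {\<lambda>_. 0}" "img V 0 D = {\<lambda>_. 0}" for D :: "nat \<Rightarrow> nat \<Rightarrow> ('v, 'k) mpoly"
    unfolding syz_def img_def * by (auto simp: mat_vec_def)
  define R where "R (c::nat) K \<longleftrightarrow> K = {\<lambda>_::nat. 0 :: ('v, 'k) mpoly}" for c K
  have "R c {\<lambda>_. 0}" by (simp add: R_def)
  then show ?thesis
  proof (rule linear_module.coinduct[of R])
    fix c K assume "R c K"
    then show "\<exists>c' N D. c = c' \<and> K = img V N D \<and> uniform V c' N D \<and>
        (R 1 (syz V N D) \<or> linear_module V 1 (syz V N D))"
      by (intro exI[of _ c] exI[of _ 0] exI[of _ "\<lambda>_ _. 0"]) (simp add: R_def uniform_def **)
  qed
qed

section \<open>Linear quotients\<close>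

text \<open>
  Ideals are treated as submodules of the free module of rank one.
\<close>

definition vec1 :: "('v, 'k::field) mpoly \<Rightarrow> nat \<Rightarrow> ('v, 'k) mpoly" where
  "vec1 p = (\<lambda>l. if l = 0 then p else 0)"

definition row1 :: "(nat \<Rightarrow> ('v, 'k::field) mpoly) \<Rightarrow> nat \<Rightarrow> nat \<Rightarrow> ('v, 'k) mpoly" where
  "row1 f = (\<lambda>l k. if l = 0 then f k else 0)"

lemma vec1_eq_iff [simp]: "vec1 p = vec1 q \<longleftrightarrow> p = q"
  by (auto simp: vec1_def fun_eq_iff)

lemma vec1_eq_0_iff [simp]: "vec1 p = (\<lambda>_. 0) \<longleftrightarrow> p = 0"
  by (auto simp: vec1_def fun_eq_iff)

lemma mat_vec_row1: "mat_vec N (row1 f) u = vec1 (\<Sum>k<N. f k * u k)"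
  by (auto simp: mat_vec_def row1_def vec1_def)

lemma free_mod_1: "free_mod V 1 = vec1 ` {p. vars p \<subseteq> V}"
proof (intro equalityI subsetI)
  fix u assume "u \<in> free_mod V 1"
  then have "u = vec1 (u 0)" "vars (u 0) \<subseteq> V" by (auto simp: free_mod_iff vec1_def)
  then show "u \<in> vec1 ` {p. vars p \<subseteq> V}" by blast
qed (auto simp: free_mod_iff vec1_def split: if_splits)

lemma img_row1:
  fixes f :: "nat \<Rightarrow> ('v, 'k::field) mpoly"
  assumes f: "\<And>k. k < N \<Longrightarrow> vars (f k) \<subseteq> V"
  shows "img V N (row1 f) = vec1 ` (Idl\<^bsub>mpoly_ring V\<^esub> (f ` {..<N}))"
proof -
  let ?I = "Idl\<^bsub>mpoly_ring V\<^esub> (f ` {..<N})"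
  let ?S = "{p. \<exists>u\<in>free_mod V N. p = (\<Sum>k<N. f k * u k)}"
  have gens: "vars g \<subseteq> V" if "g \<in> f ` {..<N}" for g using that f by auto
  have I: "ideal ?I (mpoly_ring V)" by (rule Idl_ideal) (rule gens)
  have "?I = ?S"
  proof
    show "?I \<subseteq> ?S"
    proof (rule Idl_least[OF gens])
      show "ideal ?S (mpoly_ring V)"
      proof (rule mpoly_idealI)
        show "vars p \<subseteq> V" if "p \<in> ?S" for p
        proof -
          from that obtain u where "u \<in> free_mod V N" "p = (\<Sum>k<N. f k * u k)" by blast
          then show ?thesis
            using f by (simp only:, intro vars_sum vars_mult_in) (auto simp: free_mod_iff)
        qed
        show "0 \<in> ?S" using free_mod_zero by (force intro: bexI[of _ "\<lambda>_. 0"])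
        show "p + q \<in> ?S" if pq: "p \<in> ?S" "q \<in> ?S" for p q
        proof -
          from pq obtain u w where "u \<in> free_mod V N" "p = (\<Sum>k<N. f k * u k)"
            "w \<in> free_mod V N" "q = (\<Sum>k<N. f k * w k)" by blast
          then have "p + q = (\<Sum>k<N. f k * (u k + w k))" "(\<lambda>k. u k + w k) \<in> free_mod V N"
            by (simp_all add: distrib_left sum.distrib free_mod_add)
          then show ?thesis by (intro CollectI bexI)
        qed
        show "q * p \<in> ?S" if p: "p \<in> ?S" and q: "vars q \<subseteq> V" for p q
        proof -
          from p obtain u where "u \<in> free_mod V N" "p = (\<Sum>k<N. f k * u k)" by blast
          then have "q * p = (\<Sum>k<N. f k * (q * u k))" "(\<lambda>k. q * u k) \<in> free_mod V N"
            using q by (simp_all add: sum_distrib_left mult.left_commute free_mod_mult)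
          then show ?thesis by (intro CollectI bexI)
        qed
      qed
      show "f ` {..<N} \<subseteq> ?S"
      proof
        fix g assume "g \<in> f ` {..<N}"
        then obtain k where k: "k < N" "g = f k" by auto
        then have "g = (\<Sum>j<N. f j * unit_vec k j)"
          using fun_cong[OF mat_vec_unit[OF k(1), of "row1 f"], of 0] by (simp add: mat_vec_def row1_def)
        then show "g \<in> ?S" using free_mod_unit_vec[OF k(1)] by blast
      qed
    qed
    show "?S \<subseteq> ?I"
    proof clarify
      fix u :: "nat \<Rightarrow> ('v, 'k) mpoly" assume u: "u \<in> free_mod V N"
      have "(\<Sum>k<N. u k * f k) \<in> ?I"
      proof (rule mpoly_ideal_sum[OF I])
        fix k assume "k \<in> {..<N}"
        then have "f k \<in> ?I" by (intro Idl_self gens) auto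
        then show "u k * f k \<in> ?I"
          by (rule mpoly_ideal_mult[OF I]) (use u in \<open>simp add: free_mod_iff\<close>)
      qed
      then show "(\<Sum>k<N. f k * u k) \<in> ?I" by (simp add: mult.commute)
    qed
  qed
  then show ?thesis by (auto simp: img_def mat_vec_row1)
qed

lemma img_row1_monom:
  assumes "\<And>k. k < N \<Longrightarrow> keys (g k) \<subseteq> V"
  shows "img V N (row1 (\<lambda>k. monom (g k) :: ('v, 'k::field) mpoly)) = vec1 ` monomial_span V (g ` {..<N})"
proof -
  have "(\<lambda>k. monom (g k) :: ('v, 'k) mpoly) ` {..<N} = monom ` g ` {..<N}" by auto
  moreover have "Idl\<^bsub>mpoly_ring V\<^esub> (monom ` g ` {..<N}) = (monomial_span V (g ` {..<N}) :: ('v, 'k) mpoly set)"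
    by (rule Idl_monom) (use assms in auto)
  ultimately show ?thesis using assms by (simp add: img_row1)
qed

definition variable_ideal :: "'v set \<Rightarrow> 'v set \<Rightarrow> ('v, 'k::field) mpoly set" where
  "variable_ideal V T = {p. vars p \<subseteq> V \<and> (\<forall>m\<in>keys p. keys m \<inter> T \<noteq> {})}"

text \<open>
  The syzygies of the first \<open>k + 1\<close> generators are an extension of the colon ideal of the first \<open>k\<close>
  generators by the next one, which is generated by variables, by the syzygies of the first \<open>k\<close>
  generators.  So the extension lemma applies repeatedly.
\<close>

lemma linear_quotients:
  fixes g :: "nat \<Rightarrow> ('v \<Rightarrow>\<^sub>0 nat)"
  assumes g: "\<And>k. k < N \<Longrightarrow> keys (g k) \<subseteq> V" "\<And>k. k < N \<Longrightarrow> mdeg (g k) = c"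
    and colon: "\<And>k m. k < N \<Longrightarrow> (\<exists>j<k. mon_dvd (g j) (g k + m)) \<longleftrightarrow> keys m \<inter> T k \<noteq> {}"
    and lin: "\<And>k. k < N \<Longrightarrow> linear_module V 1 (vec1 ` (variable_ideal V (T k) :: ('v, 'k::field) mpoly set))"
  shows "linear_module V c (vec1 ` (monomial_span V (g ` {..<N}) :: ('v, 'k) mpoly set))"
proof -
  let ?G = "row1 (\<lambda>k. monom (g k) :: ('v, 'k) mpoly)"
  have unif: "uniform V c n ?G" if "n \<le> N" for n
  proof -
    have "homogeneous c (monom (g k) :: ('v, 'k) mpoly)" if "k < N" for k
      using homogeneous_monom[of "g k", where 'b = 'k] g(2)[OF that] by simp
    then show ?thesis using that g(1) by (simp add: uniform_def row1_def)
  qed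
  have "linear_module V 1 (syz V n ?G)" if "n \<le> N" for n
    using that
  proof (induction n)
    case 0
    have "syz V 0 ?G = {\<lambda>_. 0}" by (auto simp: syz_def free_mod_iff mat_vec_def)
    then show ?case using linear_module_zero by simp
  next
    case (Suc n)
    then have n: "n < N" by simp
    have "{w \<in> free_mod V 1. \<exists>u\<in>free_mod V n. vcat n u w \<in> syz V (n + 1) ?G}
        = vec1 ` (variable_ideal V (T n))"
    proof -
      have "(\<exists>u\<in>free_mod V n. vcat n u (vec1 s) \<in> syz V (n + 1) ?G) \<longleftrightarrow> s \<in> variable_ideal V (T n)"
        if s: "vars s \<subseteq> V" for s
      proof -
        have s1: "vec1 s \<in> free_mod V 1" unfolding free_mod_1 using s by blast
        have shift: "mat_vec 1 (\<lambda>l k. ?G l (n + k)) (vec1 s) = vec1 (monom (g n) * s)"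
          by (auto simp: mat_vec_def row1_def vec1_def)
        have eq: "vcat n u (vec1 s) \<in> syz V (n + 1) ?G \<longleftrightarrow> mat_vec n ?G u = vec1 (- (monom (g n) * s))"
          if u: "u \<in> free_mod V n" for u
          using free_mod_vcat[OF u s1]
          by (simp only: syz_def mem_Collect_eq mat_vec_vcat shift)
            (auto simp: vec1_def fun_eq_iff eq_neg_iff_add_eq_0)
        have "(\<exists>u\<in>free_mod V n. vcat n u (vec1 s) \<in> syz V (n + 1) ?G)
            \<longleftrightarrow> vec1 (- (monom (g n) * s)) \<in> img V n ?G"
          unfolding img_def image_iff by (rule bex_cong[OF refl], subst eq, assumption, rule eq_commute)
        also have "\<dots> \<longleftrightarrow> - (monom (g n) * s) \<in> monomial_span V (g ` {..<n})"
          using g n by (subst img_row1_monom) auto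
        also have "\<dots> \<longleftrightarrow> (\<forall>m\<in>keys s. \<exists>j<n. mon_dvd (g j) (g n + m))"
        proof -
          have "vars (monom (g n) * s) \<subseteq> V" using g n s by (simp add: vars_mult_in)
          moreover have "keys (- (monom (g n) * s)) = (+) (g n) ` keys s"
            by (simp add: keys_monom_mult[symmetric] set_eq_iff in_keys_iff)
          ultimately show ?thesis by (simp add: monomial_span_def vars_uminus Bex_def)
        qed
        also have "\<dots> \<longleftrightarrow> s \<in> variable_ideal V (T n)"
          using colon[OF n] s by (simp add: variable_ideal_def)
        finally show ?thesis .
      qed
      moreover have "vars s \<subseteq> V" if "s \<in> variable_ideal V (T n)" for s :: "('v, 'k) mpoly"
        using that by (simp add: variable_ideal_def)
      ultimately show ?thesis unfolding free_mod_1 by blast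
    qed
    then have "linear_module V 1 {w \<in> free_mod V 1. \<exists>u\<in>free_mod V n. vcat n u w \<in> syz V (n + 1) ?G}"
      using lin[OF n] by simp
    moreover have "uniform V c (n + 1) ?G" using unif n by simp
    ultimately have "linear_module V 1 (syz V (n + 1) ?G)"
      using Suc by (intro linear_module_extension) auto
    then show ?case by simp
  qed
  then have "linear_module V c (img V N ?G)"
    using unif by (intro linear_moduleI) auto
  then show ?thesis using g by (simp add: img_row1_monom)
qed

text \<open>
  The resolution is the Koszul complex.  It is obtained from linear quotients again, because
  the colon ideal of some variables by a further one is generated by these variables.
\<close>

lemma linear_module_variables:
  assumes "finite T" "T \<subseteq> V"
  shows "linear_module V 1 (vec1 ` (variable_ideal V T :: ('v, 'k::field) mpoly set))"
  using assms
proof (induction "card T" arbitrary: T rule: less_induct)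
  case less
  obtain g where g: "bij_betw g {..<card T} T"
    using less.prems(1) ex_bij_betw_nat_finite[of T] unfolding atLeast0LessThan by blast
  let ?s = "\<lambda>v. Poly_Mapping.single v (1::nat)"
  have dvd: "mon_dvd (?s v) m \<longleftrightarrow> v \<in> keys m" for v m
    by (auto simp: mon_dvd_def lookup_single when_def in_keys_iff)
  have "linear_module V 1 (vec1 ` (monomial_span V ((\<lambda>k. ?s (g k)) ` {..<card T}) :: ('v, 'k) mpoly set))"
  proof (rule linear_quotients[where T = "\<lambda>k. g ` {..<k}"])
    fix k assume k: "k < card T"
    show "keys (?s (g k)) \<subseteq> V" using bij_betw_apply[OF g, of k] k less.prems by auto
    show "mdeg (?s (g k)) = 1" by simp
    have ne: "g j \<noteq> g k" if "j < k" for j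
      using inj_onD[OF bij_betw_imp_inj_on[OF g], of j k] that k by auto
    show "(\<exists>j<k. mon_dvd (?s (g j)) (?s (g k) + m)) \<longleftrightarrow> keys m \<inter> g ` {..<k} \<noteq> {}" for m
    proof -
      have "mon_dvd (?s (g j)) (?s (g k) + m) \<longleftrightarrow> g j \<in> keys m" if "j < k" for j
        unfolding dvd keys_add_nat using ne[OF that] by simp
      then show ?thesis by blast
    qed
    have sub: "g ` {..<k} \<subseteq> T" using bij_betw_apply[OF g] k by auto
    have "card (g ` {..<k}) = k"
      using inj_on_subset[OF bij_betw_imp_inj_on[OF g], of "{..<k}"] k by (simp add: card_image)
    then have "card (g ` {..<k}) < card T" "g ` {..<k} \<subseteq> V" using sub less.prems k by simp_all
    then show "linear_module V 1 (vec1 ` (variable_ideal V (g ` {..<k}) :: ('v, 'k) mpoly set))"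
      by (rule less.hyps[OF _ finite_imageI[OF finite_lessThan]])
  qed
  moreover have "monomial_span V ((\<lambda>k. ?s (g k)) ` {..<card T}) = (variable_ideal V T :: ('v, 'k) mpoly set)"
  proof -
    have "(\<lambda>k. ?s (g k)) ` {..<card T} = ?s ` T"
      unfolding image_image[of ?s g, symmetric] bij_betw_imp_surj_on[OF g] ..
    moreover have "(\<exists>a\<in>?s ` T. mon_dvd a m) \<longleftrightarrow> keys m \<inter> T \<noteq> {}" for m
      using dvd[of _ m] by blast
    ultimately have "(\<exists>a\<in>(\<lambda>k. ?s (g k)) ` {..<card T}. mon_dvd a m) \<longleftrightarrow> keys m \<inter> T \<noteq> {}" for m
      by simp
    then show ?thesis by (simp add: monomial_span_def variable_ideal_def)
  qed
  ultimately show ?case by simp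
qed

section \<open>Minimal resolutions of modules with a linear resolution\<close>

text \<open>
  A module of this kind is generated by its elements of degree \<open>c\<close>, so a minimal generator cannot have
  another degree.  Then the columns of \<open>E\<close> and those of a matrix \<open>D\<close> provided by \<open>linear_module\<close> are related
  by matrices of scalars \<open>A\<close> and \<open>B\<close>.  The columns of \<open>A B - 1\<close> and \<open>B A - 1\<close> are syzygies with constant
  entries, which vanish by minimality.  Hence \<open>B\<close> maps the syzygies of \<open>D\<close> isomorphically to those of \<open>E\<close>.
  This comparison of generators replaces the comparison of resolutions by chain maps.
\<close>

lemma linear_module_minimal_generators:
  fixes E :: "nat \<Rightarrow> nat \<Rightarrow> ('v, 'k::field) mpoly"
  assumes lin: "linear_module V c (img V M E)"
    and vars: "\<And>l k. k < M \<Longrightarrow> vars (E l k) \<subseteq> V"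
    and col: "\<And>k. k < M \<Longrightarrow> \<exists>t. \<forall>l. homogeneous t (E l k)"
    and minimal_gens: "\<And>u. u \<in> syz V M E \<Longrightarrow> \<forall>k<M. lookup (u k) 0 = 0"
  shows "uniform V c M E" and "\<And>k. k < M \<Longrightarrow> \<exists>l. E l k \<noteq> 0" and "linear_module V 1 (syz V M E)"
proof -
  from lin obtain N D where D: "uniform V c N D" "img V M E = img V N D"
    "linear_module V 1 (syz V N D)" by cases auto
  have minimal: "lookup (u k) 0 = 0" if "u \<in> syz V M E" "k < M" for u k
    using minimal_gens that by blast
  show nonzero: "\<exists>l. E l k \<noteq> 0" if k: "k < M" for k
  proof (rule ccontr)
    assume "\<nexists>l. E l k \<noteq> 0"
    then have "unit_vec k \<in> syz V M E"
      using k by (simp add: syz_def free_mod_unit_vec mat_vec_unit)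
    from minimal[OF this k] show False by (simp add: unit_vec_def)
  qed
  \<comment> \<open>each family of columns is expressed through the other; the coefficients of \<open>E\<close> can be taken homogeneous\<close>
  have "\<exists>q. q \<in> free_mod V M \<and> (\<lambda>l. D l j) = mat_vec M E q" if "j < N" for j
    using img_column[OF that, of D V] unfolding D(2)[symmetric] by (auto simp: img_def)
  then obtain Q where Q: "\<And>j. j < N \<Longrightarrow> Q j \<in> free_mod V M"
      "\<And>j. j < N \<Longrightarrow> (\<lambda>l. D l j) = mat_vec M E (Q j)" by metis
  have E_D: "\<exists>p. p \<in> free_mod V N \<and> (\<lambda>l. E l k) = mat_vec N D p \<and> (\<forall>j. homogeneous (t - c) (p j)) \<and> c \<le> t"
    if k: "k < M" and t: "\<forall>l. homogeneous t (E l k)" for k t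
  proof -
    obtain p where p: "p \<in> free_mod V N" "(\<lambda>l. E l k) = mat_vec N D p"
      using img_column[OF k, of E V] unfolding D(2) by (auto simp: img_def)
    have "E l k = hcomp t (mat_vec N D p l)" for l
      using t hcomp_of_homogeneous[of t "E l k" t] fun_cong[OF p(2), of l] by metis
    then have *: "E l k = (if c \<le> t then mat_vec N D (\<lambda>k. hcomp (t - c) (p k)) l else 0)" for l
      by (simp add: mat_vec_hcomp[OF D(1)])
    then have "c \<le> t" using nonzero[OF k] by metis
    then show ?thesis
      using * free_mod_hcomp[OF p(1)] hcomp_homogeneous by (intro exI[of _ "\<lambda>k. hcomp (t - c) (p k)"]) auto
  qed
  have E_E: "mat_vec N D p = mat_vec M E (mat_vec N (\<lambda>l j. Q j l) p)" for p
    unfolding mat_vec_mat_vec by (rule mat_vec_cong) (use Q(2) in \<open>auto simp: fun_eq_iff\<close>)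
  have QP_free: "mat_vec N (\<lambda>l j. Q j l) p \<in> free_mod V M" if "p \<in> free_mod V N" for p
    by (rule mat_vec_free_mod[OF _ that]) (use Q(1) in simp)
  have deg: "t = c" if k: "k < M" and t: "\<forall>l. homogeneous t (E l k)" for k t
  proof (rule ccontr)
    assume "t \<noteq> c"
    obtain p where p: "p \<in> free_mod V N" "(\<lambda>l. E l k) = mat_vec N D p" "\<forall>j. homogeneous (t - c) (p j)" "c \<le> t"
      using E_D[OF k t] by blast
    \<comment> \<open>otherwise column \<open>k\<close> is a combination of all columns with coefficients in the maximal ideal\<close>
    have "(\<lambda>l. unit_vec k l - mat_vec N (\<lambda>l j. Q j l) p l) \<in> syz V M E"
      unfolding syz_def
      using E_E[of p] p k by (simp add: free_mod_diff free_mod_unit_vec QP_free mat_vec_diff mat_vec_unit)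
    from minimal[OF this k] have "1 = (\<Sum>j<N. lookup (Q j k) 0 * lookup (p j) 0)"
      by (simp add: unit_vec_def lookup_minus lookup_mat_vec_0)
    moreover have "lookup (p j) 0 = 0" for j
      using homogeneous_lookup_0[of "t - c" "p j"] p(3,4) \<open>t \<noteq> c\<close> by simp
    ultimately show False by simp
  qed
  have homog: "homogeneous c (E l k)" if "k < M" for l k
    using col[OF that] deg[OF that] by blast
  then show unif: "uniform V c M E" using vars by (simp add: uniform_def)
  \<comment> \<open>the two families now differ by scalar matrices, which are inverse to each other\<close>
  have "\<exists>p. p \<in> free_mod V N \<and> (\<lambda>l. E l k) = mat_vec N D p \<and> (\<forall>j. homogeneous 0 (p j))" if "k < M" for k
    using E_D[OF that, of c] homog[OF that] by auto
  then obtain P where P: "\<And>k. k < M \<Longrightarrow> P k \<in> free_mod V N" "\<And>k. k < M \<Longrightarrow> (\<lambda>l. E l k) = mat_vec N D (P k)"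
      "\<And>k j. k < M \<Longrightarrow> homogeneous 0 (P k j)" by metis
  define R where "R j = (\<lambda>k. hcomp 0 (Q j k))" for j
  have R: "R j \<in> free_mod V M" "(\<lambda>l. D l j) = mat_vec M E (R j)" "homogeneous 0 (R j k)" if "j < N" for j k
  proof -
    show "R j \<in> free_mod V M" unfolding R_def by (rule free_mod_hcomp[OF Q(1)[OF that]])
    show "homogeneous 0 (R j k)" by (simp add: R_def hcomp_homogeneous)
    show "(\<lambda>l. D l j) = mat_vec M E (R j)"
    proof
      fix l
      have "D l j = hcomp c (D l j)" using D(1) that by (simp add: uniform_def hcomp_of_homogeneous[of c])
      also have "\<dots> = hcomp c (mat_vec M E (Q j) l)" using fun_cong[OF Q(2)[OF that], of l] by simp
      also have "\<dots> = mat_vec M E (R j) l" by (simp add: mat_vec_hcomp[OF unif] R_def)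
      finally show "D l j = mat_vec M E (R j) l" .
    qed
  qed
  define A where "A = mat_vec M (\<lambda>j k. P k j)"
  define B where "B = mat_vec N (\<lambda>k j. R j k)"
  have A_free: "A u \<in> free_mod V N" if "u \<in> free_mod V M" for u
    unfolding A_def by (rule mat_vec_free_mod[OF _ that]) (use P(1) in simp)
  have B_free: "B u \<in> free_mod V M" if "u \<in> free_mod V N" for u
    unfolding B_def by (rule mat_vec_free_mod[OF _ that]) (use R(1) in simp)
  have DA: "mat_vec N D (A u) = mat_vec M E u" for u
    unfolding A_def mat_vec_mat_vec by (rule mat_vec_cong) (use P(2) in \<open>auto simp: fun_eq_iff\<close>)
  have EB: "mat_vec M E (B u) = mat_vec N D u" for u
    unfolding B_def mat_vec_mat_vec by (rule mat_vec_cong) (use R(2) in \<open>auto simp: fun_eq_iff\<close>)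
  have const_zero: "w = (\<lambda>_. 0)"
    if "\<And>k. homogeneous 0 (w k)" "\<And>k. lookup (w k) 0 = 0" for w :: "nat \<Rightarrow> ('v, 'k) mpoly"
    using homogeneous_0_const[OF that(1)] that(2) by (auto simp: fun_eq_iff)
  have hom_mult0: "homogeneous 0 (p * q)" if "homogeneous 0 p" "homogeneous 0 q" for p q :: "('v, 'k) mpoly"
    using homogeneous_mult[OF that] by simp
  have BA: "B (A u) = u" if u: "u \<in> free_mod V M" for u
    unfolding B_def A_def mat_vec_mat_vec
  proof (rule mat_vec_identity[OF _ u])
    fix k assume k: "k < M"
    let ?w = "\<lambda>l. mat_vec N (\<lambda>k j. R j k) (P k) l - unit_vec k l"
    have w: "?w \<in> syz V M E"
      using EB[of "P k"] B_free[OF P(1)[OF k]] P(2)[OF k] k unfolding B_def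
      by (simp add: syz_def free_mod_diff free_mod_unit_vec mat_vec_diff mat_vec_unit)
    have "?w = (\<lambda>_. 0)"
    proof (rule const_zero)
      show "homogeneous 0 (?w l)" for l
        using R(3) P(3)[OF k]
        by (intro homogeneous_minus) (auto simp: mat_vec_def unit_vec_def intro!: homogeneous_sum hom_mult0)
      show "lookup (?w l) 0 = 0" for l
        using minimal[OF w, of l] syz_free_mod[OF w] by (cases "l < M") (auto simp: free_mod_iff)
    qed
    then show "(\<lambda>l. mat_vec N (\<lambda>k j. R j k) (\<lambda>j. P k j) l) = unit_vec k" by (auto simp: fun_eq_iff)
  qed
  \<comment> \<open>the system \<open>D\<close> is minimal too, since its syzygies are generated by vectors of linear forms\<close>
  have minimal': "lookup (w j) 0 = 0" if w: "w \<in> syz V N D" for w j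
  proof -
    from D(3) obtain N' D' where "uniform V 1 N' D'" "syz V N D = img V N' D'" by cases auto
    then obtain a where "w = mat_vec N' D' a" "uniform V 1 N' D'" using w by (auto simp: img_def)
    then show ?thesis by (simp add: lookup_mat_vec_0 uniform_def homogeneous_lookup_0[of 1])
  qed
  have AB: "A (B u) = u" if u: "u \<in> free_mod V N" for u
    unfolding B_def A_def mat_vec_mat_vec
  proof (rule mat_vec_identity[OF _ u])
    fix j assume j: "j < N"
    let ?w = "\<lambda>l. mat_vec M (\<lambda>j k. P k j) (R j) l - unit_vec j l"
    have w: "?w \<in> syz V N D"
      using DA[of "R j"] A_free[OF R(1)[OF j]] R(2)[OF j] j unfolding A_def
      by (simp add: syz_def free_mod_diff free_mod_unit_vec mat_vec_diff mat_vec_unit)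
    have "?w = (\<lambda>_. 0)"
    proof (rule const_zero)
      show "homogeneous 0 (?w l)" for l
        using P(3) R(3)[OF j]
        by (intro homogeneous_minus) (auto simp: mat_vec_def unit_vec_def intro!: homogeneous_sum hom_mult0)
    qed (rule minimal'[OF w])
    then show "(\<lambda>l. mat_vec M (\<lambda>j k. P k j) (\<lambda>k. R j k) l) = unit_vec j" by (auto simp: fun_eq_iff)
  qed
  from D(3) obtain N' D' where D': "uniform V 1 N' D'" "syz V N D = img V N' D'"
    "linear_module V 1 (syz V N' D')" by cases auto
  let ?E' = "\<lambda>l k. B (\<lambda>j. D' j k) l"
  have D'_free: "(\<lambda>j. D' j k) \<in> free_mod V N" if "k < N'" for k
    using img_column[OF that, of D' V] unfolding D'(2)[symmetric] by (rule syz_free_mod)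
  have E'D': "mat_vec N' ?E' u = B (mat_vec N' D' u)" for u
    unfolding B_def mat_vec_mat_vec ..
  have syz_E: "syz V M E = B ` syz V N D"
  proof (intro equalityI subsetI)
    fix u assume u: "u \<in> syz V M E"
    then have "A u \<in> syz V N D" by (simp add: syz_def A_free DA)
    moreover have "u = B (A u)" using BA u by (simp add: syz_def)
    ultimately show "u \<in> B ` syz V N D" by blast
  qed (auto simp: syz_def B_free EB)
  have "img V N' ?E' = B ` img V N' D'"
    unfolding img_def image_image E'D' ..
  then have "syz V M E = img V N' ?E'" using syz_E D'(2) by simp
  moreover have "uniform V 1 N' ?E'"
    unfolding uniform_def
  proof (intro allI impI conjI)
    fix l k assume k: "k < N'"
    show "vars (B (\<lambda>j. D' j k) l) \<subseteq> V"
      using B_free[OF D'_free[OF k]] by (simp add: free_mod_iff)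
    have "homogeneous 1 (R j l * D' j k)" if "j < N" for j
      using homogeneous_mult[OF R(3)[OF that]] D'(1) k by (fastforce simp: uniform_def)
    then show "homogeneous 1 (B (\<lambda>j. D' j k) l)"
      unfolding B_def mat_vec_def by (intro homogeneous_sum) simp
  qed
  moreover have "syz V N' ?E' = syz V N' D'"
  proof -
    have "B (mat_vec N' D' u) = (\<lambda>_. 0) \<longleftrightarrow> mat_vec N' D' u = (\<lambda>_. 0)" if "u \<in> free_mod V N'" for u
    proof
      assume *: "B (mat_vec N' D' u) = (\<lambda>_. 0)"
      have "mat_vec N' D' u = A (B (mat_vec N' D' u))"
        using AB mat_vec_free_mod[OF D'_free that] by simp
      then show "mat_vec N' D' u = (\<lambda>_. 0)" unfolding * by (simp add: A_def mat_vec_zero)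
    qed (simp add: B_def mat_vec_zero)
    then show ?thesis unfolding syz_def E'D' by blast
  qed
  ultimately show "linear_module V 1 (syz V M E)"
    using linear_moduleI[of V 1 N' ?E'] D'(3) by simp
qed

text \<open>
  Unfolding \<open>linear_module\<close> again and again gives the matrices of a resolution.  All entries of the
  differentials are linear forms, so the resolution is minimal.
\<close>

lemma linear_module_resolution:
  fixes I :: "('v, 'k::field) mpoly set"
  assumes lin: "linear_module V d (vec1 ` I)"
  shows "\<exists>F. minimal_graded_free_resolution V I F"
proof -
  from lin obtain N0 D0 where D0: "uniform V d N0 D0" "vec1 ` I = img V N0 D0"
    "linear_module V 1 (syz V N0 D0)" by cases auto
  define P where "P i x \<longleftrightarrow> uniform V (if i = 0 then d else 1) (fst x) (snd x)
      \<and> linear_module V 1 (syz V (fst x) (snd x)) \<and> (i = 0 \<longrightarrow> x = (N0, D0))"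
    for i :: nat and x :: "nat \<times> (nat \<Rightarrow> nat \<Rightarrow> ('v, 'k) mpoly)"
  define Q where "Q i x y \<longleftrightarrow> syz V (fst x) (snd x) = img V (fst y) (snd y)"
    for i :: nat and x y :: "nat \<times> (nat \<Rightarrow> nat \<Rightarrow> ('v, 'k) mpoly)"
  have "\<exists>f. \<forall>n. P n (f n) \<and> Q n (f n) (f (Suc n))"
  proof (rule dependent_nat_choice)
    show "\<exists>x. P 0 x" using D0 by (auto simp: P_def)
    fix x n assume "P n x"
    then have "linear_module V 1 (syz V (fst x) (snd x))" by (simp add: P_def)
    then obtain N D where "uniform V 1 N D" "syz V (fst x) (snd x) = img V N D"
      "linear_module V 1 (syz V N D)" by cases auto
    then show "\<exists>y. P (Suc n) y \<and> Q n x y" by (intro exI[of _ "(N, D)"]) (simp add: P_def Q_def)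
  qed
  then obtain f where f: "\<And>n. P n (f n)" "\<And>n. Q n (f n) (f (Suc n))" by blast
  define N where "N i = fst (f i)" for i
  define D where "D i = snd (f i)" for i
  have N0: "N 0 = N0" "D 0 = D0" using f(1)[of 0] by (simp_all add: P_def N_def D_def)
  have unif: "uniform V 1 (N (Suc i)) (D (Suc i))" for i
    using f(1)[of "Suc i"] by (simp add: P_def N_def D_def)
  have exact: "syz V (N i) (D i) = img V (N (Suc i)) (D (Suc i))" for i
    using f(2)[of i] by (simp add: Q_def N_def D_def)
  define F :: "('v, 'k) free_complex" where
    "F = \<lparr>rk = N, shift = (\<lambda>i k. i + d), aug = D 0 0, diff = (\<lambda>i. D (Suc i))\<rparr>"
  have F: "rk F = N" "shift F = (\<lambda>i k. i + d)" "aug F = D 0 0" "diff F = (\<lambda>i. D (Suc i))"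
    by (simp_all add: F_def)
  have D0_zero: "D 0 l k = 0" if "l > 0" "k < N 0" for l k
  proof -
    have "(\<lambda>l. D 0 l k) \<in> vec1 ` I" using img_column[OF that(2), of "D 0" V] D0(2) N0 by simp
    then obtain p where "(\<lambda>l. D 0 l k) = vec1 p" by blast
    from fun_cong[OF this, of l] show ?thesis using that by (simp add: vec1_def)
  qed
  have D_zero: "D (Suc i) l k = 0" if "l \<ge> N i" "k < N (Suc i)" for i l k
  proof -
    have "(\<lambda>l. D (Suc i) l k) \<in> syz V (N i) (D i)" using img_column[OF that(2), of "D (Suc i)" V] exact by simp
    then show ?thesis using that syz_free_mod by (fastforce simp: free_mod_iff)
  qed
  have aug: "vec1 (aug_map F u) = mat_vec (N 0) (D 0) u" for u
    by (auto simp: aug_map_def F mat_vec_def vec1_def D0_zero fun_eq_iff)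
  have dif: "diff_map F i u = mat_vec (N (Suc i)) (D (Suc i)) u" for i u
    by (auto simp: diff_map_def F mat_vec_def D_zero fun_eq_iff)
  have "minimal_graded_free_resolution V I F"
    unfolding minimal_graded_free_resolution_def
  proof (intro conjI)
    show "\<forall>k<rk F 0. aug F k \<in> carrier (mpoly_ring V) \<and> homogeneous (shift F 0 k) (aug F k)"
      using D0(1) N0 by (simp add: F uniform_def)
    show "\<forall>i. \<forall>l<rk F i. \<forall>k<rk F (Suc i). diff F i l k \<in> carrier (mpoly_ring V) \<and>
        (\<forall>m\<in>keys (diff F i l k). mdeg m + shift F i l = shift F (Suc i) k)"
      using unif by (auto simp: F uniform_def homogeneous_def)
    have "vec1 ` aug_map F ` free_mod V (rk F 0) = vec1 ` I"
      using D0(2) N0 by (simp add: image_image aug img_def F)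
    then show "aug_map F ` free_mod V (rk F 0) = I"
      by (rule inj_image_eq_iff[THEN iffD1, rotated]) (simp add: inj_def)
    have "aug_map F u = 0 \<longleftrightarrow> mat_vec (N 0) (D 0) u = (\<lambda>_. 0)" for u
      using aug[of u] vec1_eq_0_iff by metis
    then show "{u \<in> free_mod V (rk F 0). aug_map F u = 0} = diff_map F 0 ` free_mod V (rk F 1)"
      using exact[of 0] by (simp add: F syz_def img_def dif)
    show "\<forall>i. {u \<in> free_mod V (rk F (Suc i)). diff_map F i u = (\<lambda>_. 0)}
        = diff_map F (Suc i) ` free_mod V (rk F (Suc (Suc i)))"
      using exact by (simp add: F syz_def img_def dif)
    show "\<forall>i. \<forall>l<rk F i. \<forall>k<rk F (Suc i). lookup (diff F i l k) 0 = 0"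
      using unif by (simp add: F uniform_def homogeneous_lookup_0[of 1])
  qed
  then show ?thesis by blast
qed

text \<open>
  Each kernel of a minimal resolution is, by exactness, generated minimally by the next matrix.  So the
  comparison of minimal generators determines the shifts one after the other.
\<close>

lemma linear_module_shifts:
  fixes I :: "('v, 'k::field) mpoly set"
  assumes lin: "linear_module V d (vec1 ` I)" and F: "minimal_graded_free_resolution V I F"
    and k: "k < rk F i"
  shows "shift F i k = i + d"
proof -
  define E where "E i l k = (if l < rk F i then diff F i l k else 0)" for i l k
  have dif: "diff_map F i u = mat_vec (rk F (Suc i)) (E i) u" for i u
    by (auto simp: diff_map_def mat_vec_def E_def fun_eq_iff)
  note F' = F[unfolded minimal_graded_free_resolution_def carrier_mpoly_ring]
  have F_aug: "\<And>k. k < rk F 0 \<Longrightarrow> vars (aug F k) \<subseteq> V \<and> homogeneous (shift F 0 k) (aug F k)"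
    using F'[THEN conjunct1] by blast
  have F_diff: "\<forall>i. \<forall>l<rk F i. \<forall>k<rk F (Suc i). vars (diff F i l k) \<subseteq> V \<and>
      (\<forall>m\<in>keys (diff F i l k). mdeg m + shift F i l = shift F (Suc i) k)"
    using F'[THEN conjunct2, THEN conjunct1] .
  then have F_vars: "\<And>i l k. l < rk F i \<Longrightarrow> k < rk F (Suc i) \<Longrightarrow> vars (diff F i l k) \<subseteq> V"
    and F_deg: "\<And>i l k m. l < rk F i \<Longrightarrow> k < rk F (Suc i) \<Longrightarrow> m \<in> keys (diff F i l k)
      \<Longrightarrow> mdeg m + shift F i l = shift F (Suc i) k"
    by blast+
  have F_img: "aug_map F ` free_mod V (rk F 0) = I"
    and ex0: "{u \<in> free_mod V (rk F 0). aug_map F u = 0} = diff_map F 0 ` free_mod V (rk F 1)"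
    and exS: "\<And>i. {u \<in> free_mod V (rk F (Suc i)). diff_map F i u = (\<lambda>_. 0)}
      = diff_map F (Suc i) ` free_mod V (rk F (Suc (Suc i)))"
    and F_min: "\<And>i l k. l < rk F i \<Longrightarrow> k < rk F (Suc i) \<Longrightarrow> lookup (diff F i l k) 0 = 0"
    using F'[THEN conjunct2, THEN conjunct2] by simp_all
  have min_img: "lookup (u l) 0 = 0" if "u \<in> img V (rk F (Suc i)) (E i)" for u i l
    using that F_min by (auto simp: img_def lookup_mat_vec_0 E_def intro!: sum.neutral)
  have syzE: "syz V (rk F (Suc i)) (E i) = img V (rk F (Suc (Suc i))) (E (Suc i))" for i
    using exS[of i] unfolding syz_def img_def dif .
  have "(\<forall>k<rk F i. shift F i k = i + d) \<and> linear_module V 1 (img V (rk F (Suc i)) (E i))" for i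
  proof (induction i)
    case 0
    let ?A = "row1 (aug F)"
    have aug: "mat_vec (rk F 0) ?A u = vec1 (aug_map F u)" for u
      by (simp add: mat_vec_row1 aug_map_def)
    have syzA: "syz V (rk F 0) ?A = img V (rk F (Suc 0)) (E 0)"
      using ex0 unfolding syz_def img_def dif aug by simp
    have "img V (rk F 0) ?A = vec1 ` I" unfolding F_img[symmetric] img_def aug image_image ..
    then have lin': "linear_module V d (img V (rk F 0) ?A)" using lin by simp
    have vars: "\<And>l k. k < rk F 0 \<Longrightarrow> vars (?A l k) \<subseteq> V" using F_aug by (simp add: row1_def)
    have col: "\<And>k. k < rk F 0 \<Longrightarrow> \<exists>t. \<forall>l. homogeneous t (?A l k)"
      using F_aug by (metis homogeneous_zero row1_def)
    have minimal: "\<And>u. u \<in> syz V (rk F 0) ?A \<Longrightarrow> \<forall>k<rk F 0. lookup (u k) 0 = 0"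
      unfolding syzA using min_img by blast
    note gens = linear_module_minimal_generators[OF lin' vars col minimal]
    have 1: "uniform V d (rk F 0) ?A" and 2: "\<And>k. k < rk F 0 \<Longrightarrow> \<exists>l. ?A l k \<noteq> 0"
      and 3: "linear_module V 1 (syz V (rk F 0) ?A)"
      using gens by blast+
    have "shift F 0 k = d" if "k < rk F 0" for k
    proof (rule homogeneous_unique)
      show "homogeneous (shift F 0 k) (aug F k)" using F_aug that by blast
      have "homogeneous d (?A 0 k)" using 1 that unfolding uniform_def by blast
      then show "homogeneous d (aug F k)" by (simp add: row1_def)
      show "aug F k \<noteq> 0" using 2[OF that] by (auto simp: row1_def split: if_splits)
    qed
    then show ?case using 3 syzA by simp
  next
    case (Suc i)
    then have sh: "\<And>l. l < rk F i \<Longrightarrow> shift F i l = i + d"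
      and lin': "linear_module V 1 (img V (rk F (Suc i)) (E i))" by auto
    have hom: "homogeneous (shift F (Suc i) k - (i + d)) (E i l k)" if "k < rk F (Suc i)" for l k
      using F_deg[of l i k] sh[of l] that by (force simp: E_def homogeneous_def)
    have vars: "\<And>l k. k < rk F (Suc i) \<Longrightarrow> vars (E i l k) \<subseteq> V" using F_vars by (simp add: E_def)
    have col: "\<And>k. k < rk F (Suc i) \<Longrightarrow> \<exists>t. \<forall>l. homogeneous t (E i l k)" using hom by blast
    have minimal: "\<And>u. u \<in> syz V (rk F (Suc i)) (E i) \<Longrightarrow> \<forall>k<rk F (Suc i). lookup (u k) 0 = 0"
      unfolding syzE using min_img by blast
    note gens = linear_module_minimal_generators[OF lin' vars col minimal]
    have 1: "uniform V 1 (rk F (Suc i)) (E i)"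
      and 2: "\<And>k. k < rk F (Suc i) \<Longrightarrow> \<exists>l. E i l k \<noteq> 0"
      and 3: "linear_module V 1 (syz V (rk F (Suc i)) (E i))"
      using gens by blast+
    have "shift F (Suc i) k = Suc i + d" if k: "k < rk F (Suc i)" for k
    proof -
      obtain l where "E i l k \<noteq> 0" using 2[OF k] by blast
      moreover have "homogeneous 1 (E i l k)" using 1 k unfolding uniform_def by blast
      ultimately have "shift F (Suc i) k - (i + d) = 1" using homogeneous_unique[OF hom[OF k]] by blast
      then show ?thesis by simp
    qed
    then show ?case using 3 syzE by simp
  qed
  then show ?thesis using k by blast
qed

theorem linear_module_imp_linear_resolution:
  fixes G :: "('v, 'k::field) mpoly set"
  assumes "\<And>g. g \<in> G \<Longrightarrow> vars g \<subseteq> V \<and> homogeneous d g"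
    and "linear_module V d (vec1 ` (Idl\<^bsub>mpoly_ring V\<^esub> G))"
  shows "has_linear_resolution V d (Idl\<^bsub>mpoly_ring V\<^esub> G)"
proof -
  let ?I = "Idl\<^bsub>mpoly_ring V\<^esub> G"
  have F: "minimal_graded_free_resolution V ?I (SOME F. minimal_graded_free_resolution V ?I F)"
    using linear_module_resolution[OF assms(2)] by (rule someI_ex)
  have "j = i + d" if "graded_betti V ?I i j \<noteq> 0" for i j
  proof -
    let ?F = "SOME F. minimal_graded_free_resolution V ?I F"
    have "{k. k < rk ?F i \<and> shift ?F i k = j} \<noteq> {}"
      using that unfolding graded_betti_def Let_def by (metis card.empty)
    then show ?thesis using linear_module_shifts[OF assms(2) F, of _ i] by auto
  qed
  moreover have "G \<subseteq> carrier (mpoly_ring V)" "\<forall>g\<in>G. homogeneous d g" using assms(1) by auto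
  ultimately show ?thesis unfolding has_linear_resolution_def by blast
qed

section \<open>Differences of variables modulo monomial ideals\<close>

lemma mon_dvd_single: "mon_dvd (Poly_Mapping.single v 1) m \<longleftrightarrow> 0 < lookup m v"
  by (auto simp: mon_dvd_def lookup_single when_def)

text \<open>
  Let \<open>U\<close> be the set of monomials of the ideal, and follow a monomial \<open>m\<close> of \<open>p\<close> along the line through
  \<open>m\<close> on which powers of \<open>a\<close> are traded for powers of \<open>b\<close>.  The coefficients of the product are differences
  of neighbouring coefficients of \<open>p\<close>, so they vanish outside \<open>U\<close> only while the coefficient stays constant.
  Since the line is finite, trading \<open>a\<close> for \<open>b\<close> must lead to a monomial in \<open>U\<close>.  If \<open>b\<close> does not divide \<open>m\<close>,
  the line ends at \<open>m\<close> in the other direction, and the product of \<open>m\<close> and \<open>a\<close> is in \<open>U\<close>.  The assumption on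
  \<open>U\<close> says that this is enough for \<open>m\<close> to be in \<open>U\<close>.
\<close>

lemma difference_of_variables_nonzerodivisor:
  fixes p :: "('v, 'k::field) mpoly"
  assumes ab: "a \<noteq> b"
    and U: "\<And>m m'. m' \<in> U \<Longrightarrow> lookup m' a \<le> lookup m a \<Longrightarrow>
        (\<And>v. v \<noteq> a \<Longrightarrow> v \<noteq> b \<Longrightarrow> lookup m' v = lookup m v) \<Longrightarrow>
        0 < lookup m b \<or> m + Poly_Mapping.single a 1 \<in> U \<Longrightarrow> m \<in> U"
    and prod: "keys ((X a - X b) * p) \<subseteq> U"
  shows "keys p \<subseteq> U"
proof
  let ?a = "Poly_Mapping.single a (1::nat)" and ?b = "Poly_Mapping.single b (1::nat)"
  let ?D = "(X a - X b) * p"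
  have D: "lookup ?D m = (if 0 < lookup m a then lookup p (m - ?a) else 0)
      - (if 0 < lookup m b then lookup p (m - ?b) else 0)" for m
    by (simp only: left_diff_distrib lookup_minus X_def lookup_monom_mult mon_dvd_single)
  have down: "\<exists>m'\<in>U. lookup m' a \<le> lookup m a \<and> (\<forall>v. v \<noteq> a \<longrightarrow> v \<noteq> b \<longrightarrow> lookup m' v = lookup m v)"
    if "m \<in> keys p" for m
    using that
  proof (induction "lookup m a" arbitrary: m rule: less_induct)
    case less
    let ?x = "m + ?b"
    have x: "lookup ?x a = lookup m a" "\<And>v. v \<noteq> b \<Longrightarrow> lookup ?x v = lookup m v" "lookup ?x b > 0" "?x - ?b = m"
      using ab by (auto simp: lookup_add lookup_single)
    have Dx: "lookup ?D ?x = (if 0 < lookup m a then lookup p (?x - ?a) else 0) - lookup p m"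
      unfolding D using x by simp
    show ?case
    proof (cases "?x \<in> U")
      case True
      then show ?thesis using x by (intro bexI[of _ ?x]) auto
    next
      case False
      then have "lookup ?D ?x = 0" using prod by (auto simp: in_keys_iff)
      then have *: "0 < lookup m a" "lookup p (?x - ?a) = lookup p m"
        using less.prems unfolding Dx by (auto simp: in_keys_iff split: if_splits)
      let ?y = "?x - ?a"
      have y: "lookup ?y a < lookup m a" "\<And>v. v \<noteq> a \<Longrightarrow> v \<noteq> b \<Longrightarrow> lookup ?y v = lookup m v"
        using ab *(1) by (auto simp: lookup_add lookup_minus lookup_single)
      have "?y \<in> keys p" using *(2) less.prems by (simp add: in_keys_iff)
      from less.hyps[OF y(1) this] obtain m' where "m' \<in> U" "lookup m' a \<le> lookup ?y a"
        "\<forall>v. v \<noteq> a \<longrightarrow> v \<noteq> b \<longrightarrow> lookup m' v = lookup ?y v" by blast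
      then show ?thesis using y by (intro bexI[of _ m']) auto
    qed
  qed
  fix m assume m: "m \<in> keys p"
  have "0 < lookup m b \<or> m + ?a \<in> U"
  proof (rule disjCI)
    assume "m + ?a \<notin> U"
    then have "lookup ?D (m + ?a) = 0" using prod by (auto simp: in_keys_iff)
    then have "lookup p m = (if 0 < lookup m b then lookup p (m + ?a - ?b) else 0)"
      unfolding D using ab by (auto simp: lookup_add lookup_single split: if_splits)
    then show "0 < lookup m b" using m by (auto simp: in_keys_iff split: if_splits)
  qed
  with down[OF m] show "m \<in> U" using U by blast
qed

section \<open>Eliminating variables by linear forms\<close>

lemma var_hom_vimage_ideal:
  assumes "\<And>v. v \<in> V \<Longrightarrow> f v \<in> W" and K: "ideal K (mpoly_ring W)"
  shows "ideal {p. vars p \<subseteq> V \<and> var_hom f p \<in> K} (mpoly_ring V)"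
proof (rule mpoly_idealI)
  fix p q
  assume p: "p \<in> {p. vars p \<subseteq> V \<and> var_hom f p \<in> K}"
  show "vars p \<subseteq> V" using p by simp
  show "p + q \<in> {p. vars p \<subseteq> V \<and> var_hom f p \<in> K}" if "q \<in> {p. vars p \<subseteq> V \<and> var_hom f p \<in> K}"
    using p that by (simp add: var_hom_add vars_add_in mpoly_ideal_add[OF K])
  show "q * p \<in> {p. vars p \<subseteq> V \<and> var_hom f p \<in> K}" if "vars q \<subseteq> V"
    using p that assms(1) by (simp add: var_hom_mult vars_mult_in mpoly_ideal_mult[OF K] vars_var_hom)
qed (simp add: mpoly_ideal_zero[OF K])

text \<open>
  Modulo the differences \<open>X v - X (f v)\<close>, the substitution \<open>f\<close> is the identity.
\<close>

lemma ideal_minus_var_hom: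
  fixes p :: "('v, 'k::field) mpoly"
  assumes p: "vars p \<subseteq> V" and f: "\<And>v. v \<in> V \<Longrightarrow> f v \<in> V"
    and K: "ideal K (mpoly_ring V)" and X: "\<And>v. v \<in> V \<Longrightarrow> X v - X (f v) \<in> K"
  shows "p - var_hom f p \<in> K"
  using p
proof (induction rule: mpoly_induct)
  case (add p q)
  have "p + q - var_hom f (p + q) = (p - var_hom f p) + (q - var_hom f q)"
    by (simp add: var_hom_add)
  then show ?case using mpoly_ideal_add[OF K add(3,4)] by (simp only:)
next
  case (mult p q)
  have "p * q - var_hom f (p * q) = p * (q - var_hom f q) + var_hom f q * (p - var_hom f p)"
    by (simp add: var_hom_mult algebra_simps)
  moreover have "vars (var_hom f q) \<subseteq> V" using mult(2) f by (rule vars_var_hom)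
  then have "p * (q - var_hom f q) + var_hom f q * (p - var_hom f p) \<in> K"
    by (intro mpoly_ideal_add[OF K] mpoly_ideal_mult[OF K] mult)
  ultimately show ?case by (simp only:)
qed (simp_all add: mpoly_ideal_zero[OF K] X)

text \<open>
  Adding the linear forms \<open>F\<close> to a monomial ideal can be tested after the substitution \<open>f\<close> that kills
  them, where the ideal is again monomial.  The substitution stays inside the same polynomial ring, so that no
  isomorphism of quotient rings is needed.
\<close>

lemma Idl_union_linear_forms:
  fixes F :: "('v, 'k::field) mpoly set"
  assumes M: "\<And>m. m \<in> M \<Longrightarrow> keys m \<subseteq> V" and f: "\<And>v. v \<in> V \<Longrightarrow> f v \<in> V"
    and F: "\<And>g. g \<in> F \<Longrightarrow> vars g \<subseteq> V \<and> var_hom f g = 0"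
    and X: "\<And>v. v \<in> V \<Longrightarrow> f v = v \<or> X (f v) - X v \<in> F"
  shows "Idl\<^bsub>mpoly_ring V\<^esub> (monomial_span V M \<union> F)
    = {p. vars p \<subseteq> V \<and> var_hom f p \<in> monomial_span V (var_image f ` M)}"
proof
  let ?G = "monomial_span V M \<union> F"
  let ?K = "Idl\<^bsub>mpoly_ring V\<^esub> ?G"
  let ?P = "{p :: ('v, 'k) mpoly. vars p \<subseteq> V \<and> var_hom f p \<in> monomial_span V (var_image f ` M)}"
  have fM: "keys m \<subseteq> V" if "m \<in> var_image f ` M" for m
    using that keys_var_image[where f = f, OF M f] by blast
  have gens: "vars g \<subseteq> V" if "g \<in> ?G" for g
    using that F by (auto simp: monomial_span_def)
  have idealP: "ideal ?P (mpoly_ring V)"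
    by (rule var_hom_vimage_ideal[OF f ideal_monomial_span])
  show "?K \<subseteq> ?P"
  proof (rule Idl_least[OF gens idealP])
    have "monomial_span V M = (Idl\<^bsub>mpoly_ring V\<^esub> (monom ` M) :: ('v, 'k) mpoly set)"
      by (rule Idl_monom[OF M, symmetric])
    also have "\<dots> \<subseteq> ?P"
    proof (rule Idl_least[OF _ idealP])
      show "vars g \<subseteq> V" if "g \<in> monom ` M" for g :: "('v, 'k) mpoly" using that M by fastforce
      show "monom ` M \<subseteq> ?P"
      proof
        fix g :: "('v, 'k) mpoly" assume "g \<in> monom ` M"
        then obtain m where m: "m \<in> M" "g = monom m" by blast
        then show "g \<in> ?P"
          using M[OF m(1)] fM[of "var_image f m"] by (auto simp: monomial_span_def intro!: bexI[of _ m])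
      qed
    qed
    finally show "?G \<subseteq> ?P" using F mpoly_ideal_zero[OF ideal_monomial_span] by auto
  qed
  have K: "ideal ?K (mpoly_ring V)" by (rule Idl_ideal) (rule gens)
  have X_K: "X v - X (f v) \<in> ?K" if "v \<in> V" for v
  proof (cases "f v = v")
    case False
    then have "X (f v) - X v \<in> ?K" using X[OF that] by (intro Idl_self gens) auto
    from mpoly_ideal_uminus[OF K this] show ?thesis by simp
  qed (simp add: mpoly_ideal_zero[OF K])
  have sub: "monomial_span V (var_image f ` M) \<subseteq> ?K"
  proof -
    have "monomial_span V (var_image f ` M) = (Idl\<^bsub>mpoly_ring V\<^esub> (monom ` var_image f ` M) :: ('v, 'k) mpoly set)"
      by (rule Idl_monom[OF fM, symmetric])
    also have "\<dots> \<subseteq> ?K"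
    proof (rule Idl_least[OF _ K])
      show "vars g \<subseteq> V" if "g \<in> monom ` var_image f ` M" for g :: "('v, 'k) mpoly"
        using that fM by fastforce
      show "monom ` var_image f ` M \<subseteq> ?K"
      proof clarify
        fix m assume m: "m \<in> M"
        have "(monom m :: ('v, 'k) mpoly) \<in> monomial_span V M"
          using m M[OF m] by (auto simp: monomial_span_def intro!: bexI[of _ m])
        then have "monom m \<in> ?K" by (intro Idl_self gens) auto
        moreover have "monom m - var_hom f (monom m) \<in> ?K"
          by (rule ideal_minus_var_hom[OF _ f K X_K]) (use M[OF m] in auto)
        ultimately have "monom m + - (monom m - var_hom f (monom m)) \<in> ?K"
          using mpoly_ideal_add[OF K] mpoly_ideal_uminus[OF K] by blast
        then show "monom (var_image f m) \<in> ?K" by simp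
      qed
    qed
    finally show ?thesis .
  qed
  show "?P \<subseteq> ?K"
  proof clarify
    fix p :: "('v, 'k) mpoly" assume p: "vars p \<subseteq> V" "var_hom f p \<in> monomial_span V (var_image f ` M)"
    have "p - var_hom f p \<in> ?K" by (rule ideal_minus_var_hom[OF p(1) f K X_K])
    from mpoly_ideal_add[OF K this, of "var_hom f p"] show "p \<in> ?K" using p(2) sub by auto
  qed
qed

section \<open>Ideals in quotient rings\<close>

lemma zero_FactRing: "\<zero>\<^bsub>R Quot I\<^esub> = I"
  by (simp add: FactRing_def)

text \<open>
  Moves the conditions on a regular sequence in a quotient ring to the ring itself.
\<close>

lemma (in ring) Idl_quotient_iff:
  assumes I: "ideal I R" and A: "A \<subseteq> carrier R" and x: "x \<in> carrier R"
  shows "I +> x \<in> Idl\<^bsub>R Quot I\<^esub> ((+>) I ` A) \<longleftrightarrow> x \<in> Idl (I \<union> A)"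
proof -
  interpret I: ideal I R by fact
  interpret h: ring_hom_ring R "R Quot I" "(+>) I" by (rule I.rcos_ring_hom_ring)
  let ?K = "Idl (I \<union> A)" and ?Q = "Idl\<^bsub>R Quot I\<^esub> ((+>) I ` A)"
  have IA: "I \<union> A \<subseteq> carrier R" using I.a_subset A by auto
  have hA: "(+>) I ` A \<subseteq> carrier (R Quot I)" using A h.hom_closed by blast
  have K: "ideal ?K R" by (rule genideal_ideal[OF IA])
  have Q: "ideal ?Q (R Quot I)" by (rule h.S.genideal_ideal[OF hA])
  show ?thesis
  proof
    assume "I +> x \<in> ?Q"
    moreover have "?Q \<subseteq> (+>) I ` ?K"
    proof (rule h.S.genideal_minimal[OF ring_ideal_imp_quot_ideal[OF I K]])
      have "A \<subseteq> ?K" using genideal_self[OF IA] by blast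
      then show "(+>) I ` A \<subseteq> (+>) I ` ?K" by (rule image_mono)
    qed
    ultimately obtain k where k: "k \<in> ?K" "I +> x = I +> k" by blast
    have "x \<in> I +> k" using I.a_rcos_self[OF x] k(2) by simp
    then obtain i where i: "i \<in> I" "x = i \<oplus> k" unfolding a_r_coset_def' by blast
    have "i \<in> ?K" using genideal_self[OF IA] i(1) by blast
    then show "x \<in> ?K"
      unfolding i(2) using k(1) by (rule additive_subgroup.a_closed[OF ideal.axioms(1)[OF K]])
  next
    assume x_K: "x \<in> ?K"
    have "?K \<subseteq> {r \<in> carrier R. I +> r \<in> ?Q}"
    proof (rule genideal_minimal[OF h.ideal_vimage[OF Q]])
      have "I +> i \<in> ?Q" if "i \<in> I" for i
      proof -
        have "I +> i = I" using that by (rule I.a_rcos_const)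
        then show ?thesis
          using additive_subgroup.zero_closed[OF ideal.axioms(1)[OF Q]] unfolding zero_FactRing by metis
      qed
      moreover have "I +> r \<in> ?Q" if "r \<in> A" for r
        using h.S.genideal_self[OF hA] that by blast
      ultimately show "I \<union> A \<subseteq> {r \<in> carrier R. I +> r \<in> ?Q}"
        using IA by blast
    qed
    then show "I +> x \<in> ?Q" using x_K by blast
  qed
qed

section \<open>Merging the rows of a column\<close>

text \<open>
  The exponent of the generator of \<open>L_ideal\<close> that belongs to \<open>\<phi>\<close>, see \<open>monom_graph_monom\<close>.
\<close>

definition graph_monom :: "nat \<Rightarrow> (nat \<Rightarrow> nat) \<Rightarrow> (nat \<times> nat \<Rightarrow>\<^sub>0 nat)" where
  "graph_monom d \<phi> = (\<Sum>i\<in>{1..d}. Poly_Mapping.single (i, \<phi> i) 1)"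

text \<open>
  The set \<open>T\<close> contains the variables that have already been identified with the variable of the first
  row in the same column.
\<close>

definition merge :: "(nat \<times> nat) set \<Rightarrow> nat \<times> nat \<Rightarrow> nat \<times> nat" where
  "merge T v = (if v \<in> T then (1, snd v) else v)"

lemma monom_graph_monom: "monom (graph_monom d \<phi>) = (\<Prod>i\<in>{1..d}. X (i, \<phi> i))"
  by (simp add: graph_monom_def monom_sum X_def)

lemma lookup_var_image_graph_monom:
  "lookup (var_image f (graph_monom d \<phi>)) v = card {i \<in> {1..d}. f (i, \<phi> i) = v}"
proof -
  have "lookup (var_image f (graph_monom d \<phi>)) v = (\<Sum>i\<in>{1..d}. if f (i, \<phi> i) = v then 1 else 0)"
    unfolding graph_monom_def var_image_sum var_image_single lookup_sum lookup_single when_def ..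
  also have "\<dots> = card {i \<in> {1..d}. f (i, \<phi> i) = v}"
    by (simp add: sum.If_cases Int_def)
  finally show ?thesis .
qed

lemma lookup_graph_monom: "lookup (graph_monom d \<phi>) (i, c) = (if i \<in> {1..d} \<and> \<phi> i = c then 1 else 0)"
proof -
  have "lookup (graph_monom d \<phi>) (i, c) = (\<Sum>j\<in>{1..d}. if j = i then (if \<phi> i = c then 1 else 0) else 0)"
    unfolding graph_monom_def lookup_sum lookup_single when_def by (rule sum.cong) auto
  then show ?thesis by auto
qed

lemma graph_monom_dvd_iff:
  "mon_dvd (graph_monom d \<psi>) m \<longleftrightarrow> (\<forall>i\<in>{1..d}. (i, \<psi> i) \<in> keys m)"
  by (force simp: mon_dvd_def lookup_graph_monom in_keys_iff Suc_le_eq)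

lemma mdeg_graph_monom [simp]: "mdeg (graph_monom d \<phi>) = d"
  by (simp add: graph_monom_def)

lemma isotone_mapsD:
  assumes "\<phi> \<in> isotone_maps d n" "i \<in> {1..d}"
  shows "\<phi> i \<in> {1..n}" "j \<in> {1..d} \<Longrightarrow> i \<le> j \<Longrightarrow> \<phi> i \<le> \<phi> j"
  using assms by (auto simp: isotone_maps_def mono_on_def)

lemma isotone_mapsI:
  assumes "\<And>i. i \<in> {1..d} \<Longrightarrow> \<phi> i \<in> {1..n}" "\<And>i j. i \<in> {1..d} \<Longrightarrow> j \<in> {1..d} \<Longrightarrow> i \<le> j \<Longrightarrow> \<phi> i \<le> \<phi> j"
  shows "restrict \<phi> {1..d} \<in> isotone_maps d n"
  using assms by (auto simp: isotone_maps_def mono_on_def)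

lemma poset_ideal_HomD:
  assumes "poset_ideal_Hom d n J" "\<psi> \<in> J"
  shows "\<psi> \<in> isotone_maps d n"
    and "\<phi> \<in> isotone_maps d n \<Longrightarrow> (\<And>i. i \<in> {1..d} \<Longrightarrow> \<phi> i \<le> \<psi> i) \<Longrightarrow> \<phi> \<in> J"
  using assms by (auto simp: poset_ideal_Hom_def)

lemma finite_poset_ideal:
  assumes "poset_ideal_Hom d n J"
  shows "finite J"
proof (rule finite_subset)
  show "J \<subseteq> {1..d} \<rightarrow>\<^sub>E {1..n}" using assms by (auto simp: poset_ideal_Hom_def isotone_maps_def)
  show "finite ({1..d} \<rightarrow>\<^sub>E {1..n})" by (intro finite_PiE) auto
qed

lemma keys_graph_monom: "\<phi> \<in> isotone_maps d n \<Longrightarrow> keys (graph_monom d \<phi>) \<subseteq> {1..d} \<times> {1..n}"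
  using isotone_mapsD(1) by (fastforce simp: in_keys_iff lookup_graph_monom split: if_splits)

text \<open>
  The situation is that of a regular sequence in progress.  In column \<open>b\<close> the rows \<open>1, \<dots>, s\<close> are merged and
  row \<open>s + 1\<close> is next, the columns to the left are untouched, and the columns to the right are arbitrary.
  Since the generator of \<open>\<phi>\<close> contains the variable \<open>(s + 1, b)\<close> at most once, \<open>\<phi>\<close> itself works unless
  \<open>\<phi> (s + 1) = b\<close> and this variable does not divide \<open>m\<close>.  In that case \<open>\<psi>\<close> works unless it has too many
  values \<open>b\<close> in the first \<open>s\<close> rows, and then it exceeds \<open>b\<close> from row \<open>s + 1\<close> on.  So the minimum of \<open>\<phi>\<close> and
  \<open>\<psi>\<close> on the first \<open>s\<close> rows, continued by \<open>\<psi>\<close>, is isotone and below \<open>\<psi>\<close>.  It has no more values \<open>b\<close> than \<open>\<phi>\<close>.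
  Its variables to the left of column \<open>b\<close> come from \<open>\<phi>\<close> or \<open>\<psi>\<close>, and as these columns are untouched each
  of them occurs only once.
\<close>

lemma merged_column_exchange:
  assumes J: "poset_ideal_Hom d n J"
    and s: "1 \<le> s" "s < d"
    and T: "\<And>i. 1 \<le> i \<Longrightarrow> (i, b) \<in> T \<longleftrightarrow> 2 \<le> i \<and> i \<le> s" "\<And>i c. c < b \<Longrightarrow> (i, c) \<notin> T"
    and \<phi>: "\<phi> \<in> J" "mon_dvd (var_image (merge T) (graph_monom d \<phi>)) m'"
    and m': "lookup m' (1, b) \<le> lookup m (1, b)"
      "\<And>v. v \<noteq> (1, b) \<Longrightarrow> v \<noteq> (Suc s, b) \<Longrightarrow> lookup m' v = lookup m v"
    and \<psi>: "0 < lookup m (Suc s, b) \<or>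
      (\<exists>\<psi>\<in>J. mon_dvd (var_image (merge T) (graph_monom d \<psi>)) (m + Poly_Mapping.single (1, b) 1))"
  shows "\<exists>\<chi>\<in>J. mon_dvd (var_image (merge T) (graph_monom d \<chi>)) m"
proof -
  let ?S = "\<lambda>\<phi> v. {i \<in> {1..d}. merge T (i, \<phi> i) = v}"
  have dvd: "mon_dvd (var_image (merge T) (graph_monom d \<phi>)) m \<longleftrightarrow> (\<forall>v. card (?S \<phi> v) \<le> lookup m v)" for \<phi> m
    by (simp add: mon_dvd_def lookup_var_image_graph_monom)
  have S_first: "?S \<phi> (1, b) = {i \<in> {1..s}. \<phi> i = b}" for \<phi>
    using s T(1) by (fastforce simp: merge_def split: if_splits)
  have S_next: "?S \<phi> (Suc s, b) = (if \<phi> (Suc s) = b then {Suc s} else {})" for \<phi>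
    using s T(1)[of "Suc s"] by (auto simp: merge_def split: if_splits)
  have \<phi>_dvd: "card (?S \<phi> v) \<le> lookup m' v" for v using \<phi>(2) unfolding dvd by blast
  have \<phi>_m: "mon_dvd (var_image (merge T) (graph_monom d \<phi>)) m"
    if "\<phi> (Suc s) = b \<Longrightarrow> 0 < lookup m (Suc s, b)"
    unfolding dvd
  proof
    fix v
    consider "v = (1, b)" | "v = (Suc s, b)" | "v \<noteq> (1, b)" "v \<noteq> (Suc s, b)" by blast
    then show "card (?S \<phi> v) \<le> lookup m v"
    proof cases
      case 2
      then show ?thesis using that unfolding 2 S_next by (simp add: Suc_le_eq)
    qed (use \<phi>_dvd[of v] m' in auto)
  qed
  show ?thesis
  proof (cases "0 < lookup m (Suc s, b) \<or> \<phi> (Suc s) \<noteq> b")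
    case True
    then show ?thesis using \<phi>_m \<phi>(1) by blast
  next
    case False
    then have m0: "lookup m (Suc s, b) = 0" and \<phi>_s: "\<phi> (Suc s) = b" by auto
    obtain \<psi> where \<psi>_J: "\<psi> \<in> J"
      and \<psi>_dvd: "\<And>v. card (?S \<psi> v) \<le> lookup (m + Poly_Mapping.single (1, b) 1) v"
      using \<psi> less_irrefl[of "0::nat"] unfolding dvd m0 by blast
    have \<psi>_dvd': "card (?S \<psi> v) \<le> lookup m v" if "v \<noteq> (1, b)" for v
      using \<psi>_dvd[of v] that by (simp add: lookup_add lookup_single)
    show ?thesis
    proof (cases "card (?S \<psi> (1, b)) \<le> lookup m (1, b)")
      case True
      then have "card (?S \<psi> v) \<le> lookup m v" for v using \<psi>_dvd'[of v] by (cases "v = (1, b)") auto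
      then show ?thesis using \<psi>_J unfolding dvd by blast
    next
      case False
      then have "?S \<psi> (1, b) \<noteq> {}" by (metis card.empty le0)
      then obtain i0 where i0: "1 \<le> i0" "i0 \<le> s" "\<psi> i0 = b" unfolding S_first by auto
      note iso\<phi> = poset_ideal_HomD(1)[OF J \<phi>(1)] and iso\<psi> = poset_ideal_HomD(1)[OF J \<psi>_J]
      have "\<psi> (Suc s) \<noteq> b"
        using \<psi>_dvd'[of "(Suc s, b)"] m0 s unfolding S_next by (auto split: if_splits)
      moreover have "b \<le> \<psi> (Suc s)" using isotone_mapsD(2)[OF iso\<psi>, of i0 "Suc s"] i0 s by simp
      ultimately have \<psi>_s: "b < \<psi> (Suc s)" by simp
      have \<psi>_up: "b < \<psi> i" if "s < i" "i \<le> d" for i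
        using isotone_mapsD(2)[OF iso\<psi>, of "Suc s" i] that \<psi>_s by simp
      have \<phi>_down: "\<phi> i \<le> b" if "1 \<le> i" "i \<le> s" for i
        using isotone_mapsD(2)[OF iso\<phi>, of i "Suc s"] that \<phi>_s s by simp
      define \<chi> where "\<chi> = restrict (\<lambda>i. if i \<le> s then min (\<phi> i) (\<psi> i) else \<psi> i) {1..d}"
      have \<chi>: "\<chi> i = (if i \<le> s then min (\<phi> i) (\<psi> i) else \<psi> i)" if "i \<in> {1..d}" for i
        using that by (simp add: \<chi>_def)
      have "\<chi> \<in> isotone_maps d n"
        unfolding \<chi>_def
      proof (rule isotone_mapsI)
        fix i assume i: "i \<in> {1..d}"
        show "(if i \<le> s then min (\<phi> i) (\<psi> i) else \<psi> i) \<in> {1..n}"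
          using isotone_mapsD(1)[OF iso\<phi> i] isotone_mapsD(1)[OF iso\<psi> i] by auto
        fix j assume j: "j \<in> {1..d}" "i \<le> j"
        show "(if i \<le> s then min (\<phi> i) (\<psi> i) else \<psi> i) \<le> (if j \<le> s then min (\<phi> j) (\<psi> j) else \<psi> j)"
          using isotone_mapsD(2)[OF iso\<phi> i j] isotone_mapsD(2)[OF iso\<psi> i j] j(2) by auto
      qed
      then have "\<chi> \<in> J" by (rule poset_ideal_HomD(2)[OF J \<psi>_J]) (simp add: \<chi>)
      moreover have "card (?S \<chi> (r, c)) \<le> lookup m (r, c)" for r c
      proof -
        have snd_merge: "snd (merge T v) = snd v" for v by (simp add: merge_def)
        consider "c < b" | "c = b" "r = 1" | "c = b" "r \<noteq> 1" | "b < c" by linarith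
        then show ?thesis
        proof cases
          \<comment> \<open>untouched columns: one row at a time\<close>
          case 1
          have S_low: "?S \<eta> (r, c) = (if r \<in> {1..d} \<and> \<eta> r = c then {r} else {})" for \<eta>
            using T(2)[OF 1] snd_merge[of "(_, \<eta> _)"] by (auto simp: merge_def split: if_splits)
          show ?thesis
          proof (cases "r \<in> {1..d} \<and> \<chi> r = c")
            case True
            then have "r \<le> s" using \<psi>_up[of r] \<chi>[of r] 1 by (cases "r \<le> s") auto
            then have "\<phi> r = c \<or> \<psi> r = c" using True \<chi>[of r] by (auto simp: min_def split: if_splits)
            moreover have "card (?S \<phi> (r, c)) \<le> lookup m (r, c)" "card (?S \<psi> (r, c)) \<le> lookup m (r, c)"
              using \<phi>_dvd[of "(r, c)"] m'(2)[of "(r, c)"] \<psi>_dvd'[of "(r, c)"] 1 by auto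
            ultimately show ?thesis using True unfolding S_low by (auto split: if_splits)
          next
            case False
            then show ?thesis unfolding S_low by auto
          qed
        next
          \<comment> \<open>the merged variable of column \<open>b\<close>: compare with \<open>\<phi>\<close>\<close>
          case 2
          have "?S \<chi> (1, b) \<subseteq> ?S \<phi> (1, b)"
            unfolding S_first
          proof
            fix i assume "i \<in> {i \<in> {1..s}. \<chi> i = b}"
            then have i: "i \<in> {1..s}" "\<chi> i = b" by auto
            then have "b \<le> \<phi> i" using \<chi>[of i] s by auto
            then show "i \<in> {i \<in> {1..s}. \<phi> i = b}" using \<phi>_down[of i] i(1) by auto
          qed
          then have "card (?S \<chi> (1, b)) \<le> card (?S \<phi> (1, b))" by (intro card_mono) auto
          then show ?thesis using \<phi>_dvd[of "(1, b)"] m'(1) 2 by simp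
        next
          case 3
          have "merge T (i, \<chi> i) \<noteq> (r, b)" if i: "i \<in> {1..d}" for i
          proof
            assume *: "merge T (i, \<chi> i) = (r, b)"
            then have "\<chi> i = b" using snd_merge[of "(i, \<chi> i)"] by simp
            moreover from this have "i \<le> s" using \<psi>_up[of i] \<chi>[OF i] i by (cases "i \<le> s") auto
            ultimately have "i \<in> ?S \<chi> (1, b)" unfolding S_first using i by simp
            then show False using * 3 by simp
          qed
          then have "?S \<chi> (r, b) = {}" by blast
          then show ?thesis using 3 by (simp only: card.empty)
        next
          \<comment> \<open>columns to the right, merged or not: compare with \<open>\<psi>\<close>\<close>
          case 4
          have "?S \<chi> (r, c) \<subseteq> ?S \<psi> (r, c)"
          proof
            fix i assume "i \<in> ?S \<chi> (r, c)"
            then have i: "i \<in> {1..d}" "merge T (i, \<chi> i) = (r, c)" by auto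
            then have "\<chi> i = c" using snd_merge[of "(i, \<chi> i)"] by simp
            moreover from this have "\<not> i \<le> s" using \<phi>_down[of i] \<chi>[OF i(1)] i(1) 4 by auto
            ultimately show "i \<in> ?S \<psi> (r, c)" using i \<chi>[OF i(1)] by simp
          qed
          then have "card (?S \<chi> (r, c)) \<le> card (?S \<psi> (r, c))" by (intro card_mono) auto
          then show ?thesis using \<psi>_dvd'[of "(r, c)"] 4 by simp
        qed
      qed
      ultimately show ?thesis unfolding dvd by (auto intro!: bexI[of _ \<chi>])
    qed
  qed
qed

section \<open>The letterplace ideal and its projection\<close>

lemma L_ideal_eq:
  assumes J: "poset_ideal_Hom d n J"
  shows "(L_ideal d n J :: (nat \<times> nat, 'k::field) mpoly set)
    = monomial_span ({1..d} \<times> {1..n}) (graph_monom d ` J)"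
proof -
  have "(\<lambda>\<phi>. \<Prod>i\<in>{1..d}. X (i, \<phi> i) :: (nat \<times> nat, 'k) mpoly) ` J = monom ` graph_monom d ` J"
    unfolding image_image monom_graph_monom ..
  then show ?thesis
    unfolding L_ideal_def using keys_graph_monom poset_ideal_HomD(1)[OF J]
    by (simp only:) (rule Idl_monom, blast)
qed

text \<open>
  Sorting by the sum of the values puts every map after the maps below it.  The bound \<open>\<phi> j \<le> c\<close> for all
  \<open>j < i\<close> in the set \<open>T\<close> says that \<open>\<phi>\<close> stays isotone when its value at \<open>i\<close> is lowered to \<open>c\<close>.  It is written
  in this way so that \<open>i = 1\<close> is no exception.
\<close>

lemma linear_module_L_ideal:
  assumes J: "poset_ideal_Hom d n J"
  shows "linear_module ({1..d} \<times> {1..n}) d (vec1 ` (L_ideal d n J :: (nat \<times> nat, 'k::field) mpoly set))"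
proof -
  let ?V = "{1..d} \<times> {1..n}"
  obtain xs where xs: "distinct xs" "set xs = J"
    and sorted: "\<And>i j. i \<le> j \<Longrightarrow> j < length xs \<Longrightarrow> sum (xs ! i) {1..d} \<le> sum (xs ! j) {1..d}"
    using ex_sorted_enumeration[OF finite_poset_ideal[OF J], of "\<lambda>\<phi>. sum \<phi> {1..d}"] by blast
  have iso: "xs ! k \<in> isotone_maps d n" if "k < length xs" for k
    using poset_ideal_HomD(1)[OF J] xs(2) that nth_mem by blast
  define T where "T k = {(i, c). i \<in> {1..d} \<and> c \<in> {1..n} \<and> c < (xs ! k) i \<and>
    (\<forall>j\<in>{1..d}. j < i \<longrightarrow> (xs ! k) j \<le> c)}" for k
  have "linear_module ?V d (vec1 ` (monomial_span ?V ((\<lambda>k. graph_monom d (xs ! k)) ` {..<length xs})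
      :: (nat \<times> nat, 'k) mpoly set))"
  proof (rule linear_quotients[where T = T])
    fix k assume k: "k < length xs"
    let ?\<phi> = "xs ! k"
    show "keys (graph_monom d ?\<phi>) \<subseteq> ?V" by (rule keys_graph_monom[OF iso[OF k]])
    show "mdeg (graph_monom d ?\<phi>) = d" by simp
    have "T k \<subseteq> ?V" by (auto simp: T_def)
    then show "linear_module ?V 1 (vec1 ` (variable_ideal ?V (T k) :: (nat \<times> nat, 'k) mpoly set))"
      by (intro linear_module_variables finite_subset[of "T k" ?V]) auto
    show "(\<exists>j<k. mon_dvd (graph_monom d (xs ! j)) (graph_monom d ?\<phi> + m)) \<longleftrightarrow> keys m \<inter> T k \<noteq> {}" for m
    proof
      assume "\<exists>j<k. mon_dvd (graph_monom d (xs ! j)) (graph_monom d ?\<phi> + m)"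
      then obtain j where j: "j < k" and dvd: "mon_dvd (graph_monom d (xs ! j)) (graph_monom d ?\<phi> + m)" by blast
      let ?\<psi> = "xs ! j"
      have jl: "j < length xs" using j k by simp
      \<comment> \<open>an earlier map differs and has no larger sum, so it is smaller somewhere\<close>
      have "\<exists>i\<in>{1..d}. ?\<psi> i < ?\<phi> i"
      proof (rule ccontr)
        assume "\<not> (\<exists>i\<in>{1..d}. ?\<psi> i < ?\<phi> i)"
        then have le: "\<And>i. i \<in> {1..d} \<Longrightarrow> ?\<phi> i \<le> ?\<psi> i" by (meson not_le)
        have "sum ?\<phi> {1..d} = sum ?\<psi> {1..d}"
          using sum_mono[of "{1..d}" ?\<phi> ?\<psi>, OF le] sorted[of j k] j k by linarith
        then have "?\<phi> i = ?\<psi> i" if "i \<in> {1..d}" for i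
          using sum_mono_inv[OF _ le that] by simp
        then have "?\<phi> = ?\<psi>"
          using iso[OF k] iso[OF jl] by (intro PiE_ext[of _ "{1..d}" "\<lambda>_. {1..n}"]) (auto simp: isotone_maps_def)
        then show False using xs(1) j k jl by (simp add: nth_eq_iff_index_eq)
      qed
      then obtain i where i: "i \<in> {1..d}" "?\<psi> i < ?\<phi> i"
        and first: "\<And>i'. i' \<in> {1..d} \<Longrightarrow> ?\<psi> i' < ?\<phi> i' \<Longrightarrow> i \<le> i'"
        using exists_least_iff[of "\<lambda>i. i \<in> {1..d} \<and> ?\<psi> i < ?\<phi> i"] by (metis not_le)
      have "(i, ?\<psi> i) \<in> keys (graph_monom d ?\<phi> + m)"
        using dvd i(1) by (simp add: graph_monom_dvd_iff)
      then have "(i, ?\<psi> i) \<in> keys m"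
        using i by (auto simp: keys_add_nat in_keys_iff lookup_graph_monom)
      moreover have "?\<phi> j' \<le> ?\<psi> i" if j': "j' \<in> {1..d}" "j' < i" for j'
      proof -
        have "?\<phi> j' \<le> ?\<psi> j'" using first[OF j'(1)] j'(2) by (meson not_le)
        also have "\<dots> \<le> ?\<psi> i" using isotone_mapsD(2)[OF iso[OF jl] j'(1) i(1)] j'(2) by simp
        finally show ?thesis .
      qed
      ultimately have "(i, ?\<psi> i) \<in> keys m \<inter> T k"
        using i isotone_mapsD(1)[OF iso[OF jl] i(1)] by (auto simp: T_def)
      then show "keys m \<inter> T k \<noteq> {}" by blast
    next
      assume "keys m \<inter> T k \<noteq> {}"
      then obtain v where v: "v \<in> keys m" "v \<in> T k" by blast
      obtain i c where ic_eq: "v = (i, c)" by (cases v)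
      have ic: "(i, c) \<in> keys m" "i \<in> {1..d}" "c \<in> {1..n}" "c < ?\<phi> i"
        "\<And>j. j \<in> {1..d} \<Longrightarrow> j < i \<Longrightarrow> ?\<phi> j \<le> c"
        using v unfolding ic_eq T_def by simp_all
      let ?\<chi> = "restrict (?\<phi>(i := c)) {1..d}"
      note iso\<phi> = iso[OF k]
      have \<chi>_iso: "?\<chi> \<in> isotone_maps d n"
      proof (rule isotone_mapsI)
        fix l assume l: "l \<in> {1..d}"
        show "(?\<phi>(i := c)) l \<in> {1..n}" using isotone_mapsD(1)[OF iso\<phi> l] ic(3) by simp
        fix l' assume l': "l' \<in> {1..d}" "l \<le> l'"
        show "(?\<phi>(i := c)) l \<le> (?\<phi>(i := c)) l'"
          using isotone_mapsD(2)[OF iso\<phi> l l'] isotone_mapsD(2)[OF iso\<phi> ic(2) l'(1)] ic(4) ic(5)[OF l] l'(2)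
          by (cases "l = i"; cases "l' = i") auto
      qed
      moreover have le: "?\<chi> l \<le> ?\<phi> l" if "l \<in> {1..d}" for l using that ic(4) by simp
      moreover have "?\<phi> \<in> J" using xs(2) k nth_mem by blast
      ultimately have "?\<chi> \<in> J" using poset_ideal_HomD(2)[OF J] by blast
      then obtain j where j: "j < length xs" "xs ! j = ?\<chi>" using xs(2) by (metis in_set_conv_nth)
      have "sum ?\<chi> {1..d} < sum ?\<phi> {1..d}"
        by (rule sum_strict_mono_ex1) (use le ic(2,4) in auto)
      then have "j < k" using sorted[of k j] j by (metis not_le)
      moreover have "mon_dvd (graph_monom d ?\<chi>) (graph_monom d ?\<phi> + m)"
        unfolding graph_monom_dvd_iff
        using ic(1) by (auto simp: keys_add_nat in_keys_iff lookup_graph_monom)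
      ultimately show "\<exists>j<k. mon_dvd (graph_monom d (xs ! j)) (graph_monom d ?\<phi> + m)"
        using j(2) by auto
    qed
  qed
  moreover have "(\<lambda>k. graph_monom d (xs ! k)) ` {..<length xs} = graph_monom d ` J"
    unfolding xs(2)[symmetric] using nth_image[of "length xs" xs]
    by (simp add: image_image[of "graph_monom d" "(!) xs", symmetric] atLeast0LessThan)
  ultimately show ?thesis by (simp add: L_ideal_eq[OF J])
qed

lemma L_ideal_linear_resolution:
  assumes J: "poset_ideal_Hom d n J"
  shows "has_linear_resolution ({1..d} \<times> {1..n}) d (L_ideal d n J :: (nat \<times> nat, 'k::field) mpoly set)"
  unfolding L_ideal_def
proof (rule linear_module_imp_linear_resolution)
  show "linear_module ({1..d} \<times> {1..n}) d
      (vec1 ` (Idl\<^bsub>mpoly_ring ({1..d} \<times> {1..n})\<^esub> ((\<lambda>\<phi>. \<Prod>i\<in>{1..d}. X (i, \<phi> i) :: (nat \<times> nat, 'k) mpoly) ` J)))"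
    using linear_module_L_ideal[OF J] unfolding L_ideal_def .
  fix g :: "(nat \<times> nat, 'k) mpoly"
  assume "g \<in> (\<lambda>\<phi>. \<Prod>i\<in>{1..d}. X (i, \<phi> i)) ` J"
  then obtain \<phi> where "\<phi> \<in> J" "g = monom (graph_monom d \<phi>)" by (auto simp: monom_graph_monom)
  then show "vars g \<subseteq> {1..d} \<times> {1..n} \<and> homogeneous d g"
    using keys_graph_monom[OF poset_ideal_HomD(1)[OF J]] homogeneous_monom[of "graph_monom d \<phi>"] by simp
qed

lemma keys_projected_graph_monom:
  assumes J: "poset_ideal_Hom d n J" and m: "m \<in> var_image snd ` graph_monom d ` J"
  shows "keys m \<subseteq> {1..n}"
proof -
  from m obtain \<phi> where \<phi>: "\<phi> \<in> J" "m = var_image snd (graph_monom d \<phi>)" by blast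
  have "keys (graph_monom d \<phi>) \<subseteq> {1..d} \<times> {1..n}"
    by (rule keys_graph_monom[OF poset_ideal_HomD(1)[OF J \<phi>(1)]])
  then show ?thesis unfolding \<phi>(2) by (rule keys_var_image) auto
qed

lemma L_p2_ideal_eq:
  assumes J: "poset_ideal_Hom d n J"
  shows "(L_p2_ideal d n J :: (nat, 'k::field) mpoly set)
    = monomial_span {1..n} (var_image snd ` graph_monom d ` J)"
  unfolding L_p2_ideal_def L_ideal_eq[OF J]
  by (rule Idl_var_hom_monomial_span) (use keys_graph_monom poset_ideal_HomD(1)[OF J] in auto)

lemma associated_stable_ideal_eq:
  assumes J: "poset_ideal_Hom d n J"
  shows "(associated_stable_ideal d n J :: (nat, 'k::field) mpoly set)
    = Idl\<^bsub>mpoly_ring {1..n}\<^esub> (monom ` var_image snd ` graph_monom d ` J)" (is ?gens)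
    and "(associated_stable_ideal d n J :: (nat, 'k) mpoly set) = L_p2_ideal d n J"
proof -
  have "(\<Prod>i\<in>{1..d}. X (\<phi> i)) = (monom (var_image snd (graph_monom d \<phi>)) :: (nat, 'k) mpoly)" for \<phi>
    by (simp add: graph_monom_def monom_sum X_def)
  then show ?gens by (simp add: associated_stable_ideal_def image_image)
  then show "(associated_stable_ideal d n J :: (nat, 'k) mpoly set) = L_p2_ideal d n J"
    by (simp only: L_p2_ideal_eq[OF J] Idl_monom[OF keys_projected_graph_monom[OF J]])
qed

section \<open>Strong stability\<close>

text \<open>
  If the multiplicity of \<open>j + 1\<close> as a value of \<open>\<psi>\<close> does not exceed its exponent in \<open>m\<close>, then \<open>\<psi>\<close> itself
  works.  Otherwise \<open>\<psi>\<close> takes the value \<open>j + 1\<close>, and lowering it to \<open>j\<close> at the first such place keeps \<open>\<psi>\<close>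
  isotone.
\<close>

lemma strongly_stable_adjacent:
  assumes J: "poset_ideal_Hom d n J" and j: "1 \<le> j"
    and \<psi>: "\<psi> \<in> J" "mon_dvd (var_image snd (graph_monom d \<psi>)) (m + Poly_Mapping.single (Suc j) 1)"
  shows "\<exists>\<chi>\<in>J. mon_dvd (var_image snd (graph_monom d \<chi>)) (m + Poly_Mapping.single j 1)"
proof -
  let ?S = "\<lambda>\<phi> c. {i \<in> {1..d}. \<phi> i = c}"
  have dvd: "mon_dvd (var_image snd (graph_monom d \<phi>)) m \<longleftrightarrow> (\<forall>c. card (?S \<phi> c) \<le> lookup m c)" for \<phi> m
    unfolding mon_dvd_def lookup_var_image_graph_monom by simp
  have \<psi>_dvd: "card (?S \<psi> c) \<le> lookup m c + (if c = Suc j then 1 else 0)" for c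
    using \<psi>(2)[unfolded dvd, rule_format, of c] by (auto simp: lookup_add lookup_single split: if_splits)
  show ?thesis
  proof (cases "card (?S \<psi> (Suc j)) \<le> lookup m (Suc j)")
    case True
    have "card (?S \<psi> c) \<le> lookup (m + Poly_Mapping.single j 1) c" for c
      using \<psi>_dvd[of c] True by (cases "c = Suc j") (auto simp: lookup_add)
    then show ?thesis using \<psi>(1) unfolding dvd by blast
  next
    case False
    then have "?S \<psi> (Suc j) \<noteq> {}" by (metis card.empty le0)
    then have "\<exists>u. u \<in> {1..d} \<and> \<psi> u = Suc j" by blast
    then obtain u where u: "u \<in> {1..d}" "\<psi> u = Suc j"
      and first: "\<And>i. i < u \<Longrightarrow> \<not> (i \<in> {1..d} \<and> \<psi> i = Suc j)"
      unfolding exists_least_iff[of "\<lambda>u. u \<in> {1..d} \<and> \<psi> u = Suc j"] by blast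
    note iso = poset_ideal_HomD(1)[OF J \<psi>(1)]
    let ?f = "\<psi>(u := j)"
    have below: "\<psi> i \<le> j" if "i \<in> {1..d}" "i < u" for i
      using first[OF that(2)] isotone_mapsD(2)[OF iso that(1) u(1)] that u(2) by auto
    have "restrict ?f {1..d} \<in> isotone_maps d n"
    proof (rule isotone_mapsI)
      fix l assume l: "l \<in> {1..d}"
      show "?f l \<in> {1..n}"
        using isotone_mapsD(1)[OF iso l] isotone_mapsD(1)[OF iso u(1)] u(2) j by auto
      fix l' assume l': "l' \<in> {1..d}" "l \<le> l'"
      show "?f l \<le> ?f l'"
        using isotone_mapsD(2)[OF iso l l'] isotone_mapsD(2)[OF iso u(1) l'(1)] below[OF l] u(2) l'(2)
        by (cases "l = u"; cases "l' = u") auto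
    qed
    then have "restrict ?f {1..d} \<in> J"
      by (rule poset_ideal_HomD(2)[OF J \<psi>(1)]) (use u(2) in simp)
    moreover have "card (?S (restrict ?f {1..d}) c) \<le> lookup (m + Poly_Mapping.single j 1) c" for c
    proof -
      consider "c = j" | "c = Suc j" | "c \<noteq> j" "c \<noteq> Suc j" by blast
      then show ?thesis
      proof cases
        case 1
        have "?S (restrict ?f {1..d}) j = insert u (?S \<psi> j)" using u by auto
        then have "card (?S (restrict ?f {1..d}) j) \<le> Suc (card (?S \<psi> j))"
          by (simp add: card_insert_if)
        then show ?thesis using \<psi>_dvd[of j] 1 by (simp add: lookup_add)
      next
        case 2
        have "?S (restrict ?f {1..d}) (Suc j) = ?S \<psi> (Suc j) - {u}" using u by auto
        then have "card (?S (restrict ?f {1..d}) (Suc j)) = card (?S \<psi> (Suc j)) - 1"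
          using u by (simp add: card_Diff_singleton)
        then show ?thesis using \<psi>_dvd[of "Suc j"] 2 by (simp add: lookup_add)
      next
        case 3
        have "?S (restrict ?f {1..d}) c = ?S \<psi> c" using 3 u by auto
        then show ?thesis using \<psi>_dvd[of c] 3 by (simp add: lookup_add)
      qed
    qed
    ultimately show ?thesis unfolding dvd by (intro bexI[of _ "restrict ?f {1..d}"]) auto
  qed
qed

text \<open>
  Descending from \<open>j\<close> to \<open>i\<close> in steps of one avoids having to sort the values of a map after an exchange.
\<close>

lemma strongly_stable_L_p2_ideal:
  assumes J: "poset_ideal_Hom d n J"
  shows "strongly_stable n (L_p2_ideal d n J :: (nat, 'k::field) mpoly set)"
proof -
  have X_monom: "(X i :: (nat, 'k) mpoly) * monom m = monom (m + Poly_Mapping.single i 1)" for i m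
    by (simp add: X_def monom_mult add.commute)
  have mem: "monom m \<in> (L_p2_ideal d n J :: (nat, 'k) mpoly set)
      \<longleftrightarrow> keys m \<subseteq> {1..n} \<and> (\<exists>\<phi>\<in>J. mon_dvd (var_image snd (graph_monom d \<phi>)) m)" for m
    by (simp add: L_p2_ideal_eq[OF J] monomial_span_def)
  have "monomial_ideal {1..n} (L_p2_ideal d n J :: (nat, 'k) mpoly set)"
    unfolding monomial_ideal_def associated_stable_ideal_eq(2)[OF J, symmetric]
    using associated_stable_ideal_eq(1)[OF J] keys_projected_graph_monom[OF J] by blast
  moreover have "X i * monom m \<in> (L_p2_ideal d n J :: (nat, 'k) mpoly set)"
    if "keys m \<subseteq> {1..n}" "i \<in> {1..n}" "i < j" "X j * monom m \<in> (L_p2_ideal d n J :: (nat, 'k) mpoly set)" for m i j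
  proof -
    have "\<exists>\<phi>\<in>J. mon_dvd (var_image snd (graph_monom d \<phi>)) (m + Poly_Mapping.single i 1)"
      if "i \<le> j" "\<exists>\<phi>\<in>J. mon_dvd (var_image snd (graph_monom d \<phi>)) (m + Poly_Mapping.single j 1)"
      using that(1)
    proof (induction rule: inc_induct)
      case base
      then show ?case using that(2) .
    next
      case (step k)
      then show ?case using strongly_stable_adjacent[OF J, of k] \<open>i \<in> {1..n}\<close> by auto
    qed
    then show ?thesis
      using that unfolding X_monom mem by (auto simp: keys_add_nat split: if_splits)
  qed
  ultimately show ?thesis unfolding strongly_stable_def by blast
qed

section \<open>The regular sequence\<close>

definition row_difference :: "nat \<times> nat \<Rightarrow> (nat \<times> nat, 'k::field) mpoly" where
  "row_difference v = X (1, snd v) - X v"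

lemma vars_row_difference:
  assumes "v \<in> {2..d} \<times> {1..n}"
  shows "vars (row_difference v :: (nat \<times> nat, 'k::field) mpoly) \<subseteq> {1..d} \<times> {1..n}"
  unfolding row_difference_def by (rule vars_minus_in) (use assms in auto)

lemma Idl_L_ideal_row_differences:
  assumes J: "poset_ideal_Hom d n J" and T: "T \<subseteq> {2..d} \<times> {1..n}"
  shows "Idl\<^bsub>mpoly_ring ({1..d} \<times> {1..n})\<^esub> (L_ideal d n J \<union> row_difference ` T)
    = {p :: (nat \<times> nat, 'k::field) mpoly. vars p \<subseteq> {1..d} \<times> {1..n} \<and>
        var_hom (merge T) p \<in> monomial_span ({1..d} \<times> {1..n}) (var_image (merge T) ` graph_monom d ` J)}"
  unfolding L_ideal_eq[OF J]
proof (rule Idl_union_linear_forms)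
  let ?V = "{1..d} \<times> {1..n}"
  show "keys m \<subseteq> ?V" if "m \<in> graph_monom d ` J" for m
    using that keys_graph_monom poset_ideal_HomD(1)[OF J] by blast
  show "merge T v \<in> ?V" if "v \<in> ?V" for v using that by (cases v) (auto simp: merge_def)
  show "vars g \<subseteq> ?V \<and> var_hom (merge T) g = 0" if "g \<in> row_difference ` T" for g :: "(nat \<times> nat, 'k) mpoly"
  proof -
    from that obtain v where v: "v \<in> T" "g = X (1, snd v) - X v" by (auto simp: row_difference_def)
    have "(1, snd v) \<notin> T" using T by auto
    moreover have "v \<in> ?V" "(1, snd v) \<in> ?V" using v(1) T by auto
    ultimately show ?thesis using v(1) unfolding v(2)
      by (simp add: var_hom_minus merge_def vars_minus_in)
  qed
  show "merge T v = v \<or> X (merge T v) - X v \<in> (row_difference ` T :: (nat \<times> nat, 'k) mpoly set)" for v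
    by (auto simp: merge_def row_difference_def)
qed

text \<open>
  The section of \<open>p2_hat\<close> onto the first row turns the projection into the substitution that merges all rows.
\<close>

lemma p2_hat_in_L_p2_ideal_iff:
  fixes p :: "(nat \<times> nat, 'k::field) mpoly"
  assumes J: "poset_ideal_Hom d n J" and p: "vars p \<subseteq> {1..d} \<times> {1..n}"
  shows "p2_hat p \<in> L_p2_ideal d n J \<longleftrightarrow>
    p \<in> Idl\<^bsub>mpoly_ring ({1..d} \<times> {1..n})\<^esub> (L_ideal d n J \<union> row_difference ` ({2..d} \<times> {1..n}))"
proof -
  let ?V = "{1..d} \<times> {1..n}" and ?T = "{2..d} \<times> {1..n}"
  let ?\<sigma> = "\<lambda>c. (1::nat, c::nat)"
  have \<sigma>: "?\<sigma> (snd v) = merge ?T v" if "v \<in> ?V" for v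
    using that by (cases v) (auto simp: merge_def)
  have \<sigma>_hom: "var_hom ?\<sigma> (var_hom snd q) = var_hom (merge ?T) q"
    if "vars q \<subseteq> ?V" for q :: "(nat \<times> nat, 'k) mpoly"
    by (rule var_hom_comp[OF that]) (rule \<sigma>)
  have snd_hom: "var_hom snd (var_hom (merge ?T) q) = var_hom snd q"
    if "vars q \<subseteq> ?V" for q :: "(nat \<times> nat, 'k) mpoly"
    by (rule var_hom_comp[OF that]) (simp add: merge_def)
  have im: "var_image ?\<sigma> (var_image snd m) = var_image (merge ?T) m"
    "var_image snd (var_image (merge ?T) m) = var_image snd m" if "keys m \<subseteq> ?V" for m
    using \<sigma>_hom[of "monom m"] snd_hom[of "monom m"] that
    unfolding var_hom_monom vars_monom monom_inject by simp_all
  have keysJ: "keys (graph_monom d \<phi>) \<subseteq> ?V" if "\<phi> \<in> J" for \<phi>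
    by (rule keys_graph_monom[OF poset_ideal_HomD(1)[OF J that]])
  have imJ: "var_image ?\<sigma> ` var_image snd ` graph_monom d ` J = var_image (merge ?T) ` graph_monom d ` J"
    "var_image snd ` var_image (merge ?T) ` graph_monom d ` J = var_image snd ` graph_monom d ` J"
    unfolding image_image
    by (rule image_cong[OF refl], rule im(1), erule keysJ)
      (rule image_cong[OF refl], rule im(2), erule keysJ)
  have "p2_hat p \<in> L_p2_ideal d n J \<longleftrightarrow>
      var_hom (merge ?T) p \<in> monomial_span ?V (var_image (merge ?T) ` graph_monom d ` J)"
  proof
    assume "p2_hat p \<in> L_p2_ideal d n J"
    then have "p2_hat p \<in> monomial_span {1..n} (var_image snd ` graph_monom d ` J)"
      unfolding L_p2_ideal_eq[OF J] .
    then have "var_hom ?\<sigma> (p2_hat p) \<in> monomial_span UNIV (var_image ?\<sigma> ` var_image snd ` graph_monom d ` J)"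
      by (rule var_hom_monomial_span) simp
    then have "var_hom (merge ?T) p \<in> monomial_span UNIV (var_image (merge ?T) ` graph_monom d ` J)"
      unfolding \<sigma>_hom[OF p] imJ .
    moreover have "vars (var_hom (merge ?T) p) \<subseteq> ?V"
      by (rule vars_var_hom[OF p]) (auto simp: merge_def)
    ultimately show "var_hom (merge ?T) p \<in> monomial_span ?V (var_image (merge ?T) ` graph_monom d ` J)"
      by (simp add: monomial_span_def)
  next
    assume "var_hom (merge ?T) p \<in> monomial_span ?V (var_image (merge ?T) ` graph_monom d ` J)"
    then have "var_hom snd (var_hom (merge ?T) p)
        \<in> monomial_span {1..n} (var_image snd ` var_image (merge ?T) ` graph_monom d ` J)"
      by (rule var_hom_monomial_span) auto
    then show "p2_hat p \<in> L_p2_ideal d n J"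
      unfolding L_p2_ideal_eq[OF J] snd_hom[OF p] imJ .
  qed
  then show ?thesis using p Idl_L_ideal_row_differences[OF J order_refl, where 'k = 'k] by simp
qed

text \<open>
  Columns from right to left and, within a column, rows from top to bottom.
\<close>

lemma regular_row_differences:
  assumes J: "poset_ideal_Hom d n J" and d: "1 \<le> d"
  defines "R \<equiv> mpoly_ring ({1..d} \<times> {1..n}) :: (nat \<times> nat, 'k::field) mpoly ring"
  obtains vs where "set vs = {2..d} \<times> {1..n}"
    "regular_sequence (R Quot L_ideal d n J) (map (\<lambda>v. L_ideal d n J +>\<^bsub>R\<^esub> row_difference v) vs)"
proof -
  let ?V = "{1..d} \<times> {1..n}" and ?A = "{2..d} \<times> {1..n}"
  let ?L = "L_ideal d n J :: (nat \<times> nat, 'k) mpoly set"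
  let ?key = "\<lambda>v. (n - snd v) * Suc d + fst v"
  let ?h = "\<lambda>p. ?L +>\<^bsub>R\<^esub> p"
  let ?W = "\<lambda>T. var_image (merge T) ` graph_monom d ` J"
  interpret R: ring R unfolding R_def by (rule mpoly_ring_ring)
  have L: "ideal ?L R" unfolding R_def L_ideal_eq[OF J] by (rule ideal_monomial_span)
  interpret L: ideal ?L R by (rule L)
  \<comment> \<open>row numbers are smaller than \<open>Suc d\<close>, so the key orders by column first\<close>
  have key_less: "?key (i, b) < ?key (i', c)" if "c < b" "b \<le> n" "i \<le> d" for i i' b c
  proof -
    have "?key (i, b) < Suc (n - b) * Suc d" using that by simp
    also have "\<dots> \<le> (n - c) * Suc d" using that by (intro mult_right_mono) auto
    finally show ?thesis by simp
  qed
  have inj: "inj_on ?key ?A"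
  proof (rule inj_onI)
    fix v w assume v: "v \<in> ?A" "w \<in> ?A" "?key v = ?key w"
    obtain i b i' c where vw: "v = (i, b)" "w = (i', c)" by (cases v, cases w)
    have "b = c" using key_less[of c b i i'] key_less[of b c i' i] v unfolding vw
      by (cases b c rule: linorder_cases) auto
    then show "v = w" using v(3) vw by simp
  qed
  obtain vs where vs: "distinct vs" "set vs = ?A"
    and sorted: "\<And>i j. i \<le> j \<Longrightarrow> j < length vs \<Longrightarrow> ?key (vs ! i) \<le> ?key (vs ! j)"
    using ex_sorted_enumeration[of ?A ?key] by auto
  let ?fs = "map (\<lambda>v. ?h (row_difference v)) vs"
  have carrier: "row_difference v \<in> carrier R" if "v \<in> ?A" for v
    using vars_row_difference[OF that] unfolding R_def by simp
  have mem_iff: "?h p \<in> Idl\<^bsub>R Quot ?L\<^esub> (set (map (\<lambda>v. ?h (row_difference v)) ws)) \<longleftrightarrow>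
      var_hom (merge (set ws)) p \<in> monomial_span ?V (?W (set ws))"
    if "set ws \<subseteq> ?A" "vars p \<subseteq> ?V" for ws p
  proof -
    have ws: "set (map (\<lambda>v. ?h (row_difference v)) ws) = ?h ` row_difference ` set ws" by auto
    have sub: "row_difference ` set ws \<subseteq> carrier R" using carrier that(1) by blast
    have "p \<in> carrier R" using that(2) by (simp add: R_def)
    then have "?h p \<in> Idl\<^bsub>R Quot ?L\<^esub> (set (map (\<lambda>v. ?h (row_difference v)) ws)) \<longleftrightarrow>
        p \<in> Idl\<^bsub>R\<^esub> (?L \<union> row_difference ` set ws)"
      unfolding ws by (rule R.Idl_quotient_iff[OF L sub])
    then show ?thesis
      using Idl_L_ideal_row_differences[OF J that(1), where 'k = 'k] that(2) unfolding R_def by simp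
  qed
  have "set ?fs \<subseteq> carrier (R Quot ?L)"
    using carrier vs(2) ring_hom_closed[OF L.rcos_ring_hom] by auto
  moreover have "Idl\<^bsub>R Quot ?L\<^esub> (set ?fs) \<noteq> carrier (R Quot ?L)"
  proof
    assume "Idl\<^bsub>R Quot ?L\<^esub> (set ?fs) = carrier (R Quot ?L)"
    \<comment> \<open>otherwise a generator, which has degree \<open>d\<close>, would divide 1\<close>
    then have "?h 1 \<in> Idl\<^bsub>R Quot ?L\<^esub> (set ?fs)"
      using ring_hom_closed[OF L.rcos_ring_hom, of 1] unfolding R_def by simp
    then have "var_hom (merge (set vs)) 1 \<in> (monomial_span ?V (?W (set vs)) :: (nat \<times> nat, 'k) mpoly set)"
      using mem_iff[of vs 1] vs(2) by simp
    then obtain \<phi> where "mon_dvd (var_image (merge (set vs)) (graph_monom d \<phi>)) 0"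
      by (auto simp: monomial_span_def)
    from mon_dvd_diff[OF this] have "mdeg (var_image (merge (set vs)) (graph_monom d \<phi>)) = 0"
      by (metis mdeg_add mdeg_zero add_is_0)
    then show False using d by simp
  qed
  moreover have "C \<in> Idl\<^bsub>R Quot ?L\<^esub> (set (take j ?fs))"
    if j: "j < length ?fs" and C: "C \<in> carrier (R Quot ?L)"
      and prod: "?fs ! j \<otimes>\<^bsub>R Quot ?L\<^esub> C \<in> Idl\<^bsub>R Quot ?L\<^esub> (set (take j ?fs))" for j C
  proof -
    have jl: "j < length vs" using j by simp
    let ?T = "set (take j vs)"
    have take: "take j ?fs = map (\<lambda>v. ?h (row_difference v)) (take j vs)" by (simp add: take_map)
    have T_A: "?T \<subseteq> ?A" unfolding vs(2)[symmetric] by (rule set_take_subset)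
    obtain p where p: "vars p \<subseteq> ?V" "C = ?h p"
      using C unfolding R_def by (auto simp: FactRing_def A_RCOSETS_def')
    obtain r b where rb: "vs ! j = (r, b)" by (cases "vs ! j")
    have "(r, b) \<in> ?A" using rb vs(2) jl nth_mem by metis
    then obtain s where s: "r = Suc s" "1 \<le> s" "s < d" and b: "b \<in> {1..n}"
      by (cases r) auto
    have T: "?T = {v \<in> ?A. ?key v < ?key (Suc s, b)}"
      using set_take_sorted[OF sorted vs(1) inj[folded vs(2)] jl] vs(2) rb s(1) by simp
    have T_b: "(i, b) \<in> ?T \<longleftrightarrow> 2 \<le> i \<and> i \<le> s" for i
      unfolding T using s b by auto
    have T_less: "(i, c) \<notin> ?T" if "c < b" for i c
      using key_less[of c b "Suc s" i] that b s unfolding T by auto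
    have not_T: "(1, b) \<notin> ?T" "(Suc s, b) \<notin> ?T" using T_b by auto
    let ?\<mu> = "var_hom (merge ?T) :: (nat \<times> nat, 'k) mpoly \<Rightarrow> _"
    let ?f = "row_difference (Suc s, b) :: (nat \<times> nat, 'k) mpoly"
    have f: "?f = X (1, b) - X (Suc s, b)" "?\<mu> ?f = ?f"
      using not_T by (simp_all add: row_difference_def var_hom_minus merge_def)
    have f_carrier: "vars ?f \<subseteq> ?V" using carrier[of "(Suc s, b)"] s b unfolding R_def by simp
    have "?fs ! j \<otimes>\<^bsub>R Quot ?L\<^esub> C = ?h (?f * p)"
    proof -
      have "?h (?f \<otimes>\<^bsub>R\<^esub> p) = ?h ?f \<otimes>\<^bsub>R Quot ?L\<^esub> ?h p"
        using ring_hom_mult[OF L.rcos_ring_hom, of ?f p] f_carrier p(1) unfolding R_def by simp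
      then show ?thesis using jl rb s(1) p(2) unfolding R_def by simp
    qed
    then have "?\<mu> (?f * p) \<in> monomial_span ?V (?W ?T)"
      using prod mem_iff[OF T_A, of "?f * p"] p(1) f_carrier unfolding take by (simp add: vars_mult_in)
    then have prod': "(X (1, b) - X (Suc s, b)) * ?\<mu> p \<in> monomial_span ?V (?W ?T)"
      unfolding var_hom_mult f(2) unfolding f(1) .
    define U where "U = {m. \<exists>\<phi>\<in>J. mon_dvd (var_image (merge ?T) (graph_monom d \<phi>)) m}"
    have "keys (?\<mu> p) \<subseteq> U"
    proof (rule difference_of_variables_nonzerodivisor)
      show "(1, b) \<noteq> (Suc s, b)" using s by simp
      show "keys ((X (1, b) - X (Suc s, b)) * ?\<mu> p) \<subseteq> U"
        using prod' by (auto simp: monomial_span_def U_def)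
      fix m m' assume m': "m' \<in> U" "lookup m' (1, b) \<le> lookup m (1, b)"
        "\<And>v. v \<noteq> (1, b) \<Longrightarrow> v \<noteq> (Suc s, b) \<Longrightarrow> lookup m' v = lookup m v"
        and m: "0 < lookup m (Suc s, b) \<or> m + Poly_Mapping.single (1, b) 1 \<in> U"
      from m'(1) obtain \<phi> where \<phi>: "\<phi> \<in> J" "mon_dvd (var_image (merge ?T) (graph_monom d \<phi>)) m'"
        unfolding U_def by blast
      show "m \<in> U"
        unfolding U_def mem_Collect_eq
      proof (rule merged_column_exchange[OF J s(2,3) T_b T_less \<phi> m'(2,3)])
        show "0 < lookup m (Suc s, b) \<or>
          (\<exists>\<psi>\<in>J. mon_dvd (var_image (merge ?T) (graph_monom d \<psi>)) (m + Poly_Mapping.single (1, b) 1))"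
          using m unfolding U_def by simp
      qed
    qed
    moreover have "vars (?\<mu> p) \<subseteq> ?V"
      by (rule vars_var_hom[OF p(1)]) (use d in \<open>auto simp: merge_def\<close>)
    ultimately have "?\<mu> p \<in> monomial_span ?V (?W ?T)"
      by (auto simp: monomial_span_def U_def)
    then show ?thesis using mem_iff[OF T_A p(1)] p(2) unfolding take by simp
  qed
  ultimately have "regular_sequence (R Quot ?L) ?fs"
    unfolding regular_sequence_def by blast
  then show thesis using vs(2) that by blast
qed

lemma quotient_by_row_differences:
  assumes J: "poset_ideal_Hom d n J" and d: "1 \<le> d"
  shows "quotient_by_regular_sequence
    (mpoly_ring ({1..d} \<times> {1..n}) Quot (L_ideal d n J :: (nat \<times> nat, 'k::field) mpoly set))
    (mpoly_ring {1..n} Quot (L_p2_ideal d n J :: (nat, 'k) mpoly set))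
    (induced_quot_map (mpoly_ring {1..n}) (L_p2_ideal d n J) p2_hat)"
proof -
  let ?V = "{1..d} \<times> {1..n}"
  define R where "R = (mpoly_ring ?V :: (nat \<times> nat, 'k) mpoly ring)"
  define S where "S = (mpoly_ring {1..n} :: (nat, 'k) mpoly ring)"
  define L where "L = (L_ideal d n J :: (nat \<times> nat, 'k) mpoly set)"
  define K where "K = (L_p2_ideal d n J :: (nat, 'k) mpoly set)"
  let ?q = "induced_quot_map S K p2_hat"
  have hom: "p2_hat \<in> ring_hom R S" unfolding R_def S_def by (rule var_hom_ring_hom) auto
  have L: "ideal L R" unfolding R_def L_def L_ideal_eq[OF J] by (rule ideal_monomial_span)
  have K: "ideal K S" unfolding S_def K_def L_p2_ideal_eq[OF J] by (rule ideal_monomial_span)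
  interpret L: ideal L R by (rule L)
  interpret K: ideal K S by (rule K)
  have mem: "p2_hat p \<in> K \<longleftrightarrow> p \<in> Idl\<^bsub>R\<^esub> (L \<union> row_difference ` ({2..d} \<times> {1..n}))"
    if "p \<in> carrier R" for p
    using p2_hat_in_L_p2_ideal_iff[OF J, of p] that unfolding R_def K_def L_def by simp
  have rd: "row_difference ` ({2..d} \<times> {1..n}) \<subseteq> carrier R"
  proof
    fix g assume "g \<in> (row_difference ` ({2..d} \<times> {1..n}) :: (nat \<times> nat, 'k) mpoly set)"
    then obtain v where "v \<in> {2..d} \<times> {1..n}" "g = row_difference v" by blast
    then show "g \<in> carrier R" unfolding R_def carrier_mpoly_ring by (simp only: vars_row_difference)
  qed
  have LK: "p2_hat ` L \<subseteq> K"
    using mem L.a_subset L.genideal_self[of "L \<union> row_difference ` ({2..d} \<times> {1..n})"] rd by auto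
  have q: "?q (L +>\<^bsub>R\<^esub> p) = K +>\<^bsub>S\<^esub> p2_hat p" if "p \<in> carrier R" for p
    by (rule induced_quot_map_coset[OF L K hom LK that])
  have carrier: "carrier (R Quot L) = (\<lambda>p. L +>\<^bsub>R\<^esub> p) ` carrier R"
    "carrier (S Quot K) = (\<lambda>p. K +>\<^bsub>S\<^esub> p) ` carrier S"
    by (auto simp: FactRing_def A_RCOSETS_def')
  note hL = L.rcos_ring_hom and hK = K.rcos_ring_hom
  have "?q \<in> ring_hom (R Quot L) (S Quot K)"
  proof (rule ring_hom_memI)
    fix A assume "A \<in> carrier (R Quot L)"
    then obtain p where p: "p \<in> carrier R" "A = L +>\<^bsub>R\<^esub> p" unfolding carrier by blast
    show "?q A \<in> carrier (S Quot K)"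
      unfolding p(2) q[OF p(1)] using ring_hom_closed[OF hom p(1)] by (rule ring_hom_closed[OF hK])
    fix B assume "B \<in> carrier (R Quot L)"
    then obtain r where r: "r \<in> carrier R" "B = L +>\<^bsub>R\<^esub> r" unfolding carrier by blast
    note closed = ring_hom_closed[OF hom p(1)] ring_hom_closed[OF hom r(1)]
    show "?q (A \<otimes>\<^bsub>R Quot L\<^esub> B) = ?q A \<otimes>\<^bsub>S Quot K\<^esub> ?q B"
      unfolding p(2) r(2) q[OF p(1)] q[OF r(1)] ring_hom_mult[OF hL p(1) r(1), symmetric]
        q[OF L.m_closed[OF p(1) r(1)]] ring_hom_mult[OF hom p(1) r(1)] ring_hom_mult[OF hK closed] ..
    show "?q (A \<oplus>\<^bsub>R Quot L\<^esub> B) = ?q A \<oplus>\<^bsub>S Quot K\<^esub> ?q B"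
      unfolding p(2) r(2) q[OF p(1)] q[OF r(1)] ring_hom_add[OF hL p(1) r(1), symmetric]
        q[OF L.a_closed[OF p(1) r(1)]] ring_hom_add[OF hom p(1) r(1)] ring_hom_add[OF hK closed] ..
  next
    show "?q \<one>\<^bsub>R Quot L\<^esub> = \<one>\<^bsub>S Quot K\<^esub>"
      unfolding ring_hom_one[OF hL, symmetric] q[OF L.one_closed] ring_hom_one[OF hom] ring_hom_one[OF hK] ..
  qed
  moreover have "?q ` carrier (R Quot L) = carrier (S Quot K)"
  proof -
    have "p2_hat ` carrier R = carrier S"
    proof
      show "p2_hat ` carrier R \<subseteq> carrier S" using ring_hom_closed[OF hom] by blast
      show "carrier S \<subseteq> p2_hat ` carrier R"
      proof
        fix p assume "p \<in> carrier S"
        then have p: "vars p \<subseteq> {1..n}" by (simp add: S_def)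
        let ?p = "var_hom (\<lambda>c. (1::nat, c)) p"
        have "?p \<in> carrier R"
          using vars_var_hom[OF p, of "\<lambda>c. (1, c)" ?V] d by (simp add: R_def)
        moreover have "p2_hat ?p = p"
          using var_hom_comp[OF p, of snd "\<lambda>c. (1::nat, c)" "\<lambda>c. c"] var_hom_id[OF p, of "\<lambda>c. c"] by simp
        ultimately show "p \<in> p2_hat ` carrier R" by (metis image_eqI)
      qed
    qed
    then have "carrier (S Quot K) = (\<lambda>p. K +>\<^bsub>S\<^esub> p2_hat p) ` carrier R"
      unfolding carrier by (metis image_image)
    also have "\<dots> = ?q ` carrier (R Quot L)"
      unfolding carrier image_image by (rule image_cong) (simp_all add: q)
    finally show ?thesis by simp
  qed
  moreover obtain vs where vs: "set vs = {2..d} \<times> {1..n}"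
    and reg: "regular_sequence (R Quot L) (map (\<lambda>v. L +>\<^bsub>R\<^esub> row_difference v) vs)"
    using regular_row_differences[OF J d, where 'k = 'k] unfolding R_def L_def by blast
  let ?fs = "map (\<lambda>v. L +>\<^bsub>R\<^esub> row_difference v) vs"
  have "a_kernel (R Quot L) (S Quot K) ?q = Idl\<^bsub>R Quot L\<^esub> (set ?fs)"
  proof -
    have fs: "set ?fs = (\<lambda>p. L +>\<^bsub>R\<^esub> p) ` row_difference ` ({2..d} \<times> {1..n})" using vs by auto
    have Idl_sub: "Idl\<^bsub>R Quot L\<^esub> (set ?fs) \<subseteq> carrier (R Quot L)"
    proof -
      interpret Q: ring "R Quot L" by (rule L.quotient_is_ring)
      have "set ?fs \<subseteq> carrier (R Quot L)" using reg by (simp add: regular_sequence_def)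
      from Q.genideal_ideal[OF this] show ?thesis by (rule ideal.Icarr[THEN subsetI])
    qed
    have "?q C = \<zero>\<^bsub>S Quot K\<^esub> \<longleftrightarrow> C \<in> Idl\<^bsub>R Quot L\<^esub> (set ?fs)" if "C \<in> carrier (R Quot L)" for C
    proof -
      obtain p where p: "p \<in> carrier R" "C = L +>\<^bsub>R\<^esub> p" using \<open>C \<in> _\<close> unfolding carrier by blast
      have "?q C = \<zero>\<^bsub>S Quot K\<^esub> \<longleftrightarrow> p2_hat p \<in> K"
        unfolding p(2) q[OF p(1)] zero_FactRing
        using K.a_rcos_const K.rcos_const_imp_mem ring_hom_closed[OF hom p(1)] by blast
      also have "\<dots> \<longleftrightarrow> C \<in> Idl\<^bsub>R Quot L\<^esub> (set ?fs)"
        unfolding mem[OF p(1)] fs p(2) using L.Idl_quotient_iff[OF L rd p(1)] by blast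
      finally show ?thesis .
    qed
    then show ?thesis unfolding a_kernel_def' using Idl_sub by blast
  qed
  ultimately have "quotient_by_regular_sequence (R Quot L) (S Quot K) ?q"
    unfolding quotient_by_regular_sequence_def using reg by blast
  then show ?thesis unfolding R_def S_def L_def K_def .
qed

theorem corollary6p1:
  fixes d n :: nat and J :: "(nat \<Rightarrow> nat) set"
  assumes "d \<ge> 1" and "n \<ge> 1" and "poset_ideal_Hom d n J"
  shows "has_linear_resolution ({1..d} \<times> {1..n}) d (L_ideal d n J :: (nat \<times> nat, 'k::field) mpoly set)
    \<and> quotient_by_regular_sequence
        (mpoly_ring ({1..d} \<times> {1..n}) Quot (L_ideal d n J :: (nat \<times> nat, 'k) mpoly set))
        (mpoly_ring {1..n} Quot (L_p2_ideal d n J :: (nat, 'k) mpoly set))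
        (induced_quot_map (mpoly_ring {1..n}) (L_p2_ideal d n J) p2_hat)
    \<and> strongly_stable n (L_p2_ideal d n J :: (nat, 'k) mpoly set)
    \<and> (L_p2_ideal d n J :: (nat, 'k) mpoly set) = associated_stable_ideal d n J"
proof (intro conjI)
  show "(L_p2_ideal d n J :: (nat, 'k) mpoly set) = associated_stable_ideal d n J"
    by (rule associated_stable_ideal_eq(2)[OF assms(3), symmetric])
qed (rule L_ideal_linear_resolution[OF assms(3)] quotient_by_row_differences[OF assms(3,1)]
    strongly_stable_L_p2_ideal[OF assms(3)])+

end
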